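(* Let $\iota\in[K]$ be the initial colour of an edge iterated graph system whose degree matrix $\mathbf N$ and mass matrix $\mathbf M$ are primitive-Frobenius, with degree scaling limit $(\Xi_\iota,\hat\deg_{\Xi_\iota})$. If $\Lambda_{\mathcal U_\iota}>1$, then \[ \mathscr D(\Xi_\iota,\hat\deg_{\Xi_\iota})=\left\{\frac{\log\Lambda_{\mathbf M}^{\deg,\mathrm{eff}}(Q)}{\log\Lambda_{\mathcal U_\iota}}:Q\in\mathscr K_{\deg}(\iota)\right\}. \] Consequently, $\Xi_\iota$ satisfies the BEDM condition if and only if it is finite discrete multiscale-free.
   Context: Conventions: $[N]=\{1,\dots,N\}$; $\|\cdot\|_1$ the $\ell^1$ norm; $\rho$ spectral radius; $f\asymp g$ means $f(m)/g(m)$ converges to a constant in $(0,\infty)$. EIGS: $K\ge1$ colours; for $i\in[K]$, $R_i$ is a finite connected directed graph with edges coloured in $[K]$ and planting vertices $\beta_i^+,\beta_i^-$ at undirected distance $\ge2$. $\Xi_\iota^0$ is a single directed edge of colour $\iota$; $\Xi_\iota^{n+1}$ replaces each edge $(a,b)$ of colour $i$ of $\Xi_\iota^n$ by a fresh copy of $R_i$ with $\beta_i^+=a$, $\beta_i^-=b$. Vertex sets are nested; a vertex is born in generation $m$ if it first appears in $\Xi_\iota^m$. Matrices: $[\mathbf M]_{ik}$ = number of colour-$k$ edges in $R_i$. For a vertex $v$ of a coloured digraph $G$, $\boldsymbol\kappa_G(v)\in\mathbb N^{1\times 2K}$ has entry $2i-1$ = number of outgoing colour-$i$ edges at $v$ and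 entry $2i$ = number of incoming colour-$i$ edges. $\mathbf N\in\mathbb N^{2K\times 2K}$ has rows $2i-1,2i$ equal to $\boldsymbol\kappa_{R_i}(\beta_i^+),\boldsymbol\kappa_{R_i}(\beta_i^-)$. Frobenius notions (nonnegative square $\mathbf X$): $a\rightsquigarrow b$ iff $[\mathbf X^n]_{ab}>0$ for some $n\ge0$; $\mathfrak r_{\mathbf X}(a)$ = indices reachable from $a$; blocks = mutual-reachability classes with diagonal blocks $\mathbf B_k(\mathbf X)$; $\mathfrak R_{\mathbf X}(a)$ = blocks reachable from the block of $a$; primitive-Frobenius = every diagonal block primitive. $\varkappa_{\mathbf X}(a)$ = maximum over chains of distinct blocks $k_0,\dots,k_L$ ($k_0$ the block of $a$, each reaching the next) of the number of $r$ with $\rho(\mathbf B_{k_r}(\mathbf X))=\max_{\ell\in\mathfrak R_{\mathbf X}(a)}\rho(\mathbf B_\ell(\mathbf X))$. Birth types: $\mathcal U_\iota=\{\boldsymbol\kappa_{\Xi_\iota^0}(v):v\in V(\Xi_\iota^0)\}\cup\bigcup_{j\in\mathfrak r_{\mathbf M}(\iota)}\{\boldsymbol\kappa_{R_j}(w):w\in V(R_j)\setminus\{\beta_j^\pm\}\}$; birth type of a vertex born in generation $m$ is its $\boldsymbol\kappa$ vector in $\Xi_\iota^m$. For nonzero $\mathbf u$: $\lambda(\mathbf u)=\max_{a:[\mathbf u]_a>0}\max_{\ell\in\mathfrak R_{\mathbf N}(a)}\rho(\mathbf B_\ell(\mathbf N))$; $\tau(\mathbf u)=\max\{\varkappa_{\mathbf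 N}(a):[\mathbf u]_a>0,\ \max_{\ell\in\mathfrak R_{\mathbf N}(a)}\rho(\mathbf B_\ell(\mathbf N))=\lambda(\mathbf u)\}$; $\Lambda_{\mathcal U_\iota}=\max_{\mathbf u\in\mathcal U_\iota}\lambda(\mathbf u)$; $\tau_{\deg}(\iota)=\max\{\tau(\mathbf u):\lambda(\mathbf u)=\Lambda_{\mathcal U_\iota}\}$; $c_{\deg}(\mathbf u)=\lim_n\|\mathbf u\mathbf N^n\|_1/(n^{\tau(\mathbf u)-1}\lambda(\mathbf u)^n)\in(0,\infty)$. Degree scaling limit: $\Delta(G)$ = maximum degree; $\hat\deg_{\Xi_\iota}(v)=\lim_n\deg_{\Xi_\iota^n}(v)/\Delta(\Xi_\iota^n)$ for $v\in\bigcup_nV(\Xi_\iota^n)$; $P(\ell)=|\{v:\hat\deg_{\Xi_\iota}(v)=\ell\}|$. Classes: $B_{\mathbf u}(m)$ = number of vertices born in generation $m$ with birth type $\mathbf u$; $I_{\mathrm{deg,surv}}(\iota)$ = nonzero $\mathbf u\in\mathcal U_\iota$ with $\lambda(\mathbf u)=\Lambda_{\mathcal U_\iota}$, $\tau(\mathbf u)=\tau_{\deg}(\iota)$, and $B_{\mathbf u}(m)>0$ for arbitrarily large $m$; for such $\mathbf u$, $\Lambda^{\deg}_{\mathbf M}(\mathbf u)>0$ is the number with $B_{\mathbf u}(m)\asymp m^{q-1}\Lambda^{\deg}_{\mathbf M}(\mathbf u)^m$ for some integer $q\ge1$. $\mathbf u\sim_{\deg}\mathbf v$ iff $c_{\deg}(\mathbf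 u)/c_{\deg}(\mathbf v)\in\Lambda_{\mathcal U_\iota}^{\mathbb Z}$; $\mathscr K_{\deg}(\iota)$ = set of classes; $\Lambda_{\mathbf M}^{\deg,\mathrm{eff}}(Q)=\max_{\mathbf u\in Q}\Lambda^{\deg}_{\mathbf M}(\mathbf u)$. BEDM: there exist classes $Q_1,Q_2$ with different $\Lambda^{\deg,\mathrm{eff}}_{\mathbf M}$. Degree spectrum: $\mathscr D(\Xi_\iota,\hat\deg_{\Xi_\iota})$ is the set of all limit points of $\log P(\ell_m)/(-\log\ell_m)$ along sequences $\ell_m\downarrow0$ with $P(\ell_m)>0$; finite discrete multiscale-free means $1<|\mathscr D|<\infty$. *)

theory Defs
  imports
    "Jordan_Normal_Form.Spectral_Radius"
    "Jordan_Normal_Form.DL_Submatrix"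
    "Graph_Theory.Graph_Theory"
begin

section \<open>Coloured digraphs and edge iterated graph systems\<close>

record ('v, 'e) cdigraph = "('v, 'e) pre_digraph" +
  colour :: "'e \<Rightarrow> nat"

abbreviation uncoloured :: "('v, 'e) cdigraph \<Rightarrow> ('v, 'e) pre_digraph" where
  "uncoloured G \<equiv> pre_digraph.truncate G"

text \<open>A loop counts twice in the degree.\<close>

definition vertex_degree :: "('v, 'e) cdigraph \<Rightarrow> 'v \<Rightarrow> nat" where
  "vertex_degree G v = out_degree (uncoloured G) v + in_degree (uncoloured G) v"

definition max_degree :: "('v, 'e) cdigraph \<Rightarrow> nat" where
  "max_degree G = Max (vertex_degree G ` verts G)"

definition undirected_dist :: "('v, 'e) cdigraph \<Rightarrow> 'v \<Rightarrow> 'v \<Rightarrow> ereal" where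
  "undirected_dist G = wf_digraph.\<mu> (mk_symmetric (uncoloured G)) (\<lambda>_. 1)"

text \<open>
  Colours and matrix indices are counted from 0: colour \<open>i < K\<close> stands for colour \<open>i + 1\<close> of \<open>[K]\<close>,
  and entry \<open>2i\<close> (respectively \<open>2i + 1\<close>) of a vector \<open>\<kappa>\<close> counts the outgoing (respectively incoming)
  arcs of colour \<open>i\<close>.
\<close>

record ('v, 'e) eigs =
  num_colours :: nat
  rule :: "nat \<Rightarrow> ('v, 'e) cdigraph"
  plant_pos :: "nat \<Rightarrow> 'v"
  plant_neg :: "nat \<Rightarrow> 'v"

definition is_eigs :: "('v, 'e) eigs \<Rightarrow> bool" where
  "is_eigs S \<longleftrightarrow>
     num_colours S \<ge> 1 \<and>
     (\<forall>i < num_colours S.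
        fin_digraph (uncoloured (rule S i)) \<and>
        Digraph_Component.connected (uncoloured (rule S i)) \<and>
        colour (rule S i) ` arcs (rule S i) \<subseteq> {..<num_colours S} \<and>
        plant_pos S i \<in> verts (rule S i) \<and>
        plant_neg S i \<in> verts (rule S i) \<and>
        undirected_dist (rule S i) (plant_pos S i) (plant_neg S i) \<ge> 2)"

text \<open>
  An arc of \<open>\<Xi>\<^sup>n\<close> is addressed by the list (most recent first) of the rule-graph arcs chosen at the
  \<open>n\<close> replacement steps, and \<open>Born e w\<close> is the copy of the non-planting vertex \<open>w\<close> that
  is created when the arc \<open>e\<close> is replaced. Addresses of different generations have different
  lengths, so these vertices are fresh.
\<close>

datatype ('v, 'e) xvertex = Root_tail | Root_head | Born "'e list" 'v

type_synonym ('v, 'e) xgraph = "(('v, 'e) xvertex, 'e list) cdigraph"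

definition planted :: "('v, 'e) eigs \<Rightarrow> ('v, 'e) xgraph \<Rightarrow> 'e list \<Rightarrow> 'v \<Rightarrow> ('v, 'e) xvertex" where
  "planted S G e w =
     (if w = plant_pos S (colour G e) then tail G e
      else if w = plant_neg S (colour G e) then head G e
      else Born e w)"

definition substitute :: "('v, 'e) eigs \<Rightarrow> ('v, 'e) xgraph \<Rightarrow> ('v, 'e) xgraph" where
  "substitute S G =
     \<lparr> verts = verts G \<union> (\<Union>e \<in> arcs G. planted S G e ` verts (rule S (colour G e))),
       arcs = {f # e | e f. e \<in> arcs G \<and> f \<in> arcs (rule S (colour G e))},
       tail = (\<lambda>x. planted S G (tl x) (tail (rule S (colour G (tl x))) (hd x))),
       head = (\<lambda>x. planted S G (tl x) (head (rule S (colour G (tl x))) (hd x))),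
       colour = (\<lambda>x. colour (rule S (colour G (tl x))) (hd x)) \<rparr>"

primrec Xi :: "('v, 'e) eigs \<Rightarrow> nat \<Rightarrow> nat \<Rightarrow> ('v, 'e) xgraph" where
  "Xi S \<iota> 0 =
     \<lparr> verts = {Root_tail, Root_head}, arcs = {[]},
       tail = (\<lambda>_. Root_tail), head = (\<lambda>_. Root_head), colour = (\<lambda>_. \<iota>) \<rparr>"
| "Xi S \<iota> (Suc n) = substitute S (Xi S \<iota> n)"

definition Xi_verts :: "('v, 'e) eigs \<Rightarrow> nat \<Rightarrow> ('v, 'e) xvertex set" where
  "Xi_verts S \<iota> = (\<Union>n. verts (Xi S \<iota> n))"

definition born :: "('v, 'e) eigs \<Rightarrow> nat \<Rightarrow> nat \<Rightarrow> ('v, 'e) xvertex set" where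
  "born S \<iota> m = {v \<in> verts (Xi S \<iota> m). \<forall>k < m. v \<notin> verts (Xi S \<iota> k)}"


section \<open>Mass and degree matrices\<close>

definition mass_mat :: "('v, 'e) eigs \<Rightarrow> real mat" where
  "mass_mat S = mat (num_colours S) (num_colours S)
     (\<lambda>(i, k). real (card {e \<in> arcs (rule S i). colour (rule S i) e = k}))"

definition kappa :: "nat \<Rightarrow> ('v, 'e) cdigraph \<Rightarrow> 'v \<Rightarrow> real vec" where
  "kappa K G v = vec (2 * K)
     (\<lambda>a. real (card {e \<in> (if even a then out_arcs (uncoloured G) v else in_arcs (uncoloured G) v).
                       colour G e = a div 2}))"

definition degree_mat :: "('v, 'e) eigs \<Rightarrow> real mat" where
  "degree_mat S = mat (2 * num_colours S) (2 * num_colours S)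
     (\<lambda>(a, b). kappa (num_colours S) (rule S (a div 2))
                 (if even a then plant_pos S (a div 2) else plant_neg S (a div 2)) $ b)"


section \<open>Frobenius notions for nonnegative square matrices\<close>

definition reaches :: "real mat \<Rightarrow> nat \<Rightarrow> nat \<Rightarrow> bool" where
  "reaches X a b \<longleftrightarrow> a < dim_row X \<and> b < dim_row X \<and> (\<exists>n. (X ^\<^sub>m n) $$ (a, b) > 0)"

definition reachable_indices :: "real mat \<Rightarrow> nat \<Rightarrow> nat set" where
  "reachable_indices X a = {b. reaches X a b}"

definition block_of :: "real mat \<Rightarrow> nat \<Rightarrow> nat set" where
  "block_of X a = {b. reaches X a b \<and> reaches X b a}"

definition blocks :: "real mat \<Rightarrow> nat set set" where
  "blocks X = block_of X ` {..<dim_row X}"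

definition diagonal_block :: "real mat \<Rightarrow> nat set \<Rightarrow> real mat" where
  "diagonal_block X C = submatrix X C C"

definition primitive_mat :: "real mat \<Rightarrow> bool" where
  "primitive_mat A \<longleftrightarrow> square_mat A \<and> (\<forall>i < dim_row A. \<forall>j < dim_row A. A $$ (i, j) \<ge> 0) \<and>
     (\<exists>n \<ge> 1. \<forall>i < dim_row A. \<forall>j < dim_row A. (A ^\<^sub>m n) $$ (i, j) > 0)"

definition primitive_Frobenius :: "real mat \<Rightarrow> bool" where
  "primitive_Frobenius X \<longleftrightarrow> (\<forall>C \<in> blocks X. primitive_mat (diagonal_block X C))"

definition block_rho :: "real mat \<Rightarrow> nat set \<Rightarrow> real" where
  "block_rho X C = spectral_radius (map_mat complex_of_real (diagonal_block X C))"

definition block_reaches :: "real mat \<Rightarrow> nat set \<Rightarrow> nat set \<Rightarrow> bool" where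
  "block_reaches X C D \<longleftrightarrow> (\<exists>a \<in> C. \<exists>b \<in> D. reaches X a b)"

definition reachable_blocks :: "real mat \<Rightarrow> nat \<Rightarrow> nat set set" where
  "reachable_blocks X a = {D \<in> blocks X. block_reaches X (block_of X a) D}"

definition max_rho :: "real mat \<Rightarrow> nat \<Rightarrow> real" where
  "max_rho X a = Max (block_rho X ` reachable_blocks X a)"

definition block_chain :: "real mat \<Rightarrow> nat \<Rightarrow> nat set list \<Rightarrow> bool" where
  "block_chain X a cs \<longleftrightarrow> cs \<noteq> [] \<and> hd cs = block_of X a \<and> set cs \<subseteq> blocks X \<and> distinct cs \<and>
     successively (block_reaches X) cs"

definition varkappa :: "real mat \<Rightarrow> nat \<Rightarrow> nat" where
  "varkappa X a =
     Max {card {r. r < length cs \<and> block_rho X (cs ! r) = max_rho X a} | cs. block_chain X a cs}"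


section \<open>Birth types and their degree growth\<close>

definition birth_types :: "('v, 'e) eigs \<Rightarrow> nat \<Rightarrow> real vec set" where
  "birth_types S \<iota> =
     kappa (num_colours S) (Xi S \<iota> 0) ` verts (Xi S \<iota> 0) \<union>
     (\<Union>j \<in> reachable_indices (mass_mat S) \<iota>.
        kappa (num_colours S) (rule S j) ` (verts (rule S j) - {plant_pos S j, plant_neg S j}))"

definition type_lambda :: "('v, 'e) eigs \<Rightarrow> real vec \<Rightarrow> real" where
  "type_lambda S u = Max {max_rho (degree_mat S) a | a. a < dim_vec u \<and> u $ a > 0}"

definition type_tau :: "('v, 'e) eigs \<Rightarrow> real vec \<Rightarrow> nat" where
  "type_tau S u = Max {varkappa (degree_mat S) a | a.
     a < dim_vec u \<and> u $ a > 0 \<and> max_rho (degree_mat S) a = type_lambda S u}"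

definition Lambda_U :: "('v, 'e) eigs \<Rightarrow> nat \<Rightarrow> real" where
  "Lambda_U S \<iota> = Max (type_lambda S ` birth_types S \<iota>)"

definition tau_deg :: "('v, 'e) eigs \<Rightarrow> nat \<Rightarrow> nat" where
  "tau_deg S \<iota> = Max {type_tau S u | u. u \<in> birth_types S \<iota> \<and> type_lambda S u = Lambda_U S \<iota>}"

definition l1_norm :: "real vec \<Rightarrow> real" where
  "l1_norm v = (\<Sum>i < dim_vec v. \<bar>v $ i\<bar>)"

text \<open>The row vector \<open>u N\<^sup>n\<close> is written as the transpose of \<open>N\<^sup>n\<close> applied to \<open>u\<close>.\<close>

definition c_deg :: "('v, 'e) eigs \<Rightarrow> real vec \<Rightarrow> real" where
  "c_deg S u = lim (\<lambda>n. l1_norm (transpose_mat (degree_mat S ^\<^sub>m n) *\<^sub>v u) /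
                       (real n ^ (type_tau S u - 1) * type_lambda S u ^ n))"


section \<open>Degree scaling limit and degree spectrum\<close>

definition deg_hat :: "('v, 'e) eigs \<Rightarrow> nat \<Rightarrow> ('v, 'e) xvertex \<Rightarrow> real" where
  "deg_hat S \<iota> v = lim (\<lambda>n. real (vertex_degree (Xi S \<iota> n) v) / real (max_degree (Xi S \<iota> n)))"

definition level_count :: "('v, 'e) eigs \<Rightarrow> nat \<Rightarrow> real \<Rightarrow> nat" where
  "level_count S \<iota> l = card {v \<in> Xi_verts S \<iota>. deg_hat S \<iota> v = l}"

definition degree_spectrum :: "('v, 'e) eigs \<Rightarrow> nat \<Rightarrow> real set" where
  "degree_spectrum S \<iota> =
     {x. \<exists>l :: nat \<Rightarrow> real. decseq l \<and> l \<longlonglongrightarrow> 0 \<and> (\<forall>m. l m > 0) \<and> (\<forall>m. level_count S \<iota> (l m) > 0) \<and>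
         (\<exists>r. strict_mono r \<and>
            (\<lambda>m. ln (real (level_count S \<iota> (l (r m)))) / (- ln (l (r m)))) \<longlonglongrightarrow> x)}"

definition finite_discrete_multiscale_free :: "('v, 'e) eigs \<Rightarrow> nat \<Rightarrow> bool" where
  "finite_discrete_multiscale_free S \<iota> \<longleftrightarrow>
     finite (degree_spectrum S \<iota>) \<and> 1 < card (degree_spectrum S \<iota>)"


section \<open>Surviving degree classes and the BEDM condition\<close>

definition birth_count :: "('v, 'e) eigs \<Rightarrow> nat \<Rightarrow> real vec \<Rightarrow> nat \<Rightarrow> nat" where
  "birth_count S \<iota> u m = card {v \<in> born S \<iota> m. kappa (num_colours S) (Xi S \<iota> m) v = u}"

definition I_deg_surv :: "('v, 'e) eigs \<Rightarrow> nat \<Rightarrow> real vec set" where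
  "I_deg_surv S \<iota> = {u \<in> birth_types S \<iota>. u \<noteq> 0\<^sub>v (2 * num_colours S) \<and>
     type_lambda S u = Lambda_U S \<iota> \<and> type_tau S u = tau_deg S \<iota> \<and>
     (\<forall>m0. \<exists>m \<ge> m0. birth_count S \<iota> u m > 0)}"

definition asymp_const :: "(nat \<Rightarrow> real) \<Rightarrow> (nat \<Rightarrow> real) \<Rightarrow> bool" where
  "asymp_const f g \<longleftrightarrow> (\<exists>c > 0. (\<lambda>m. f m / g m) \<longlonglongrightarrow> c)"

definition Lambda_M :: "('v, 'e) eigs \<Rightarrow> nat \<Rightarrow> real vec \<Rightarrow> real" where
  "Lambda_M S \<iota> u = (THE L. L > 0 \<and>
     (\<exists>q \<ge> 1. asymp_const (\<lambda>m. real (birth_count S \<iota> u m)) (\<lambda>m. real m ^ (q - 1) * L ^ m)))"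

definition deg_equiv :: "('v, 'e) eigs \<Rightarrow> nat \<Rightarrow> (real vec \<times> real vec) set" where
  "deg_equiv S \<iota> = {(u, v). u \<in> I_deg_surv S \<iota> \<and> v \<in> I_deg_surv S \<iota> \<and>
     (\<exists>k :: int. c_deg S u / c_deg S v = Lambda_U S \<iota> powi k)}"

definition deg_classes :: "('v, 'e) eigs \<Rightarrow> nat \<Rightarrow> real vec set set" where
  "deg_classes S \<iota> = I_deg_surv S \<iota> // deg_equiv S \<iota>"

definition Lambda_eff :: "('v, 'e) eigs \<Rightarrow> nat \<Rightarrow> real vec set \<Rightarrow> real" where
  "Lambda_eff S \<iota> Q = Max (Lambda_M S \<iota> ` Q)"

definition BEDM :: "('v, 'e) eigs \<Rightarrow> nat \<Rightarrow> bool" where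
  "BEDM S \<iota> \<longleftrightarrow>
     (\<exists>Q1 \<in> deg_classes S \<iota>. \<exists>Q2 \<in> deg_classes S \<iota>. Lambda_eff S \<iota> Q1 \<noteq> Lambda_eff S \<iota> Q2)"

end

theory Submission
  imports Defs "HOL-Analysis.Uniform_Limit" "HOL-Library.Product_Lexorder"
begin

text \<open>
  The row sums of the powers of a nonnegative matrix with primitive diagonal blocks grow like
  \<open>n\<^sup>q\<^sup>-\<^sup>1 L\<^sup>n\<close>: inside a block this is Perron's theorem, and passing from the blocks reachable from a
  block to the block itself is a convolution with a geometric sequence, which either dominates, is
  dominated, or is resonant and then raises \<open>q\<close> by one. The types of the vertices evolve by the degree
  matrix, the numbers of births by the mass matrix. Since degrees increase in time, the maximum degree
  is realised by first born vertices of finitely many types, so a vertex of type \<open>u\<close> born in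
  generation \<open>m\<close> has rescaled degree \<open>c(u) \<Lambda>\<^sup>-\<^sup>m\<close> up to a common constant if the growth of \<open>u\<close> is maximal, and
  \<open>0\<close> otherwise. A small level is therefore populated by the types of exactly one class, each in
  a single generation \<open>m + O(1)\<close>, and the logarithm of its size is asymptotically \<open>m\<close> times the
  logarithm of the largest birth rate in the class.
\<close>

unbundle no vec_syntax
hide_const (open) Finite_Cartesian_Product.vec
hide_type (open) Finite_Cartesian_Product.vec

section \<open>Perron theory of primitive kernels\<close>

text \<open>Bounds up to constant factors would not do: \<open>deg_hat\<close> is a limit and levels
  are compared for exact equality, so every asymptotic statement carries a positive limit constant.
  This is what primitivity of the diagonal blocks, as opposed to mere irreducibility, supplies. The
  exponent q is tracked along with L because maximal growth of a type is decided by the pair (L, q)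
  in lexicographic order; in the final exponents it disappears, since ln m / m tends to 0. The two
  matrices are used with different strength. For the degree matrix and the all-ones vector the pair
  is identified with \<open>max_rho\<close> and \<open>varkappa\<close>. Births start from an
  arbitrary nonnegative vector, for which only the existence of some pair is proved; it is the
  bottom pair if the vector vanishes on all reachable colours. Kernels are functions on arbitrary
  finite index sets, so a diagonal block is the same kernel summed over a smaller set; matrices
  enter only when powers and spectral radii are translated.\<close>

definition mapp :: "'a set \<Rightarrow> ('a \<Rightarrow> 'a \<Rightarrow> real) \<Rightarrow> ('a \<Rightarrow> real) \<Rightarrow> 'a \<Rightarrow> real" where
  "mapp C B v = (\<lambda>i. \<Sum>j\<in>C. B i j * v j)"

text \<open>Powers are read off from orbits that start at an indicator, so statements on orbits of
  \<open>mapp\<close> apply to the entries of the powers.\<close>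

definition mpow :: "'a set \<Rightarrow> ('a \<Rightarrow> 'a \<Rightarrow> real) \<Rightarrow> nat \<Rightarrow> 'a \<Rightarrow> 'a \<Rightarrow> real" where
  "mpow C B n i j = (mapp C B ^^ n) (\<lambda>k. of_bool (k = j)) i"

lemma mpow_0: "mpow C B 0 i j = of_bool (i = j)"
  by (simp add: mpow_def)

lemma mpow_Suc: "mpow C B (Suc n) i j = (\<Sum>k\<in>C. B i k * mpow C B n k j)"
  by (simp add: mpow_def mapp_def)

lemma mapp_funpow:
  assumes "finite C" "i \<in> C"
  shows "(mapp C B ^^ n) v i = (\<Sum>j\<in>C. mpow C B n i j * v j)"
  using assms(2)
proof (induction n arbitrary: i)
  case 0
  then show ?case using assms(1) by (simp add: mpow_0 of_bool_def if_distrib if_distribR cong: if_cong)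
next
  case (Suc n)
  have "(mapp C B ^^ Suc n) v i = (\<Sum>k\<in>C. B i k * (mapp C B ^^ n) v k)"
    by (simp add: mapp_def)
  also have "\<dots> = (\<Sum>k\<in>C. \<Sum>j\<in>C. B i k * mpow C B n k j * v j)"
    by (rule sum.cong) (simp_all add: Suc.IH sum_distrib_left mult.assoc)
  also have "\<dots> = (\<Sum>j\<in>C. \<Sum>k\<in>C. B i k * mpow C B n k j * v j)"
    by (rule sum.swap)
  finally show ?case by (simp add: mpow_Suc sum_distrib_right)
qed

lemma mapp_eigen_funpow:
  assumes "\<And>i. i \<in> C \<Longrightarrow> mapp C B x i = r * x i" "i \<in> C"
  shows "(mapp C B ^^ n) x i = r ^ n * x i"
  using assms(2)
proof (induction n arbitrary: i)
  case (Suc n)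
  have "(mapp C B ^^ Suc n) x i = (\<Sum>k\<in>C. B i k * (r ^ n * x k))"
    using Suc.IH by (simp add: mapp_def[of C B "(mapp C B ^^ n) x"])
  also have "\<dots> = r ^ n * mapp C B x i"
    by (simp add: mapp_def sum_distrib_left mult_ac)
  finally show ?case using assms(1)[OF Suc.prems] by simp
qed auto

lemma mpow_add:
  assumes "finite C" "i \<in> C"
  shows "mpow C B (m + n) i j = (\<Sum>k\<in>C. mpow C B m i k * mpow C B n k j)"
  using mapp_funpow[OF assms, where B = B and n = m and v = "(mapp C B ^^ n) (\<lambda>k. of_bool (k = j))"]
  by (simp add: mpow_def funpow_add)

lemma mpow_1: "finite C \<Longrightarrow> j \<in> C \<Longrightarrow> mpow C B (Suc 0) i j = B i j"
  by (simp add: mpow_Suc mpow_0 of_bool_def if_distrib if_distribR cong: if_cong)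

lemma mpow_Suc_right:
  assumes "finite C" "i \<in> C" "j \<in> C"
  shows "mpow C B (Suc n) i j = (\<Sum>k\<in>C. mpow C B n i k * B k j)"
  using mpow_add[OF assms(1,2), where B = B and m = n and n = "Suc 0" and j = j] assms by (simp add: mpow_1)

lemma mpow_transpose:
  assumes "finite C" "i \<in> C" "j \<in> C"
  shows "mpow C (\<lambda>i j. B j i) n i j = mpow C B n j i"
  using assms(2,3)
proof (induction n arbitrary: i j)
  case 0
  then show ?case by (simp add: mpow_0 eq_commute)
next
  case (Suc n)
  then show ?case
    using mpow_Suc_right[OF assms(1), of j i B n] by (simp add: mpow_Suc mult.commute)
qed

lemma mpow_nonneg:
  assumes "\<And>i j. i \<in> C \<Longrightarrow> j \<in> C \<Longrightarrow> 0 \<le> B i j" "i \<in> C"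
  shows "0 \<le> mpow C B n i j"
  using assms(2)
  by (induction n arbitrary: i) (auto simp: mpow_0 mpow_Suc intro!: sum_nonneg mult_nonneg_nonneg assms(1))

text \<open>An index where s is maximal carries weight at least \<delta>, which lifts the average
  above the minimum by \<delta> times the oscillation; the other bound is symmetric. With \<delta> =
  0 averages stay between the extremes, with \<delta> > 0 the oscillation is contracted.\<close>

lemma weighted_average_bounds:
  fixes s W :: "'a \<Rightarrow> real"
  assumes "finite C" "C \<noteq> {}" "0 \<le> \<delta>" "\<And>j. j \<in> C \<Longrightarrow> \<delta> \<le> W j" "(\<Sum>j\<in>C. W j) = 1"
  shows "Min (s ` C) + \<delta> * (Max (s ` C) - Min (s ` C)) \<le> (\<Sum>j\<in>C. W j * s j)"
    and "(\<Sum>j\<in>C. W j * s j) \<le> Max (s ` C) - \<delta> * (Max (s ` C) - Min (s ` C))"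
proof -
  let ?lo = "Min (s ` C)" and ?hi = "Max (s ` C)"
  have lo: "?lo \<le> s j" and hi: "s j \<le> ?hi" if "j \<in> C" for j using that assms by auto
  have le: "?lo \<le> ?hi" using assms(1,2) lo hi by (meson all_not_in_conv order_trans)
  have "?hi \<in> s ` C" using assms by (intro Max_in) auto
  then obtain a where a: "a \<in> C" "s a = ?hi" by auto
  have "?lo \<in> s ` C" using assms by (intro Min_in) auto
  then obtain b where b: "b \<in> C" "s b = ?lo" by auto
  have "\<delta> * (?hi - ?lo) \<le> W a * (s a - ?lo)" using a assms le by (simp add: mult_right_mono)
  also have "\<dots> \<le> (\<Sum>j\<in>C. W j * (s j - ?lo))"
    by (rule member_le_sum) (use a assms lo in \<open>auto intro!: mult_nonneg_nonneg intro: order_trans\<close>)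
  also have "\<dots> = (\<Sum>j\<in>C. W j * s j) - ?lo"
    using assms(5) by (simp add: right_diff_distrib sum_subtractf flip: sum_distrib_right)
  finally show "?lo + \<delta> * (?hi - ?lo) \<le> (\<Sum>j\<in>C. W j * s j)" by simp
  have "\<delta> * (?hi - ?lo) \<le> W b * (?hi - s b)" using b assms le by (simp add: mult_right_mono)
  also have "\<dots> \<le> (\<Sum>j\<in>C. W j * (?hi - s j))"
    by (rule member_le_sum) (use b assms hi in \<open>auto intro!: mult_nonneg_nonneg intro: order_trans\<close>)
  also have "\<dots> = ?hi - (\<Sum>j\<in>C. W j * s j)"
    using assms(5) by (simp add: right_diff_distrib sum_subtractf flip: sum_distrib_right)
  finally show "(\<Sum>j\<in>C. W j * s j) \<le> ?hi - \<delta> * (?hi - ?lo)" by simp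
qed

section \<open>Perron's theorem for a kernel with an entrywise positive power\<close>

locale primitive_kernel =
  fixes C :: "'a set" and B :: "'a \<Rightarrow> 'a \<Rightarrow> real" and p :: nat
  assumes fin: "finite C" and nonempty: "C \<noteq> {}"
    and nonneg: "\<And>i j. i \<in> C \<Longrightarrow> j \<in> C \<Longrightarrow> 0 \<le> B i j"
    and p_pos: "0 < p"
    and pow_pos: "\<And>i j. i \<in> C \<Longrightarrow> j \<in> C \<Longrightarrow> 0 < mpow C B p i j"
begin

abbreviation T where "T \<equiv> mapp C B"

text \<open>A vanishing row would stay zero in every power of positive exponent, in particular in
  the power p.\<close>

lemma row_nonzero:
  assumes "i \<in> C" shows "\<exists>j\<in>C. 0 < B i j"
proof (rule ccontr)
  assume "\<not> ?thesis"
  then have "\<forall>j\<in>C. B i j = 0" using nonneg[OF assms] by (meson linorder_not_less order_antisym)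
  then have "mpow C B (Suc (p - 1)) i i = 0" by (simp add: mpow_Suc)
  with pow_pos[OF assms assms] p_pos show False by simp
qed

lemma T_pos:
  assumes "\<And>j. j \<in> C \<Longrightarrow> 0 < w j" "i \<in> C" shows "0 < T w i"
proof -
  obtain j where "j \<in> C" "0 < B i j" using row_nonzero[OF assms(2)] by auto
  then show ?thesis unfolding mapp_def
    by (intro sum_pos2[OF fin, of j]) (use assms nonneg in \<open>auto intro!: mult_nonneg_nonneg simp: less_imp_le\<close>)
qed

lemma T_funpow_pos:
  assumes "\<And>j. j \<in> C \<Longrightarrow> 0 < w j" "i \<in> C" shows "0 < (T ^^ n) w i"
  using assms(2) by (induction n arbitrary: i) (auto intro!: T_pos assms)

lemma T_p_pos:
  assumes "\<And>j. j \<in> C \<Longrightarrow> 0 \<le> v j" "j0 \<in> C" "0 < v j0" "i \<in> C"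
  shows "0 < (T ^^ p) v i"
  unfolding mapp_funpow[OF fin assms(4)]
  by (intro sum_pos2[OF fin assms(2)])
     (use assms pow_pos in \<open>auto intro!: mult_nonneg_nonneg intro: less_imp_le\<close>)

lemma funpow_shift: "i \<in> C \<Longrightarrow> (T ^^ (n + k)) v i = (\<Sum>j\<in>C. mpow C B k i j * (T ^^ n) v j)"
  using mapp_funpow[OF fin, where B = B and n = k and v = "(T ^^ n) v"] by (simp add: funpow_add add.commute)

text \<open>
  The quotients of two orbits are averages of the earlier quotients, and after \<open>p\<close> steps all
  weights are bounded below; hence the oscillation of the quotients over \<open>C\<close> is contracted.
\<close>

lemma orbit_quotient_limit:
  assumes w: "\<And>j. j \<in> C \<Longrightarrow> 0 < w j"
    and v: "\<And>j. j \<in> C \<Longrightarrow> 0 \<le> v j" and j0: "j0 \<in> C" "0 < v j0"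
  obtains l where "0 < l" "\<And>i. i \<in> C \<Longrightarrow> (\<lambda>n. (T ^^ n) v i / (T ^^ n) w i) \<longlonglongrightarrow> l"
proof -
  let ?s = "\<lambda>n i. (T ^^ n) v i / (T ^^ n) w i"
  \<comment> \<open>Conjugating k steps of the kernel with the positive orbit of w gives a
    stochastic kernel, and this kernel averages the quotients of the two orbits.\<close>
  let ?W = "\<lambda>n k i j. mpow C B k i j * (T ^^ n) w j / (T ^^ (n + k)) w i"
  define lo hi where "lo = (\<lambda>n. Min (?s n ` C))" and "hi = (\<lambda>n. Max (?s n ` C))"
  have wpos: "0 < (T ^^ n) w i" if "i \<in> C" for n i by (rule T_funpow_pos) (use w that in auto)
  have avg: "?s (n + k) i = (\<Sum>j\<in>C. ?W n k i j * ?s n j)" if "i \<in> C" for n k i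
  proof -
    have "(\<Sum>j\<in>C. ?W n k i j * ?s n j) = (\<Sum>j\<in>C. mpow C B k i j * (T ^^ n) v j / (T ^^ (n + k)) w i)"
      by (rule sum.cong) (use wpos in \<open>auto simp: field_simps less_imp_neq[THEN not_sym]\<close>)
    then show ?thesis using funpow_shift[OF that] by (simp add: sum_divide_distrib)
  qed
  have W1: "(\<Sum>j\<in>C. ?W n k i j) = 1" if "i \<in> C" for n k i
    using funpow_shift[OF that, where n = n and k = k and v = w] wpos[OF that, of "n + k"]
    by (simp flip: sum_divide_distrib)
  have W0: "0 \<le> ?W n k i j" if "i \<in> C" "j \<in> C" for n k i j
    using that wpos mpow_nonneg[of C B] nonneg by (simp add: less_imp_le)
  have s_lo: "lo n \<le> ?s n i" and s_hi: "?s n i \<le> hi n" if "i \<in> C" for n i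
    unfolding lo_def hi_def using that fin by auto
  have ex_lo: "\<exists>i\<in>C. lo n = ?s n i" and ex_hi: "\<exists>i\<in>C. hi n = ?s n i" for n
  proof -
    have "lo n \<in> ?s n ` C" unfolding lo_def using fin nonempty by (intro Min_in) auto
    then show "\<exists>i\<in>C. lo n = ?s n i" by auto
    have "hi n \<in> ?s n ` C" unfolding hi_def using fin nonempty by (intro Max_in) auto
    then show "\<exists>i\<in>C. hi n = ?s n i" by auto
  qed
  have step: "lo n \<le> ?s (n + k) i" "?s (n + k) i \<le> hi n" if "i \<in> C" for n k i
    using weighted_average_bounds[OF fin nonempty order_refl, of "?W n k i" "?s n"] W0[OF that] W1[OF that]
    unfolding lo_def hi_def avg[OF that, of n k] by auto
  have lo_le_hi: "lo n \<le> hi n" for n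
    using ex_lo[of n] s_hi by force
  have "incseq lo"
  proof (rule incseq_SucI)
    fix n show "lo n \<le> lo (Suc n)" using ex_lo[of "Suc n"] step(1)[of _ n 1] by auto
  qed
  have "decseq hi"
  proof (rule decseq_SucI)
    fix n show "hi (Suc n) \<le> hi n" using ex_hi[of "Suc n"] step(2)[of _ n 1] by auto
  qed
  have "lo n \<le> hi 0" for n using lo_le_hi[of n] decseqD[OF \<open>decseq hi\<close>, of 0 n] by simp
  with \<open>incseq lo\<close> obtain l where l: "lo \<longlonglongrightarrow> l" by (metis incseq_convergent)
  have "lo 0 \<le> hi n" for n using lo_le_hi[of n] incseqD[OF \<open>incseq lo\<close>, of 0 n] by simp
  with \<open>decseq hi\<close> obtain h where h: "hi \<longlonglongrightarrow> h" by (metis decseq_convergent)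
  have "\<exists>\<delta>>0. \<forall>n i j. i \<in> C \<longrightarrow> j \<in> C \<longrightarrow> \<delta> \<le> ?W (n + p) p i j"
  proof -
    define a where "a = Min ((\<lambda>(i, j). mpow C B p i j) ` (C \<times> C))"
    define b where "b = Max ((\<lambda>(i, j). mpow C B p i j) ` (C \<times> C))"
    have ab: "a \<le> mpow C B p i j" "mpow C B p i j \<le> b" if "i \<in> C" "j \<in> C" for i j
      unfolding a_def b_def using that fin by (auto intro!: Min_le Max_ge)
    have "a \<in> (\<lambda>(i, j). mpow C B p i j) ` (C \<times> C)"
      unfolding a_def using fin nonempty by (intro Min_in) auto
    then have a0: "0 < a" using pow_pos by auto
    obtain c where "c \<in> C" using nonempty by auto
    then have b0: "0 < b" using ab[of c c] a0 by linarith
    \<comment> \<open>One run of p steps makes all entries of the w-orbit comparable to their sum at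
      time n, with factors a and b; a second run bounds the denominator by
      \<open>card C * b * b\<close> times this sum. Hence the weights start at n + p, and the sum
      cancels in the bound.\<close>
    have "a * (a / (card C * b * b)) \<le> ?W (n + p) p i j" if "i \<in> C" "j \<in> C" for n i j
    proof -
      let ?S = "\<Sum>k\<in>C. (T ^^ n) w k"
      have S: "0 < ?S" using fin nonempty wpos by (intro sum_pos) auto
      have low: "a * ?S \<le> (T ^^ (n + p)) w j"
        unfolding funpow_shift[OF that(2)] sum_distrib_left
        by (intro sum_mono mult_right_mono) (use ab that wpos in \<open>auto intro: less_imp_le\<close>)
      have up: "(T ^^ (n + p)) w k \<le> b * ?S" if "k \<in> C" for k
        unfolding funpow_shift[OF that(1)] sum_distrib_left
        by (intro sum_mono mult_right_mono) (use ab that wpos in \<open>auto intro: less_imp_le\<close>)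
      have "(T ^^ (n + p + p)) w i \<le> (\<Sum>k\<in>C. b * (b * ?S))"
        unfolding funpow_shift[OF that(1), of "n + p"]
        by (intro sum_mono mult_mono) (use ab up that wpos b0 in \<open>auto intro: less_imp_le\<close>)
      then have up2: "(T ^^ (n + p + p)) w i \<le> card C * b * b * ?S" by (simp add: mult_ac)
      have "a * (a / (card C * b * b)) = a * (a * ?S) / (card C * b * b * ?S)"
        using S by simp
      also have "\<dots> \<le> mpow C B p i j * (T ^^ (n + p)) w j / (T ^^ (n + p + p)) w i"
        by (intro frac_le mult_mono mult_nonneg_nonneg)
           (use ab that low up2 a0 S wpos pow_pos in \<open>auto simp: less_imp_le\<close>)
      finally show ?thesis .
    qed
    moreover have "0 < a * (a / (card C * b * b))" using a0 b0 fin nonempty by (simp add: card_gt_0_iff)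
    ultimately show ?thesis by blast
  qed
  then obtain \<delta> where \<delta>: "0 < \<delta>" "\<And>n i j. i \<in> C \<Longrightarrow> j \<in> C \<Longrightarrow> \<delta> \<le> ?W (n + p) p i j" by blast
  have gap: "hi (n + p + p) - lo (n + p + p) \<le> (1 - \<delta>) * (hi (n + p) - lo (n + p))" for n
  proof -
    obtain i where i: "i \<in> C" "hi (n + p + p) = ?s (n + p + p) i" using ex_hi by blast
    obtain k where k: "k \<in> C" "lo (n + p + p) = ?s (n + p + p) k" using ex_lo by blast
    have "hi (n + p + p) \<le> hi (n + p) - \<delta> * (hi (n + p) - lo (n + p))"
      using weighted_average_bounds(2)[OF fin nonempty less_imp_le[OF \<delta>(1)], of "?W (n + p) p i" "?s (n + p)"]
        \<delta>(2)[OF i(1)] W1[OF i(1)]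
      unfolding i(2) avg[OF i(1), of "n + p" p] unfolding hi_def lo_def by auto
    moreover have "lo (n + p) \<le> lo (n + p + p)"
      unfolding k(2) using step(1)[OF k(1), of "n + p" p] .
    ultimately show ?thesis by (simp add: algebra_simps)
  qed
  have "(\<lambda>n. hi (n + p + p) - lo (n + p + p)) \<longlonglongrightarrow> h - l"
    by (intro tendsto_diff LIMSEQ_ignore_initial_segment l h)
  moreover have "(\<lambda>n. (1 - \<delta>) * (hi (n + p) - lo (n + p))) \<longlonglongrightarrow> (1 - \<delta>) * (h - l)"
    by (intro tendsto_mult tendsto_const tendsto_diff LIMSEQ_ignore_initial_segment l h)
  \<comment> \<open>Both limits exist by monotonicity; passing to the limit in the contraction
    forces them to agree.\<close>
  ultimately have "h - l \<le> (1 - \<delta>) * (h - l)"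
    by (rule LIMSEQ_le) (use gap in blast)
  then have "\<delta> * (h - l) \<le> 0" by (simp add: algebra_simps)
  then have "h \<le> l" using \<delta>(1) by (simp add: mult_le_0_iff)
  moreover have "l \<le> h" by (rule LIMSEQ_le[OF l h]) (use lo_le_hi in blast)
  ultimately have "h = l" by simp
  have "(\<lambda>n. ?s n i) \<longlonglongrightarrow> l" if "i \<in> C" for i
    by (rule tendsto_sandwich[OF _ _ l h[unfolded \<open>h = l\<close>]]) (use s_lo s_hi that in auto)
  \<comment> \<open>After p steps the orbit of v is positive on all of C, and from then on the
    minimal quotient can only increase.\<close>
  moreover have "0 < l"
  proof -
    obtain i where i: "i \<in> C" "lo p = ?s p i" using ex_lo by blast
    have "0 < lo p" unfolding i(2) using T_p_pos[of v j0 i] v j0 wpos i by simp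
    also have "lo p \<le> l" using \<open>incseq lo\<close> l by (rule incseq_le)
    finally show ?thesis .
  qed
  ultimately show ?thesis using that by blast
qed

lemma transposed: "primitive_kernel C (\<lambda>i j. B j i) p"
proof
  fix i j assume "i \<in> C" "j \<in> C"
  then show "0 < mpow C (\<lambda>i j. B j i) p i j"
    using mpow_transpose[OF fin, of i j B p] pow_pos[of j i] by simp
qed (use fin nonempty nonneg p_pos in auto)

text \<open>\<open>y j\<close> is the limiting share of column j in a row sum of the n-th power,
  which does not depend on the row; r is the limiting quotient of consecutive row sums. Multiplying
  the power by B from the right turns the shares into the eigenvector equation.\<close>

lemma left_eigenvector:
  obtains r y where "0 < r" "\<And>j. j \<in> C \<Longrightarrow> 0 < y j" "\<And>j. j \<in> C \<Longrightarrow> (\<Sum>k\<in>C. y k * B k j) = r * y j"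
proof -
  let ?e = "\<lambda>j k. of_bool (k = j) :: real"
  let ?one = "\<lambda>_. 1 :: real"
  have "\<exists>y>0. \<forall>i\<in>C. (\<lambda>n. (T ^^ n) (?e j) i / (T ^^ n) ?one i) \<longlonglongrightarrow> y" if "j \<in> C" for j
    by (rule orbit_quotient_limit[of ?one "?e j" j]) (use that in auto)
  then obtain y where y: "\<And>j. j \<in> C \<Longrightarrow> 0 < y j"
    "\<And>i j. i \<in> C \<Longrightarrow> j \<in> C \<Longrightarrow> (\<lambda>n. (T ^^ n) (?e j) i / (T ^^ n) ?one i) \<longlonglongrightarrow> y j"
    using bchoice[of C "\<lambda>j y. 0 < y \<and> (\<forall>i\<in>C. (\<lambda>n. (T ^^ n) (?e j) i / (T ^^ n) ?one i) \<longlonglongrightarrow> y)"]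
    by blast
  obtain i where i: "i \<in> C" using nonempty by auto
  have T1: "0 < T ?one i" if "i \<in> C" for i using T_pos[of ?one] that by simp
  obtain r where r: "0 < r" "(\<lambda>n. (T ^^ n) (T ?one) i / (T ^^ n) ?one i) \<longlonglongrightarrow> r"
    by (rule orbit_quotient_limit[of ?one "T ?one" i]) (use T1 i in \<open>auto intro: less_imp_le\<close>)
  have "(\<Sum>k\<in>C. y k * B k j) = r * y j" if j: "j \<in> C" for j
  proof (rule LIMSEQ_unique)
    show "(\<lambda>n. \<Sum>k\<in>C. (T ^^ n) (?e k) i / (T ^^ n) ?one i * B k j) \<longlonglongrightarrow> (\<Sum>k\<in>C. y k * B k j)"
      by (intro tendsto_sum tendsto_mult tendsto_const y i)
    have "(\<lambda>n. (T ^^ n) (T ?one) i / (T ^^ n) ?one i * ((T ^^ Suc n) (?e j) i / (T ^^ Suc n) ?one i)) \<longlonglongrightarrow> r * y j"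
      by (intro tendsto_mult r LIMSEQ_Suc y i j)
    moreover have "(T ^^ n) (T ?one) i / (T ^^ n) ?one i * ((T ^^ Suc n) (?e j) i / (T ^^ Suc n) ?one i)
        = (\<Sum>k\<in>C. (T ^^ n) (?e k) i / (T ^^ n) ?one i * B k j)" for n
    proof -
      have "0 < (T ^^ Suc n) ?one i" by (rule T_funpow_pos) (use i in auto)
      then have "0 < (T ^^ n) (T ?one) i" unfolding funpow_Suc_right by simp
      then have "(T ^^ n) (T ?one) i / (T ^^ n) ?one i * ((T ^^ Suc n) (?e j) i / (T ^^ Suc n) ?one i)
        = mpow C B (Suc n) i j / (T ^^ n) ?one i"
        unfolding funpow_Suc_right mpow_def by simp
      also have "\<dots> = (\<Sum>k\<in>C. (T ^^ n) (?e k) i / (T ^^ n) ?one i * B k j)"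
        using mpow_Suc_right[OF fin i j, of B n] by (simp add: mpow_def sum_divide_distrib)
      finally show ?thesis .
    qed
    ultimately show "(\<lambda>n. \<Sum>k\<in>C. (T ^^ n) (?e k) i / (T ^^ n) ?one i * B k j) \<longlonglongrightarrow> r * y j" by simp
  qed
  then show ?thesis using that r y by blast
qed

text \<open>The right eigenvector is the left one of the transposed kernel, and pairing the two
  shows that their eigenvalues agree. Along the right eigenvector the orbit is exactly
  \<open>r ^ n * x\<close>, so a quotient limit against it becomes a limit of \<open>mpow\<close>
  divided by powers of r.\<close>

theorem perron:
  obtains r x y where "0 < r" "\<And>j. j \<in> C \<Longrightarrow> 0 < x j" "\<And>j. j \<in> C \<Longrightarrow> 0 < y j"
    "\<And>i. i \<in> C \<Longrightarrow> T x i = r * x i"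
    "\<And>j. j \<in> C \<Longrightarrow> (\<Sum>k\<in>C. y k * B k j) = r * y j"
    "\<And>i j. i \<in> C \<Longrightarrow> j \<in> C \<Longrightarrow> \<exists>c>0. (\<lambda>n. mpow C B n i j / r ^ n) \<longlonglongrightarrow> c"
proof -
  obtain r y where y: "0 < r" "\<And>j. j \<in> C \<Longrightarrow> 0 < y j" "\<And>j. j \<in> C \<Longrightarrow> (\<Sum>k\<in>C. y k * B k j) = r * y j"
    using left_eigenvector by blast
  obtain r' x where x: "0 < r'" "\<And>j. j \<in> C \<Longrightarrow> 0 < x j" "\<And>j. j \<in> C \<Longrightarrow> (\<Sum>k\<in>C. x k * B j k) = r' * x j"
    using primitive_kernel.left_eigenvector[OF transposed] by blast
  have "r * (\<Sum>j\<in>C. y j * x j) = (\<Sum>j\<in>C. (\<Sum>k\<in>C. y k * B k j) * x j)"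
    by (simp add: sum_distrib_left y(3) mult.assoc)
  also have "\<dots> = (\<Sum>k\<in>C. y k * (\<Sum>j\<in>C. x j * B k j))"
    by (simp add: sum_distrib_left sum_distrib_right mult_ac) (rule sum.swap)
  also have "\<dots> = r' * (\<Sum>j\<in>C. y j * x j)"
    by (simp add: sum_distrib_left x(3) mult_ac)
  finally have "r * (\<Sum>j\<in>C. y j * x j) = r' * (\<Sum>j\<in>C. y j * x j)" .
  moreover have "0 < (\<Sum>j\<in>C. y j * x j)" using fin nonempty x y by (intro sum_pos) auto
  ultimately have "r' = r" by simp
  have Tx: "T x i = r * x i" if "i \<in> C" for i
    using x(3)[OF that] \<open>r' = r\<close> by (simp add: mapp_def mult.commute)
  have "\<exists>c>0. (\<lambda>n. mpow C B n i j / r ^ n) \<longlonglongrightarrow> c" if ij: "i \<in> C" "j \<in> C" for i j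
  proof -
    obtain l where l: "0 < l" "(\<lambda>n. mpow C B n i j / (T ^^ n) x i) \<longlonglongrightarrow> l"
      unfolding mpow_def
      by (rule orbit_quotient_limit[of x "\<lambda>k. of_bool (k = j)" j]) (use x ij in auto)
    have "(\<lambda>n. mpow C B n i j / (T ^^ n) x i * x i) \<longlonglongrightarrow> l * x i"
      by (intro tendsto_mult l tendsto_const)
    moreover have "mpow C B n i j / (T ^^ n) x i * x i = mpow C B n i j / r ^ n" for n
      using mapp_eigen_funpow[of C B x r i n] Tx ij x(2)[OF ij(1)] by simp
    ultimately have "(\<lambda>n. mpow C B n i j / r ^ n) \<longlonglongrightarrow> l * x i" by (simp only:)
    moreover have "0 < l * x i" using l x ij by simp
    ultimately show ?thesis by blast
  qed
  then show ?thesis using that[of r x y] x(2) y Tx by blast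
qed

end

section \<open>Growth rates\<close>

lemma n_power_times_geometric_tendsto_0:
  fixes x :: real
  assumes "0 \<le> x" "x < 1"
  shows "(\<lambda>n. real n ^ k * x ^ n) \<longlonglongrightarrow> 0"
proof (cases "k = 0 \<or> x = 0")
  case True
  then show ?thesis
  proof
    assume "x = 0"
    have "\<forall>\<^sub>F n in sequentially. real n ^ k * x ^ n = 0"
      using eventually_gt_at_top[of 0] by eventually_elim (simp add: power_0_left \<open>x = 0\<close>)
    then show ?thesis by (rule tendsto_eventually)
  next
    assume "k = 0"
    then show ?thesis using LIMSEQ_power_zero[of x] assms by simp
  qed
next
  case False
  \<comment> \<open>The k-th root reduces the claim to exponent one: \<open>n ^ k * x ^ n\<close> is
    the k-th power of \<open>n * y ^ n\<close>.\<close>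
  define y where "y = root k x"
  have y: "0 < y" "y < 1" "y ^ k = x" using False assms by (auto simp: y_def)
  have "(\<lambda>n. (real n * y ^ n) ^ k) \<longlonglongrightarrow> 0 ^ k"
    by (intro tendsto_power powser_times_n_limit_0) (use y in auto)
  moreover have "(real n * y ^ n) ^ k = real n ^ k * x ^ n" for n
    by (simp add: y(3)[symmetric] power_mult_distrib mult.commute flip: power_mult)
  ultimately show ?thesis using False by (simp add: power_0_left)
qed

text \<open>The index q exceeds the polynomial degree by one, so that it can later count blocks in a
  chain. Truncated subtraction makes q = 0 and q = 1 coincide, hence the condition 1 \<le> q
  wherever rates are compared.\<close>

definition rate :: "real \<Rightarrow> nat \<Rightarrow> nat \<Rightarrow> real" where
  "rate L q n = real n ^ (q - 1) * L ^ n"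

lemma rate_pos: "0 < L \<Longrightarrow> 0 < n \<Longrightarrow> 0 < rate L q n"
  by (simp add: rate_def)

lemma rate_shift:
  assumes "0 < L" shows "(\<lambda>n. rate L q (n + k) / rate L q n) \<longlonglongrightarrow> L ^ k"
proof -
  have "(\<lambda>n. 1 + real k * inverse (real n)) \<longlonglongrightarrow> 1 + real k * 0"
    by (intro tendsto_add tendsto_mult tendsto_const lim_inverse_n)
  then have "(\<lambda>n. (1 + real k * inverse (real n)) ^ (q - 1) * L ^ k) \<longlonglongrightarrow> (1 + real k * 0) ^ (q - 1) * L ^ k"
    by (rule tendsto_mult[OF tendsto_power tendsto_const])
  moreover have "\<forall>\<^sub>F n in sequentially. (1 + real k * inverse (real n)) ^ (q - 1) * L ^ k = rate L q (n + k) / rate L q n"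
    using eventually_gt_at_top[of 0]
  proof eventually_elim
    case (elim n)
    then have "1 + real k * inverse (real n) = real (n + k) / real n" by (simp add: field_simps)
    then show ?case using assms by (simp add: rate_def power_divide power_add)
  qed
  ultimately show ?thesis using Lim_transform_eventually by fastforce
qed

text \<open>Dominance of rates is the lexicographic order: a larger base beats every polynomial
  factor, and for equal bases the larger exponent wins by a power of n.\<close>

lemma rate_less:
  assumes "0 < L" "0 < L'" "1 \<le> q" "1 \<le> q'" "(L, q) < (L', q')"
  shows "(\<lambda>n. rate L q n / rate L' q' n) \<longlonglongrightarrow> 0"
proof (cases "L < L'")
  case True
  have "(\<lambda>n. real n ^ (q - 1) * (L / L') ^ n) \<longlonglongrightarrow> 0"
    by (rule n_power_times_geometric_tendsto_0) (use assms True in auto)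
  moreover have "\<forall>\<^sub>F n in sequentially. norm (rate L q n / rate L' q' n) \<le> real n ^ (q - 1) * (L / L') ^ n"
    using eventually_gt_at_top[of 0]
  proof eventually_elim
    case (elim n)
    have "real n ^ (q - 1) * (L / L') ^ n / real n ^ (q' - 1) \<le> real n ^ (q - 1) * (L / L') ^ n / 1"
      by (rule divide_left_mono) (use elim assms in auto)
    then show ?case using assms by (simp add: rate_def power_divide field_simps)
  qed
  ultimately show ?thesis by (rule Lim_null_comparison[rotated])
next
  case False
  then have eq: "L' = L" "q < q'" using assms by auto
  have "(\<lambda>n. inverse (real n) ^ (q' - q)) \<longlonglongrightarrow> 0 ^ (q' - q)"
    by (intro tendsto_power lim_inverse_n)
  moreover have "\<forall>\<^sub>F n in sequentially. inverse (real n) ^ (q' - q) = rate L q n / rate L' q' n"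
    using eventually_gt_at_top[of 0]
  proof eventually_elim
    case (elim n)
    have "q' - 1 = (q - 1) + (q' - q)" using eq assms by simp
    then have "real n ^ (q' - 1) = real n ^ (q - 1) * real n ^ (q' - q)" by (simp only: power_add)
    then show ?case using elim assms eq by (simp add: rate_def field_simps power_inverse)
  qed
  ultimately show ?thesis using eq(2) by (simp add: filterlim_cong[OF refl refl] power_0_left)
qed

text \<open>\<open>grows f (0, 0)\<close> means that \<open>f\<close> vanishes identically, so that \<open>(0, 0)\<close> is the bottom of the
  lexicographic order on growth rates.\<close>

definition grows :: "(nat \<Rightarrow> real) \<Rightarrow> real \<times> nat \<Rightarrow> bool" where
  "grows f P \<longleftrightarrow> P = (0, 0) \<and> f = (\<lambda>_. 0) \<or>
     0 < fst P \<and> 1 \<le> snd P \<and> (\<exists>c>0. (\<lambda>n. f n / rate (fst P) (snd P) n) \<longlonglongrightarrow> c)"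

lemma grows_zero: "grows (\<lambda>_. 0) (0, 0)"
  by (simp add: grows_def)

lemma growsI:
  "0 < L \<Longrightarrow> 1 \<le> q \<Longrightarrow> 0 < c \<Longrightarrow> (\<lambda>n. f n / rate L q n) \<longlonglongrightarrow> c \<Longrightarrow> grows f (L, q)"
  by (auto simp: grows_def)

lemma grows_cases [consumes 1, case_names zero pos]:
  assumes "grows f P"
  obtains "P = (0, 0)" "\<And>n. f n = 0"
  | L q c where "P = (L, q)" "0 < L" "1 \<le> q" "0 < c" "(\<lambda>n. f n / rate L q n) \<longlonglongrightarrow> c"
  using assms by (cases P) (auto simp: grows_def)

lemma grows_bot: "grows f P \<Longrightarrow> (0, 0) \<le> P"
  by (cases P) (auto simp: grows_def)

lemma grows_less:
  assumes "grows f P" "P < (L', q')" "0 < L'" "1 \<le> q'"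
  shows "(\<lambda>n. f n / rate L' q' n) \<longlonglongrightarrow> 0"
  using assms(1)
proof (cases rule: grows_cases)
  case (pos L q c)
  have "(\<lambda>n. f n / rate L q n * (rate L q n / rate L' q' n)) \<longlonglongrightarrow> 0"
    using tendsto_mult[OF pos(5) rate_less[of L L' q q']] assms pos by auto
  moreover have "\<forall>\<^sub>F n in sequentially. f n / rate L q n * (rate L q n / rate L' q' n) = f n / rate L' q' n"
    using eventually_gt_at_top[of 0]
  proof eventually_elim
    case (elim n)
    then show ?case using rate_pos[OF pos(2) elim, of q] by simp
  qed
  ultimately show ?thesis by (rule Lim_transform_eventually)
qed simp

text \<open>The limit constants are positive, so nothing cancels and the larger rate prevails; in a
  tie the constants add up.\<close>

lemma grows_add:
  assumes "grows f P" "grows g Q" shows "grows (\<lambda>n. f n + g n) (max P Q)"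
proof -
  have *: "grows (\<lambda>n. f n + g n) Q" if h: "grows f P" "grows g Q" "P \<le> Q" for f g P Q
    using h(2)
  proof (cases rule: grows_cases)
    case zero
    with h grows_bot[OF h(1)] have "P = (0, 0)" by simp
    with h zero show ?thesis by (auto simp: grows_def)
  next
    case (pos L q c)
    obtain c' where c': "0 \<le> c'" "(\<lambda>n. f n / rate L q n) \<longlonglongrightarrow> c'"
    proof (cases "P = Q")
      case True
      with h(1) pos that show ?thesis by (auto simp: grows_def intro: less_imp_le)
    next
      case False
      with h pos grows_less[OF h(1), of L q] that[of 0] show ?thesis by simp
    qed
    have "(\<lambda>n. f n / rate L q n + g n / rate L q n) \<longlonglongrightarrow> c' + c"
      by (intro tendsto_add c' pos)
    then show ?thesis unfolding pos(1)
      by (intro growsI[of L q "c' + c"]) (use pos c' in \<open>auto simp: add_divide_distrib\<close>)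
  qed
  show ?thesis
  proof (cases "P \<le> Q")
    case True
    then show ?thesis using *[OF assms] by (simp add: max_def)
  next
    case False
    then show ?thesis using *[OF assms(2,1)] by (simp add: max_def add.commute)
  qed
qed

text \<open>The inserted pair (0, 0) is the value for the empty sum; being the least possible rate,
  it does not disturb the maximum otherwise.\<close>

lemma grows_sum:
  assumes "finite A" "\<And>i. i \<in> A \<Longrightarrow> grows (f i) (P i)"
  shows "grows (\<lambda>n. \<Sum>i\<in>A. f i n) (Max (insert (0, 0) (P ` A)))"
  using assms
proof (induction A rule: finite_induct)
  case empty
  then show ?case by (simp add: grows_zero)
next
  case (insert a A)
  have "grows (\<lambda>n. f a n + (\<Sum>i\<in>A. f i n)) (max (P a) (Max (insert (0, 0) (P ` A))))"
    by (intro grows_add insert) auto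
  moreover have "max (P a) (Max (insert (0, 0) (P ` A))) = Max (insert (0, 0) (P ` insert a A))"
    using insert(1) by (subst Max_insert[symmetric]) (auto simp: insert_commute)
  ultimately show ?case using insert by simp
qed

lemma grows_scale:
  assumes "grows f P" "0 < a" shows "grows (\<lambda>n. a * f n) P"
  using assms(1)
proof (cases rule: grows_cases)
  case (pos L q c)
  have "(\<lambda>n. a * (f n / rate L q n)) \<longlonglongrightarrow> a * c" by (intro tendsto_mult tendsto_const pos)
  then show ?thesis unfolding pos(1)
    by (intro growsI[of L q "a * c"]) (use assms pos in auto)
qed (simp add: grows_def)

text \<open>A strictly larger rate would give the limit 0 instead of a positive one. This is what
  makes the definite description in \<open>Lambda_M\<close> meaningful.\<close>

lemma grows_unique:
  assumes "grows f P" "grows f Q" shows "P = Q"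
proof (rule ccontr)
  assume "P \<noteq> Q"
  have *: False if "grows f P" "grows f Q" "P < Q" for P Q
    using that(2)
  proof (cases rule: grows_cases)
    case zero
    then show False using that(3) grows_bot[OF that(1)] by simp
  next
    case (pos L q c)
    then have "(\<lambda>n. f n / rate L q n) \<longlonglongrightarrow> 0" using grows_less[OF that(1), of L q] that by simp
    then show False using LIMSEQ_unique[OF pos(5)] pos(4) by auto
  qed
  show False
    using linorder_less_linear[of P Q] \<open>P \<noteq> Q\<close> *[OF assms] *[OF assms(2,1)] by blast
qed

text \<open>A delay by k costs the factor \<open>L ^ k\<close> and leaves the polynomial factor
  alone. Applied to the generation of birth, it is the source of the powers of \<Lambda> in the
  rescaled degrees. The truncation of n - k concerns only finitely many n.\<close>

lemma rate_tendsto_shift: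
  assumes "0 < L" "(\<lambda>n. f n / rate L q n) \<longlonglongrightarrow> c"
  shows "(\<lambda>n. f (n - k) / rate L q n) \<longlonglongrightarrow> c / L ^ k"
proof (rule LIMSEQ_offset[of _ k])
  have "(\<lambda>n. (f n / rate L q n) / (rate L q (n + k) / rate L q n)) \<longlonglongrightarrow> c / L ^ k"
    by (intro tendsto_divide assms rate_shift) (use assms in auto)
  moreover have "\<forall>\<^sub>F n in sequentially. (f n / rate L q n) / (rate L q (n + k) / rate L q n) = f (n + k - k) / rate L q (n + k)"
    using eventually_gt_at_top[of 0]
  proof eventually_elim
    case (elim n)
    then show ?case using rate_pos[OF assms(1) elim, of q] by simp
  qed
  ultimately show "(\<lambda>n. f (n + k - k) / rate L q (n + k)) \<longlonglongrightarrow> c / L ^ k"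
    by (rule Lim_transform_eventually)
qed

text \<open>One initial value cannot influence a positive rate; it matters only if the sequence is
  to vanish identically, hence the second assumption.\<close>

lemma grows_unshift:
  assumes "grows (\<lambda>n. f (Suc n)) P" "P = (0, 0) \<Longrightarrow> f 0 = 0"
  shows "grows f P"
  using assms(1)
proof (cases rule: grows_cases)
  case zero
  then have "f n = 0" for n using assms(2) by (cases n) auto
  then show ?thesis using zero by (auto simp: grows_def)
next
  case (pos L q c)
  have "(\<lambda>n. f (Suc (n - 1)) / rate L q n) \<longlonglongrightarrow> c / L ^ 1"
    by (rule rate_tendsto_shift[OF pos(2,5)])
  moreover have "\<forall>\<^sub>F n in sequentially. f (Suc (n - 1)) / rate L q n = f n / rate L q n"
    using eventually_gt_at_top[of 0] by eventually_elim simp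
  ultimately have "(\<lambda>n. f n / rate L q n) \<longlonglongrightarrow> c / L" using Lim_transform_eventually by fastforce
  then show ?thesis unfolding pos(1) by (intro growsI[of L q "c / L"]) (use pos in auto)
qed

section \<open>Limits of convolutions\<close>

lemma convolution_summable_limit:
  fixes a b :: "nat \<Rightarrow> real"
  assumes a: "\<And>s. 0 \<le> a s" "summable a" and b: "(\<lambda>n. b n / real n ^ q) \<longlonglongrightarrow> c"
  shows "(\<lambda>n. (\<Sum>s\<le>n. a s * b (n - s)) / real n ^ q) \<longlonglongrightarrow> c * suminf a"
proof -
  obtain K0 where K0: "0 < K0" "\<And>n. norm (b n / real n ^ q) \<le> K0"
    using convergent_imp_Bseq[OF convergentI[OF b]] by (auto simp: Bseq_def)
  \<comment> \<open>For q > 0 the quotient at 0 is 0 by the convention for division by zero, so K0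
    says nothing about \<open>b 0\<close>, which is bounded separately.\<close>
  define K where "K = max K0 \<bar>b 0\<bar>"
  have K: "\<bar>b m / real n ^ q\<bar> \<le> K" if "m \<le> n" "0 < n" for m n
  proof (cases "m = 0")
    case True
    have "\<bar>b 0\<bar> / real n ^ q \<le> \<bar>b 0\<bar> / 1" by (rule divide_left_mono) (use that in auto)
    then show ?thesis using True by (simp add: K_def)
  next
    case False
    then have "\<bar>b m / real n ^ q\<bar> \<le> \<bar>b m / real m ^ q\<bar>"
      unfolding abs_divide by (intro divide_left_mono) (use that False in \<open>auto intro: power_mono\<close>)
    also have "\<dots> \<le> K" using K0(2)[of m] by (simp add: K_def)
    finally show ?thesis .
  qed
  define t where "t = (\<lambda>s n. if s \<le> n then a s * (b (n - s) / real n ^ q) else 0)"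
  have lim: "(\<lambda>n. t s n) \<longlonglongrightarrow> a s * c" for s
  proof -
    have b1: "(\<lambda>n. b n / rate 1 (Suc q) n) \<longlonglongrightarrow> c" using b by (simp add: rate_def)
    have "(\<lambda>n. b (n - s) / real n ^ q) \<longlonglongrightarrow> c"
      using rate_tendsto_shift[of 1 b "Suc q" c s] b1 by (simp add: rate_def)
    then have "(\<lambda>n. a s * (b (n - s) / real n ^ q)) \<longlonglongrightarrow> a s * c" by (intro tendsto_intros)
    moreover have "\<forall>\<^sub>F n in sequentially. a s * (b (n - s) / real n ^ q) = t s n"
      using eventually_ge_at_top[of s] by eventually_elim (simp add: t_def)
    ultimately show ?thesis by (rule Lim_transform_eventually)
  qed
  have K_pos: "0 < K" using K0 by (simp add: K_def)
  have "norm (t s n) \<le> a s * K" if "0 < n" for s n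
    using mult_left_mono[OF K[of "n - s" n] a(1)[of s]] that a(1)[of s] K_pos
    by (simp add: t_def abs_mult)
  then have "\<forall>\<^sub>F (s, n) in sequentially \<times>\<^sub>F sequentially. norm (t s n) \<le> a s * K"
    unfolding eventually_prod_sequentially by (intro exI[of _ 1]) auto
  \<comment> \<open>Dominated convergence for series: each term tends to \<open>a s * c\<close> and
    is bounded by the summable \<open>a s * K\<close>.\<close>
  then have "(\<lambda>n. \<Sum>s. t s n) \<longlonglongrightarrow> (\<Sum>s. a s * c)"
    using tannerys_theorem[of t "\<lambda>s. a s * c" sequentially "\<lambda>s. a s * K"] lim a(2)
    by (auto intro: summable_mult2)
  moreover have "(\<Sum>s. t s n) = (\<Sum>s\<le>n. a s * b (n - s)) / real n ^ q" for n
  proof -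
    have "(\<Sum>s. t s n) = (\<Sum>s\<le>n. t s n)" by (rule suminf_finite) (auto simp: t_def)
    then show ?thesis by (simp add: t_def sum_divide_distrib)
  qed
  ultimately show ?thesis using suminf_mult2[OF a(2), of c] by (simp add: mult.commute)
qed

lemma cesaro_null:
  fixes x :: "nat \<Rightarrow> real"
  assumes "\<And>k. 0 \<le> x k" "x \<longlonglongrightarrow> 0"
  shows "(\<lambda>n. (\<Sum>k\<le>n. x k) / real n) \<longlonglongrightarrow> 0"
proof (rule LIMSEQ_I)
  fix e :: real assume "0 < e"
  then obtain N where N: "\<And>k. N \<le> k \<Longrightarrow> x k < e / 4"
    using LIMSEQ_D[OF assms(2), of "e / 4"] assms(1) by auto
  define A where "A = (\<Sum>k<N. x k)"
  \<comment> \<open>For n \<ge> M the terms of index below N contribute less than e / 4 to the mean.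
    The other terms, at most n + 1 in number, are at most e / 4 each and so contribute at most e /
    2.\<close>
  obtain M :: nat where M: "A / (e / 4) < real M" using reals_Archimedean2 by blast
  have "norm ((\<Sum>k\<le>n. x k) / real n - 0) < e" if "max M 1 \<le> n" for n
  proof -
    have n: "M \<le> n" "1 \<le> real n" using that by auto
    have "(\<Sum>k\<le>n. x k) \<le> (\<Sum>k\<le>n. (if k < N then x k else 0) + e / 4)"
      by (rule sum_mono) (use N \<open>0 < e\<close> in \<open>auto simp: not_less intro: less_imp_le\<close>)
    also have "\<dots> = (\<Sum>k\<le>n. if k < N then x k else 0) + (real n + 1) * (e / 4)"
      by (simp add: sum.distrib algebra_simps)
    also have "(\<Sum>k\<le>n. if k < N then x k else 0) = sum x ({..n} \<inter> {k. k < N})"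
      by (simp add: sum.inter_restrict)
    also have "\<dots> \<le> A"
      unfolding A_def by (rule sum_mono2) (use assms in auto)
    finally have "(\<Sum>k\<le>n. x k) \<le> A + (real n + 1) * (e / 4)" by simp
    moreover have "A < real n * (e / 4)"
      using M n \<open>0 < e\<close> by (simp add: divide_simps split: if_splits)
        (meson mult_le_cancel_right_pos less_le_trans of_nat_le_iff)
    moreover have "(real n + 1) * (e / 4) = e * real n / 4 + e / 4" "real n * (e / 4) = e * real n / 4"
      by (simp_all add: field_simps)
    moreover have "e * 1 \<le> e * real n" by (rule mult_left_mono) (use n \<open>0 < e\<close> in auto)
    ultimately have "(\<Sum>k\<le>n. x k) < e * real n"
      using \<open>0 < e\<close> by linarith
    moreover have "0 \<le> (\<Sum>k\<le>n. x k)" by (intro sum_nonneg assms)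
    ultimately show ?thesis using n by (simp add: field_simps)
  qed
  then show "\<exists>no. \<forall>n\<ge>no. norm ((\<Sum>k\<le>n. x k) / real n - 0) < e" by blast
qed

text \<open>Factor the difference of powers into q + 1 products and estimate each of them. Summed
  over k, the bounds telescope and enclose the power sums of
  \<open>sum_powers_asymp\<close>.\<close>

lemma power_Suc_diff_bounds:
  "real (Suc q) * real k ^ q \<le> real (Suc k) ^ Suc q - real k ^ Suc q"
  "real (Suc k) ^ Suc q - real k ^ Suc q \<le> real (Suc q) * real (Suc k) ^ q"
proof -
  have eq: "real (Suc k) ^ Suc q - real k ^ Suc q = (\<Sum>i<Suc q. real (Suc k) ^ i * real k ^ (q - i))"
    by (subst power_diff_sumr2) (simp add: mult.commute)
  have "(\<Sum>i<Suc q. real k ^ q) \<le> (\<Sum>i<Suc q. real (Suc k) ^ i * real k ^ (q - i))"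
  proof (rule sum_mono)
    fix i assume "i \<in> {..<Suc q}"
    then have "real k ^ q = real k ^ i * real k ^ (q - i)" by (simp flip: power_add)
    also have "\<dots> \<le> real (Suc k) ^ i * real k ^ (q - i)"
      by (intro mult_right_mono power_mono) auto
    finally show "real k ^ q \<le> real (Suc k) ^ i * real k ^ (q - i)" .
  qed
  then show "real (Suc q) * real k ^ q \<le> real (Suc k) ^ Suc q - real k ^ Suc q"
    unfolding eq by simp
  have "(\<Sum>i<Suc q. real (Suc k) ^ i * real k ^ (q - i)) \<le> (\<Sum>i<Suc q. real (Suc k) ^ q)"
  proof (rule sum_mono)
    fix i assume "i \<in> {..<Suc q}"
    have "real (Suc k) ^ i * real k ^ (q - i) \<le> real (Suc k) ^ i * real (Suc k) ^ (q - i)"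
      by (intro mult_left_mono power_mono) auto
    also have "\<dots> = real (Suc k) ^ q" using \<open>i \<in> _\<close> by (simp flip: power_add)
    finally show "real (Suc k) ^ i * real k ^ (q - i) \<le> real (Suc k) ^ q" .
  qed
  then show "real (Suc k) ^ Suc q - real k ^ Suc q \<le> real (Suc q) * real (Suc k) ^ q"
    unfolding eq by simp
qed

lemma sum_powers_asymp:
  "(\<lambda>n. (\<Sum>k\<le>n. real k ^ q) / real n ^ Suc q) \<longlonglongrightarrow> 1 / real (Suc q)"
proof -
  let ?S = "\<lambda>n. \<Sum>k\<le>n. real k ^ q"
  have lower: "real n ^ Suc q \<le> real (Suc q) * ?S n" for n
  proof (induction n)
    case (Suc n)
    then show ?case using power_Suc_diff_bounds(2)[of n q] by (simp add: algebra_simps)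
  qed simp
  have upper: "real (Suc q) * ?S n \<le> real n ^ Suc q + real (Suc q) * real n ^ q" for n
  proof (induction n)
    case (Suc n)
    then show ?case using power_Suc_diff_bounds(1)[of q n] by (simp add: algebra_simps)
  qed simp
  have **: "x / Q / x = 1 / Q" if "0 < x" "0 < Q" for x Q :: real
    using that by simp
  have *: "(x * y + Q * y) / Q / (x * y) = 1 / Q + inverse x" if "0 < x" "0 < y" "0 < Q" for x y Q :: real
    using that by (simp add: field_simps)
  show ?thesis
  proof (rule tendsto_sandwich)
    show "(\<lambda>n. 1 / real (Suc q)) \<longlonglongrightarrow> 1 / real (Suc q)" by simp
    have "(\<lambda>n. 1 / real (Suc q) + inverse (real n)) \<longlonglongrightarrow> 1 / real (Suc q) + 0"
      by (intro tendsto_add tendsto_const lim_inverse_n)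
    then show "(\<lambda>n. 1 / real (Suc q) + inverse (real n)) \<longlonglongrightarrow> 1 / real (Suc q)" by simp
    show "\<forall>\<^sub>F n in sequentially. 1 / real (Suc q) \<le> ?S n / real n ^ Suc q"
      using eventually_gt_at_top[of 0]
    proof eventually_elim
      case (elim n)
      have pos: "0 < real n ^ Suc q" "0 < real (Suc q)" using elim by simp_all
      have "real n ^ Suc q / real (Suc q) \<le> ?S n"
        using lower[of n] pos(2) by (simp only: divide_le_eq) (simp add: mult.commute)
      then have "real n ^ Suc q / real (Suc q) / real n ^ Suc q \<le> ?S n / real n ^ Suc q"
        using pos(1) by (intro divide_right_mono) auto
      moreover have "real n ^ Suc q / real (Suc q) / real n ^ Suc q = 1 / real (Suc q)"
        using ** [OF pos] .
      ultimately show ?case by simp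
    qed
    show "\<forall>\<^sub>F n in sequentially. ?S n / real n ^ Suc q \<le> 1 / real (Suc q) + inverse (real n)"
      using eventually_gt_at_top[of 0]
    proof eventually_elim
      case (elim n)
      have pos: "0 < real n ^ Suc q" "0 < real (Suc q)" using elim by simp_all
      have "?S n \<le> (real n ^ Suc q + real (Suc q) * real n ^ q) / real (Suc q)"
        using upper[of n] pos(2) by (simp only: le_divide_eq) (simp add: mult.commute)
      then have "?S n / real n ^ Suc q \<le> (real n ^ Suc q + real (Suc q) * real n ^ q) / real (Suc q) / real n ^ Suc q"
        using pos(1) by (intro divide_right_mono) auto
      also have "\<dots> = 1 / real (Suc q) + inverse (real n)"
        using * [of "real n" "real n ^ q" "real (Suc q)"] elim by (simp only: power_Suc) simp
      finally show ?case .
    qed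
  qed
qed

text \<open>Replacing a and the normalised b by their limits leaves a power sum, which supplies the
  extra factor n and the denominator q + 1. The weights (k / n)^q are at most 1, so the error is
  bounded by two Cesaro means of null sequences.\<close>

lemma convolution_resonant_limit:
  fixes a b :: "nat \<Rightarrow> real"
  assumes a: "a \<longlonglongrightarrow> c" and b: "(\<lambda>n. b n / real n ^ q) \<longlonglongrightarrow> d"
  shows "(\<lambda>n. (\<Sum>k\<le>n. a (n - k) * b k) / real n ^ Suc q) \<longlonglongrightarrow> c * d / real (Suc q)"
proof -
  define \<beta> where "\<beta> = (\<lambda>k. b k / real k ^ q)"
  have \<beta>: "\<beta> \<longlonglongrightarrow> d" using b by (simp add: \<beta>_def)
  obtain K where K: "0 < K" "\<And>n. \<bar>\<beta> n\<bar> \<le> K"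
    using convergent_imp_Bseq[OF convergentI[OF \<beta>]] by (auto simp: Bseq_def)
  \<comment> \<open>The correction at k = 0 is due to division by zero: for q > 0 the value
    \<open>\<beta> 0\<close> is 0 and does not recover \<open>b 0\<close>. It contributes a single
    term, which vanishes after division by the power of n.\<close>
  have b_eq: "b k = \<beta> k * real k ^ q + (if k = 0 then b 0 - \<beta> 0 * 0 ^ q else 0)" for k
    by (simp add: \<beta>_def)
  define E where "E = (\<lambda>n. (\<Sum>k\<le>n. (a (n - k) * \<beta> k - c * d) * (real k ^ q / real n ^ q)) / real n)"
  define D where "D = (\<lambda>n. (\<Sum>k\<le>n. \<bar>a k - c\<bar>) / real n * K + \<bar>c\<bar> * ((\<Sum>k\<le>n. \<bar>\<beta> k - d\<bar>) / real n))"
  have E_le: "norm (E n) \<le> D n" for n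
  proof -
    have "\<bar>(a (n - k) * \<beta> k - c * d) * (real k ^ q / real n ^ q)\<bar> \<le> \<bar>a (n - k) - c\<bar> * K + \<bar>c\<bar> * \<bar>\<beta> k - d\<bar>"
      if "k \<le> n" for k
    proof -
      have "\<bar>(a (n - k) * \<beta> k - c * d) * (real k ^ q / real n ^ q)\<bar>
        = \<bar>a (n - k) * \<beta> k - c * d\<bar> * (real k ^ q / real n ^ q)" by (simp add: abs_mult)
      also have "\<dots> \<le> \<bar>a (n - k) * \<beta> k - c * d\<bar> * 1"
        using that by (intro mult_left_mono) (auto simp: divide_le_eq_1 power_mono)
      also have "\<dots> = \<bar>(a (n - k) - c) * \<beta> k + c * (\<beta> k - d)\<bar>"
        by (simp add: algebra_simps)
      also have "\<dots> \<le> \<bar>a (n - k) - c\<bar> * \<bar>\<beta> k\<bar> + \<bar>c\<bar> * \<bar>\<beta> k - d\<bar>"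
        unfolding abs_mult[symmetric] by (rule abs_triangle_ineq)
      finally show ?thesis using mult_left_mono[OF K(2)[of k], of "\<bar>a (n - k) - c\<bar>"] by simp
    qed
    then have "\<bar>\<Sum>k\<le>n. (a (n - k) * \<beta> k - c * d) * (real k ^ q / real n ^ q)\<bar>
      \<le> (\<Sum>k\<le>n. \<bar>a (n - k) - c\<bar> * K + \<bar>c\<bar> * \<bar>\<beta> k - d\<bar>)"
      by (intro order_trans[OF sum_abs sum_mono]) auto
    also have "\<dots> = (\<Sum>k\<le>n. \<bar>a (n - k) - c\<bar>) * K + \<bar>c\<bar> * (\<Sum>k\<le>n. \<bar>\<beta> k - d\<bar>)"
      by (simp add: sum.distrib sum_distrib_left sum_distrib_right)
    also have "(\<Sum>k\<le>n. \<bar>a (n - k) - c\<bar>) = (\<Sum>k\<le>n. \<bar>a k - c\<bar>)"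
      using sum.nat_diff_reindex[of "\<lambda>k. \<bar>a k - c\<bar>" "Suc n"] by (simp add: lessThan_Suc_atMost)
    finally show ?thesis
      unfolding E_def D_def by (simp add: divide_simps)
  qed
  have "D \<longlonglongrightarrow> 0 * K + \<bar>c\<bar> * 0"
    unfolding D_def
    by (intro tendsto_add tendsto_mult tendsto_const cesaro_null)
       (use LIM_zero[OF a] LIM_zero[OF \<beta>] tendsto_rabs_zero in auto)
  then have E: "E \<longlonglongrightarrow> 0" using E_le by (intro Lim_null_comparison[of E D]) auto
  have "(\<lambda>n. E n + c * d * ((\<Sum>k\<le>n. real k ^ q) / real n ^ Suc q)
      + a n * (b 0 - \<beta> 0 * 0 ^ q) * inverse (real n) ^ Suc q) \<longlonglongrightarrow> 0 + c * d * (1 / real (Suc q)) + c * (b 0 - \<beta> 0 * 0 ^ q) * 0 ^ Suc q"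
    by (intro tendsto_add tendsto_mult E a tendsto_const sum_powers_asymp tendsto_power lim_inverse_n)
  moreover have "\<forall>\<^sub>F n in sequentially. E n + c * d * ((\<Sum>k\<le>n. real k ^ q) / real n ^ Suc q)
      + a n * (b 0 - \<beta> 0 * 0 ^ q) * inverse (real n) ^ Suc q = (\<Sum>k\<le>n. a (n - k) * b k) / real n ^ Suc q"
    using eventually_gt_at_top[of 0]
  proof eventually_elim
    case (elim n)
    let ?N = "real n ^ Suc q"
    have N: "?N \<noteq> 0" using elim by simp
    have "(\<Sum>k\<le>n. a (n - k) * b k) = (\<Sum>k\<le>n. a (n - k) * \<beta> k * real k ^ q)
        + (\<Sum>k\<le>n. if k = 0 then a (n - k) * (b 0 - \<beta> 0 * 0 ^ q) else 0)"
      unfolding sum.distrib[symmetric]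
      by (rule sum.cong[OF refl], subst b_eq) (simp add: algebra_simps)
    also have "(\<Sum>k\<le>n. if k = 0 then a (n - k) * (b 0 - \<beta> 0 * 0 ^ q) else 0) = a n * (b 0 - \<beta> 0 * 0 ^ q)"
      by (simp add: sum.delta)
    also have "(\<Sum>k\<le>n. a (n - k) * \<beta> k * real k ^ q)
      = (\<Sum>k\<le>n. (a (n - k) * \<beta> k - c * d) * real k ^ q) + c * d * (\<Sum>k\<le>n. real k ^ q)"
      by (simp add: sum_distrib_left sum.distrib[symmetric] algebra_simps)
    finally have "(\<Sum>k\<le>n. a (n - k) * b k) / ?N
      = (\<Sum>k\<le>n. (a (n - k) * \<beta> k - c * d) * real k ^ q) / ?N
        + c * d * ((\<Sum>k\<le>n. real k ^ q) / ?N) + a n * (b 0 - \<beta> 0 * 0 ^ q) / ?N"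
      by (simp only: add_divide_distrib times_divide_eq_right)
    moreover have "E n = (\<Sum>k\<le>n. (a (n - k) * \<beta> k - c * d) * real k ^ q) / ?N"
      by (simp add: E_def sum_divide_distrib mult.commute)
    ultimately show ?case by (simp add: divide_inverse power_inverse)
  qed
  ultimately show ?thesis using Lim_transform_eventually by fastforce
qed

lemma summable_geometric_ratio:
  fixes f :: "nat \<Rightarrow> real"
  assumes "(\<lambda>n. f n / R ^ n) \<longlonglongrightarrow> c" "0 < R" "R < L"
  shows "summable (\<lambda>n. f n / L ^ n)"
proof -
  obtain K where K: "0 < K" "\<And>n. norm (f n / R ^ n) \<le> K"
    using convergent_imp_Bseq[OF convergentI[OF assms(1)]] by (auto simp: Bseq_def)
  have "norm (f n / L ^ n) \<le> K * (R / L) ^ n" for n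
  proof -
    have "f n / L ^ n = f n / R ^ n * (R / L) ^ n" using assms by (simp add: power_divide)
    then have "norm (f n / L ^ n) = norm (f n / R ^ n) * (R / L) ^ n"
      using assms by (simp only: norm_mult) simp
    also have "\<dots> \<le> K * (R / L) ^ n" by (rule mult_right_mono[OF K(2)]) (use assms in auto)
    finally show ?thesis .
  qed
  moreover have "summable (\<lambda>n. K * (R / L) ^ n)"
    by (intro summable_mult summable_geometric) (use assms in auto)
  ultimately show ?thesis by (rule summable_comparison_test'[of _ 0, rotated])
qed

text \<open>Supplies the positive term that makes the sum of a series, and with it the limit
  constant of a convolution, positive.\<close>

lemma tendsto_pos_imp_ex_pos:
  fixes f g :: "nat \<Rightarrow> real"
  assumes "(\<lambda>n. f n / g n) \<longlonglongrightarrow> c" "0 < c" "\<And>n. 0 \<le> g n"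
  shows "\<exists>n. 0 < f n"
proof -
  have "\<forall>\<^sub>F n in sequentially. 0 < f n / g n"
    using assms(1,2) by (rule order_tendstoD)
  then obtain n where "0 < f n / g n" by (metis eventually_sequentially order_refl)
  with assms(3)[of n] show ?thesis by (auto simp: zero_less_divide_iff intro!: exI[of _ n])
qed

text \<open>The rate of the convolution of a sequence of rate (r, 1) with one of rate P. The
  exponent 1 reflects that powers of a primitive block carry no polynomial factor. A vanishing
  second sequence is kept apart, as it would otherwise fall under the case of a smaller base and
  receive the rate (r, 1).\<close>

definition comb :: "real \<Rightarrow> real \<times> nat \<Rightarrow> real \<times> nat" where
  "comb r P = (if P = (0, 0) then (0, 0) else if r < fst P then P
     else if fst P = r then (r, Suc (snd P)) else (r, 1))"

lemma comb_zero [simp]: "comb r (0, 0) = (0, 0)"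
  by (simp add: comb_def)

lemma comb_mono:
  assumes "0 < r" "(0, 0) \<le> P" "P \<le> Q"
  shows "comb r P \<le> comb r Q"
proof (cases "P = (0, 0)")
  case True
  then show ?thesis using assms by (cases Q) (auto simp: comb_def)
next
  case False
  then have "Q \<noteq> (0, 0)" using assms by auto
  with False assms show ?thesis by (cases P; cases Q) (auto simp: comb_def)
qed

text \<open>Monotonicity lets \<open>comb\<close> pass through a finite maximum; the bottom pair is
  a fixed point.\<close>

lemma comb_Max:
  assumes "0 < r" "finite A" "\<And>P. P \<in> A \<Longrightarrow> (0, 0) \<le> P"
  shows "comb r (Max (insert (0, 0) A)) = Max (insert (0, 0) (comb r ` A))"
proof (rule Max_eqI[symmetric])
  let ?M = "Max (insert (0, 0) A)"
  have M: "?M \<in> insert (0, 0) A" using assms by (intro Max_in) auto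
  then show "comb r ?M \<in> insert (0, 0) (comb r ` A)" by auto
  fix y assume "y \<in> insert (0, 0) (comb r ` A)"
  then obtain P where P: "P \<in> insert (0, 0) A" "y = comb r P" by force
  then have "P \<le> ?M" using assms by (intro Max_ge) auto
  moreover have "(0, 0) \<le> P" using P(1) assms(3) by blast
  ultimately show "y \<le> comb r ?M" unfolding P(2) using assms(1) by (intro comb_mono)
qed (use assms in auto)

text \<open>After division by powers of the larger base the sequence of smaller base becomes
  summable, and its sum enters the limit constant. For equal bases both normalised sequences
  persist, and the number of summands yields the additional factor n.\<close>

lemma grows_convolution:
  assumes \<alpha>: "\<And>n. 0 \<le> \<alpha> n" "(\<lambda>n. \<alpha> n / r ^ n) \<longlonglongrightarrow> c" and "0 < c" "0 < r"
    and g: "\<And>n. 0 \<le> g n" "grows g P"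
  shows "grows (\<lambda>n. \<Sum>k\<le>n. \<alpha> (n - k) * g k) (comb r P)"
  using g(2)
proof (cases rule: grows_cases)
  case zero
  then show ?thesis by (simp add: grows_zero)
next
  case (pos L q d)
  have flip: "(\<Sum>k\<le>n. \<alpha> (n - k) * g k) = (\<Sum>k\<le>n. \<alpha> k * g (n - k))" for n
    using sum.nat_diff_reindex[of "\<lambda>k. \<alpha> k * g (n - k)" "Suc n"] by (simp add: lessThan_Suc_atMost)
  have g_lim: "(\<lambda>n. g n / L ^ n / real n ^ (q - 1)) \<longlonglongrightarrow> d"
    using pos(5) by (simp add: rate_def mult.commute)
  have split: "x / R ^ a * (y / R ^ b) = x * y / R ^ n" if "a + b = n" for x y R :: real and a b n
    by (simp add: power_add that[symmetric])
  consider "r < L" | "L = r" | "L < r" by linarith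
  then show ?thesis
  proof cases
    case 1
    define a where "a = (\<lambda>s. \<alpha> s / L ^ s)"
    have a0: "0 \<le> a s" for s using \<alpha>(1)[of s] pos by (simp add: a_def)
    have a: "summable a" unfolding a_def by (rule summable_geometric_ratio[OF \<alpha>(2) \<open>0 < r\<close> 1])
    obtain s where "0 < \<alpha> s" using tendsto_pos_imp_ex_pos[OF \<alpha>(2) \<open>0 < c\<close>] \<open>0 < r\<close> by auto
    then have "0 < suminf a" using pos by (intro suminf_pos2[OF a a0, of s]) (simp add: a_def)
    have "(\<lambda>n. (\<Sum>s\<le>n. a s * (g (n - s) / L ^ (n - s))) / real n ^ (q - 1)) \<longlonglongrightarrow> d * suminf a"
      by (rule convolution_summable_limit[OF a0 a g_lim])
    moreover have "(\<Sum>s\<le>n. a s * (g (n - s) / L ^ (n - s))) / real n ^ (q - 1)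
        = (\<Sum>k\<le>n. \<alpha> (n - k) * g k) / rate L q n" for n
    proof -
      have "(\<Sum>s\<le>n. a s * (g (n - s) / L ^ (n - s))) = (\<Sum>s\<le>n. \<alpha> s * g (n - s) / L ^ n)"
        unfolding a_def by (intro sum.cong refl split) auto
      then show ?thesis
        by (simp only: flip rate_def divide_divide_eq_left flip: sum_divide_distrib) (simp only: mult.commute)
    qed
    ultimately have "grows (\<lambda>n. \<Sum>k\<le>n. \<alpha> (n - k) * g k) (L, q)"
      by (intro growsI[of L q "d * suminf a"]) (use pos \<open>0 < suminf a\<close> in auto)
    then show ?thesis using 1 pos by (simp add: comb_def)
  next
    case 2
    have "(\<lambda>n. (\<Sum>k\<le>n. \<alpha> (n - k) / r ^ (n - k) * (g k / r ^ k)) / real n ^ Suc (q - 1)) \<longlonglongrightarrow> c * d / real (Suc (q - 1))"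
      by (rule convolution_resonant_limit[OF \<alpha>(2)]) (use g_lim 2 in simp)
    moreover have "(\<Sum>k\<le>n. \<alpha> (n - k) / r ^ (n - k) * (g k / r ^ k)) / real n ^ Suc (q - 1)
        = (\<Sum>k\<le>n. \<alpha> (n - k) * g k) / rate r (Suc q) n" for n
    proof -
      have "(\<Sum>k\<le>n. \<alpha> (n - k) / r ^ (n - k) * (g k / r ^ k)) = (\<Sum>k\<le>n. \<alpha> (n - k) * g k / r ^ n)"
        by (intro sum.cong refl split) auto
      then show ?thesis using pos by (simp add: rate_def mult.commute flip: sum_divide_distrib)
    qed
    ultimately have "grows (\<lambda>n. \<Sum>k\<le>n. \<alpha> (n - k) * g k) (r, Suc q)"
      by (intro growsI[of r "Suc q" "c * d / real (Suc (q - 1))"]) (use pos \<open>0 < c\<close> \<open>0 < r\<close> in auto)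
    then show ?thesis using 2 pos by (simp add: comb_def)
  next
    case 3
    \<comment> \<open>An intermediate base absorbs the polynomial factor of g, so that the
      comparison with a geometric series applies.\<close>
    define M where "M = (L + r) / 2"
    have M: "L < M" "M < r" "0 < M" using 3 pos by (auto simp: M_def)
    have "(\<lambda>n. g n / rate M 1 n) \<longlonglongrightarrow> 0"
      by (rule grows_less[OF g(2)]) (use M pos in auto)
    then have gM: "(\<lambda>n. g n / M ^ n) \<longlonglongrightarrow> 0" by (simp add: rate_def)
    define a where "a = (\<lambda>k. g k / r ^ k)"
    have a0: "0 \<le> a s" for s using g(1)[of s] \<open>0 < r\<close> by (simp add: a_def)
    have a: "summable a" unfolding a_def by (rule summable_geometric_ratio[OF gM M(3,2)])
    obtain s where "0 < g s" using tendsto_pos_imp_ex_pos[OF pos(5,4)] pos by (auto simp: rate_def)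
    then have "0 < suminf a" using \<open>0 < r\<close> by (intro suminf_pos2[OF a a0, of s]) (simp add: a_def)
    have "(\<lambda>n. (\<Sum>k\<le>n. a k * (\<alpha> (n - k) / r ^ (n - k))) / real n ^ 0) \<longlonglongrightarrow> c * suminf a"
      by (rule convolution_summable_limit[OF a0 a]) (use \<alpha> in simp)
    moreover have "(\<Sum>k\<le>n. a k * (\<alpha> (n - k) / r ^ (n - k))) / real n ^ 0
        = (\<Sum>k\<le>n. \<alpha> (n - k) * g k) / rate r 1 n" for n
    proof -
      have "(\<Sum>k\<le>n. a k * (\<alpha> (n - k) / r ^ (n - k))) = (\<Sum>k\<le>n. g k * \<alpha> (n - k) / r ^ n)"
        unfolding a_def by (intro sum.cong refl split) auto
      then show ?thesis by (simp add: rate_def mult.commute flip: sum_divide_distrib)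
    qed
    ultimately have "grows (\<lambda>n. \<Sum>k\<le>n. \<alpha> (n - k) * g k) (r, 1)"
      by (intro growsI[of r 1 "c * suminf a"]) (use \<open>0 < c\<close> \<open>0 < r\<close> \<open>0 < suminf a\<close> in auto)
    then show ?thesis using 3 pos by (simp add: comb_def)
  qed
qed

lemma mapp_funpow_Suc: "(mapp C B ^^ Suc n) v i = (\<Sum>j\<in>C. B i j * (mapp C B ^^ n) v j)"
  by (simp add: mapp_def)

section \<open>Linear recursions on one block, driven from outside\<close>

lemma duhamel:
  assumes "\<And>n i. i \<in> C \<Longrightarrow> h (Suc n) i = mapp C B (h n) i + g n i" "i \<in> C"
  shows "h n i = (mapp C B ^^ n) (h 0) i + (\<Sum>k<n. (mapp C B ^^ (n - 1 - k)) (g k) i)"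
  using assms(2)
proof (induction n arbitrary: i)
  case (Suc n)
  have "h (Suc n) i = (\<Sum>j\<in>C. B i j * ((mapp C B ^^ n) (h 0) j + (\<Sum>k<n. (mapp C B ^^ (n - 1 - k)) (g k) j))) + g n i"
    using assms(1)[OF Suc.prems] Suc.IH by (simp add: mapp_def[of C B "h n"])
  also have "(\<Sum>j\<in>C. B i j * ((mapp C B ^^ n) (h 0) j + (\<Sum>k<n. (mapp C B ^^ (n - 1 - k)) (g k) j)))
    = (mapp C B ^^ Suc n) (h 0) i + (\<Sum>k<n. (mapp C B ^^ Suc (n - 1 - k)) (g k) i)"
    unfolding mapp_funpow_Suc distrib_left sum.distrib sum_distrib_left
    by (simp only: sum.swap[of _ C])
  also have "(\<Sum>k<n. (mapp C B ^^ Suc (n - 1 - k)) (g k) i) = (\<Sum>k<n. (mapp C B ^^ (n - k)) (g k) i)"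
  proof (rule sum.cong)
    fix k assume "k \<in> {..<n}"
    then have "Suc (n - 1 - k) = n - k" by auto
    then show "(mapp C B ^^ Suc (n - 1 - k)) (g k) i = (mapp C B ^^ (n - k)) (g k) i" by (simp only:)
  qed simp
  finally show ?case by simp
qed simp

text \<open>The solution is the free evolution of \<open>h 0\<close> plus, for every j, the
  convolution of the powers of the block with the forcing at j. The free part is present only if
  \<open>h 0\<close> charges the block; positivity of the Perron constants then makes it visible
  from every i, so the rate is common to all members of the block.\<close>

lemma grows_inhomogeneous:
  assumes "finite C" "i \<in> C" "0 < r"
    and B: "\<And>i j. i \<in> C \<Longrightarrow> j \<in> C \<Longrightarrow> 0 \<le> B i j"
    and perron: "\<And>i j. i \<in> C \<Longrightarrow> j \<in> C \<Longrightarrow> \<exists>c>0. (\<lambda>n. mpow C B n i j / r ^ n) \<longlonglongrightarrow> c"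
    and h: "\<And>n i. i \<in> C \<Longrightarrow> h (Suc n) i = mapp C B (h n) i + g n i"
    and h0: "\<And>i. i \<in> C \<Longrightarrow> 0 \<le> h 0 i" and g0: "\<And>n i. i \<in> C \<Longrightarrow> 0 \<le> g n i"
    and g: "\<And>i. i \<in> C \<Longrightarrow> grows (\<lambda>n. g n i) (Q i)"
  shows "grows (\<lambda>n. h n i) (max (if \<exists>j\<in>C. 0 < h 0 j then (r, 1) else (0, 0))
     (Max (insert (0, 0) (comb r ` Q ` C))))"
proof -
  have mpow0: "0 \<le> mpow C B n i j" for n j
    by (rule mpow_nonneg) (use B \<open>i \<in> C\<close> in auto)
  define H where "H = (\<lambda>n. \<Sum>j\<in>C. mpow C B n i j * h 0 j)"
  have "grows H (if \<exists>j\<in>C. 0 < h 0 j then (r, 1) else (0, 0))"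
  proof (cases "\<exists>j\<in>C. 0 < h 0 j")
    case True
    then obtain j0 where j0: "j0 \<in> C" "0 < h 0 j0" by auto
    obtain c where c: "\<And>j. j \<in> C \<Longrightarrow> 0 < c j \<and> (\<lambda>n. mpow C B n i j / r ^ n) \<longlonglongrightarrow> c j"
      using bchoice[of C "\<lambda>j c. 0 < c \<and> (\<lambda>n. mpow C B n i j / r ^ n) \<longlonglongrightarrow> c"] perron[OF \<open>i \<in> C\<close>] by blast
    have "(\<lambda>n. \<Sum>j\<in>C. mpow C B n i j / r ^ n * h 0 j) \<longlonglongrightarrow> (\<Sum>j\<in>C. c j * h 0 j)"
      by (intro tendsto_sum tendsto_mult tendsto_const) (use c in auto)
    moreover have "0 < (\<Sum>j\<in>C. c j * h 0 j)"
      by (rule sum_pos2[OF \<open>finite C\<close> j0(1)]) (use c h0 j0 in \<open>auto simp: less_imp_le\<close>)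
    ultimately have "grows H (r, 1)"
      by (intro growsI[of r 1 "\<Sum>j\<in>C. c j * h 0 j"])
         (use \<open>0 < r\<close> in \<open>auto simp: H_def rate_def sum_divide_distrib\<close>)
    then show ?thesis using True by simp
  next
    case False
    then have "H = (\<lambda>_. 0)" using h0 by (force simp: H_def intro!: sum.neutral)
    then show ?thesis using False by (simp add: grows_zero)
  qed
  moreover have "grows (\<lambda>n. h n i - H n) (Max (insert (0, 0) (comb r ` Q ` C)))"
  \<comment> \<open>Forcing at time k acts from time k + 1 on, so the convolution form holds for the
    sequence advanced by one; at time 0 the forced part vanishes.\<close>
  proof (rule grows_unshift)
    have "h (Suc n) i - H (Suc n) = (\<Sum>j\<in>C. \<Sum>k\<le>n. mpow C B (n - k) i j * g k j)" for n
    proof -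
      have "h (Suc n) i - H (Suc n) = (\<Sum>k\<le>n. (mapp C B ^^ (n - k)) (g k) i)"
        using duhamel[of C h B g, OF h \<open>i \<in> C\<close>, of "Suc n"] mapp_funpow[OF assms(1,2), of "Suc n" B "h 0"]
        by (simp add: H_def lessThan_Suc_atMost)
      also have "\<dots> = (\<Sum>k\<le>n. \<Sum>j\<in>C. mpow C B (n - k) i j * g k j)"
        by (intro sum.cong refl mapp_funpow assms)
      also have "\<dots> = (\<Sum>j\<in>C. \<Sum>k\<le>n. mpow C B (n - k) i j * g k j)" by (rule sum.swap)
      finally show ?thesis .
    qed
    moreover have "grows (\<lambda>n. \<Sum>j\<in>C. \<Sum>k\<le>n. mpow C B (n - k) i j * g k j)
        (Max (insert (0, 0) ((\<lambda>j. comb r (Q j)) ` C)))"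
    proof (rule grows_sum[OF \<open>finite C\<close>])
      fix j assume j: "j \<in> C"
      obtain c where "0 < c" "(\<lambda>n. mpow C B n i j / r ^ n) \<longlonglongrightarrow> c" using perron[OF \<open>i \<in> C\<close> j] by blast
      then show "grows (\<lambda>n. \<Sum>k\<le>n. mpow C B (n - k) i j * g k j) (comb r (Q j))"
        by (intro grows_convolution) (use mpow0 \<open>0 < r\<close> g0 g j in auto)
    qed
    ultimately show "grows (\<lambda>n. h (Suc n) i - H (Suc n)) (Max (insert (0, 0) (comb r ` Q ` C)))"
      by (simp add: image_image)
    show "h 0 i - H 0 = 0"
      using mapp_funpow[OF assms(1,2), of 0 B "h 0"] by (simp add: H_def)
  qed
  ultimately show ?thesis using grows_add by fastforce
qed

text \<open>The coordinates outside C act on the block as a forcing term through the edges leaving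
  C, so only the heads of these edges need a known rate.\<close>

lemma grows_block:
  assumes "finite I" "C \<subseteq> I" "i \<in> C" "0 < r"
    and X: "\<And>i j. i \<in> I \<Longrightarrow> j \<in> I \<Longrightarrow> 0 \<le> X i j" and w: "\<And>i. i \<in> I \<Longrightarrow> 0 \<le> w i"
    and perron: "\<And>i j. i \<in> C \<Longrightarrow> j \<in> C \<Longrightarrow> \<exists>c>0. (\<lambda>n. mpow C X n i j / r ^ n) \<longlonglongrightarrow> c"
    and P: "\<And>i b. i \<in> C \<Longrightarrow> b \<in> I - C \<Longrightarrow> 0 < X i b \<Longrightarrow> grows (\<lambda>n. (mapp I X ^^ n) w b) (P b)"
  shows "grows (\<lambda>n. (mapp I X ^^ n) w i) (max (if \<exists>j\<in>C. 0 < w j then (r, 1) else (0, 0))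
     (Max (insert (0, 0) (comb r ` P ` {b \<in> I - C. \<exists>i\<in>C. 0 < X i b}))))"
proof -
  let ?f = "\<lambda>n. (mapp I X ^^ n) w"
  define g where "g = (\<lambda>n i. \<Sum>b\<in>I - C. X i b * ?f n b)"
  define Q where "Q = (\<lambda>i. Max (insert (0, 0) (P ` {b \<in> I - C. 0 < X i b})))"
  have f0: "0 \<le> ?f n i" if "i \<in> I" for n i
    unfolding mapp_funpow[OF \<open>finite I\<close> that]
    by (intro sum_nonneg mult_nonneg_nonneg mpow_nonneg) (use X w that in auto)
  have finC: "finite C" using assms finite_subset by auto
  have g_grows: "grows (\<lambda>n. g n i) (Q i)" if i: "i \<in> C" for i
  proof -
    have "grows (\<lambda>n. \<Sum>b\<in>{b \<in> I - C. 0 < X i b}. X i b * ?f n b) (Q i)"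
      unfolding Q_def by (rule grows_sum) (use \<open>finite I\<close> P i in \<open>auto intro: grows_scale\<close>)
    moreover have "(\<Sum>b\<in>{b \<in> I - C. 0 < X i b}. X i b * ?f n b) = g n i" for n
      unfolding g_def
      by (rule sum.mono_neutral_left) (use \<open>finite I\<close> X i \<open>C \<subseteq> I\<close> in \<open>auto simp: order.strict_iff_order\<close>)
    ultimately show ?thesis by simp
  qed
  have "grows (\<lambda>n. ?f n i) (max (if \<exists>j\<in>C. 0 < ?f 0 j then (r, 1) else (0, 0))
     (Max (insert (0, 0) (comb r ` Q ` C))))"
  proof (rule grows_inhomogeneous[where h = ?f and g = g, OF finC \<open>i \<in> C\<close> \<open>0 < r\<close> _ perron])
    fix n i assume "i \<in> C"
    have "mapp I X (?f n) i = (\<Sum>b\<in>C \<union> (I - C). X i b * ?f n b)"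
      using \<open>C \<subseteq> I\<close> by (simp add: mapp_def Un_absorb1)
    also have "\<dots> = mapp C X (?f n) i + g n i"
      unfolding g_def mapp_def by (rule sum.union_disjoint) (use finC \<open>finite I\<close> in auto)
    finally show "?f (Suc n) i = mapp C X (?f n) i + g n i" by simp
  next
    fix n i assume "i \<in> C"
    then show "0 \<le> g n i" unfolding g_def
      by (intro sum_nonneg mult_nonneg_nonneg X f0) (use \<open>C \<subseteq> I\<close> in auto)
  qed (use X w \<open>C \<subseteq> I\<close> g_grows in auto)
  \<comment> \<open>The rates are maximised over the exits of each row and then over the rows; since
    \<open>comb\<close> commutes with maxima, this is one maximum over all exits of the
    block.\<close>
  moreover have "Max (insert (0, 0) (comb r ` Q ` C)) = Max (insert (0, 0) (comb r ` P ` {b \<in> I - C. \<exists>i\<in>C. 0 < X i b}))"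
  proof -
    have PQ: "comb r (Q i) = Max (insert (0, 0) (comb r ` P ` {b \<in> I - C. 0 < X i b}))" if "i \<in> C" for i
      unfolding Q_def using \<open>0 < r\<close> \<open>finite I\<close> P[OF that, THEN grows_bot] by (intro comb_Max) auto
    let ?S = "\<lambda>i. comb r ` P ` {b \<in> I - C. 0 < X i b}"
    have finS: "finite (?S i)" for i using \<open>finite I\<close> by auto
    have "Max (insert (0, 0) (comb r ` Q ` C)) = Max (\<Union>i\<in>C. insert (0, 0) (?S i))"
    proof (rule Max_eqI)
      show "finite (insert (0, 0) (comb r ` Q ` C))" using finC by simp
      show "Max (\<Union>i\<in>C. insert (0, 0) (?S i)) \<in> insert (0, 0) (comb r ` Q ` C)"
      proof -
        have "Max (\<Union>i\<in>C. insert (0, 0) (?S i)) \<in> (\<Union>i\<in>C. insert (0, 0) (?S i))"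
          using finS finC \<open>i \<in> C\<close> by (intro Max_in) auto
        then obtain k where k: "k \<in> C" "Max (\<Union>i\<in>C. insert (0, 0) (?S i)) \<in> insert (0, 0) (?S k)" by blast
        have "Max (\<Union>i\<in>C. insert (0, 0) (?S i)) = Max (insert (0, 0) (?S k))"
        proof (rule Max_eqI[symmetric])
          fix y assume "y \<in> insert (0, 0) (?S k)"
          then show "y \<le> Max (\<Union>i\<in>C. insert (0, 0) (?S i))"
            using finS finC k(1) by (intro Max_ge) auto
        qed (use finS k in auto)
        then have "Max (\<Union>i\<in>C. insert (0, 0) (?S i)) = comb r (Q k)" using PQ[OF k(1)] by (simp only:)
        then show ?thesis using k(1) by (simp only: insertI2 imageI)
      qed
      fix y assume "y \<in> insert (0, 0) (comb r ` Q ` C)"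
      then consider "y = (0, 0)" | k where "k \<in> C" "y = comb r (Q k)" by auto
      then show "y \<le> Max (\<Union>i\<in>C. insert (0, 0) (?S i))"
      proof cases
        case 1
        then show ?thesis using finS finC \<open>i \<in> C\<close> by (intro Max_ge) auto
      next
        case 2
        then show ?thesis unfolding 2(2) PQ[OF 2(1)]
          using finS finC by (intro Max_mono) auto
      qed
    qed
    also have "(\<Union>i\<in>C. insert (0, 0) (?S i)) = insert (0, 0) (comb r ` P ` {b \<in> I - C. \<exists>i\<in>C. 0 < X i b})"
      using \<open>i \<in> C\<close> by auto
    finally show ?thesis .
  qed
  ultimately show ?thesis by simp
qed

section \<open>Powers of nonnegative matrices with primitive diagonal blocks\<close>

lemma mpow_reindex:
  assumes "bij_betw \<pi> I C" "i \<in> I" "j \<in> I"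
  shows "mpow I (\<lambda>i j. B (\<pi> i) (\<pi> j)) n i j = mpow C B n (\<pi> i) (\<pi> j)"
  using assms(2)
proof (induction n arbitrary: i)
  case 0
  then show ?case using assms by (auto simp: mpow_0 bij_betw_def inj_on_def)
next
  case (Suc n)
  then show ?case
    using sum.reindex_bij_betw[OF assms(1), of "\<lambda>k. B (\<pi> i) k * mpow C B n k (\<pi> j)"]
    by (simp add: mpow_Suc)
qed

abbreviation entries :: "real mat \<Rightarrow> nat \<Rightarrow> nat \<Rightarrow> real" where
  "entries X \<equiv> \<lambda>i j. X $$ (i, j)"

lemma pow_mat_entries:
  assumes X: "X \<in> carrier_mat d d" and "i < d" "j < d"
  shows "(X ^\<^sub>m n) $$ (i, j) = mpow {..<d} (entries X) n i j"
  using assms(2,3)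
proof (induction n arbitrary: i j)
  case 0
  then show ?case using X by (simp add: mpow_0)
next
  case (Suc n)
  have "(X ^\<^sub>m Suc n) $$ (i, j) = (\<Sum>k<d. (X ^\<^sub>m n) $$ (i, k) * X $$ (k, j))"
    using X Suc.prems pow_carrier_mat[OF X, of n]
    by (simp add: scalar_prod_def atLeast0LessThan)
  also have "\<dots> = mpow {..<d} (entries X) (Suc n) i j"
    using Suc by (simp add: mpow_Suc_right)
  finally show ?case .
qed

text \<open>\<open>submatrix\<close> numbers the members of C increasingly by \<open>pick\<close>;
  this bijection carries the powers of the submatrix over to the kernel on C.\<close>

lemma pick_bij_betw:
  assumes "finite C" shows "bij_betw (pick C) {..<card C} C"
proof (rule bij_betwI')
  show "(pick C x = pick C y) = (x = y)" if "x \<in> {..<card C}" "y \<in> {..<card C}" for x y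
    using that pick_mono[of y C x] pick_mono[of x C y] by (metis lessThan_iff nat_neq_iff)
  show "pick C x \<in> C" if "x \<in> {..<card C}" for x
    using that pick_in_set by auto
  show "\<exists>x\<in>{..<card C}. y = pick C x" if "y \<in> C" for y
  proof
    show "y = pick C (card {a \<in> C. a < y})" using pick_card_in_set[OF that] by simp
    have "{a \<in> C. a < y} \<subset> C" using that by auto
    then show "card {a \<in> C. a < y} \<in> {..<card C}" using assms by (simp add: psubset_card_mono)
  qed
qed

text \<open>That r is an eigenvalue gives one bound. For the other, take absolute values in the
  equation of any complex eigenvector and pair with the positive left eigenvector: the modulus of
  the eigenvalue times the pairing is at most r times the pairing, which is positive.\<close>

lemma spectral_radius_eq_perron_root:
  assumes A: "A \<in> carrier_mat k k" "0 < k" and nonneg: "\<And>i j. i < k \<Longrightarrow> j < k \<Longrightarrow> 0 \<le> A $$ (i, j)"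
    and "0 < r" and x: "\<And>i. i < k \<Longrightarrow> 0 < x i" "\<And>i. i < k \<Longrightarrow> mapp {..<k} (entries A) x i = r * x i"
    and y: "\<And>i. i < k \<Longrightarrow> 0 < y i" "\<And>j. j < k \<Longrightarrow> (\<Sum>i<k. y i * A $$ (i, j)) = r * y j"
  shows "spectral_radius (map_mat complex_of_real A) = r"
proof (rule antisym)
  let ?A = "map_mat complex_of_real A"
  have cA: "?A \<in> carrier_mat k k" using A by simp
  define v where "v = vec k (\<lambda>i. complex_of_real (x i))"
  have "?A *\<^sub>v v = complex_of_real r \<cdot>\<^sub>v v"
  proof (rule eq_vecI)
    fix i assume i: "i < dim_vec (complex_of_real r \<cdot>\<^sub>v v)"
    then have "(?A *\<^sub>v v) $ i = complex_of_real (mapp {..<k} (entries A) x i)"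
      using A by (simp add: v_def scalar_prod_def mapp_def atLeast0LessThan)
    then show "(?A *\<^sub>v v) $ i = (complex_of_real r \<cdot>\<^sub>v v) $ i"
      using x(2) i by (simp add: v_def)
  qed (use A in \<open>simp add: v_def\<close>)
  moreover have "v \<noteq> 0\<^sub>v k"
  proof
    assume "v = 0\<^sub>v k"
    then have "v $ 0 = 0" using \<open>0 < k\<close> by simp
    then show False using \<open>0 < k\<close> x(1)[of 0] by (simp add: v_def)
  qed
  ultimately have "complex_of_real r \<in> spectrum ?A"
    unfolding spectrum_def eigenvalue_def eigenvector_def using A by (auto simp: v_def intro!: exI[of _ v])
  then have "norm (complex_of_real r) \<le> spectral_radius ?A"
    by (intro spectral_radius_mem_max(2)[OF cA \<open>0 < k\<close>] imageI)
  then show "r \<le> spectral_radius ?A" using \<open>0 < r\<close> by simp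
  obtain e where e: "e \<in> spectrum ?A" "spectral_radius ?A = norm e"
    using spectral_radius_mem_max(1)[OF cA \<open>0 < k\<close>] by auto
  then obtain u where u: "u \<in> carrier_vec k" "u \<noteq> 0\<^sub>v k" "?A *\<^sub>v u = e \<cdot>\<^sub>v u"
    using A unfolding spectrum_def eigenvalue_def eigenvector_def by auto
  obtain i0 where i0: "i0 < k" "u $ i0 \<noteq> 0"
    using u by (metis carrier_vecD eq_vecI index_zero_vec)
  let ?s = "\<Sum>i<k. y i * norm (u $ i)"
  have s: "0 < ?s"
    by (rule sum_pos2[of _ i0]) (use i0 y in \<open>auto simp: less_imp_le\<close>)
  have "norm e * norm (u $ i) \<le> (\<Sum>j<k. A $$ (i, j) * norm (u $ j))" if "i < k" for i
  proof -
    have "e * u $ i = (e \<cdot>\<^sub>v u) $ i" using that u by simp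
    also have "\<dots> = (\<Sum>j<k. complex_of_real (A $$ (i, j)) * u $ j)"
      unfolding u(3)[symmetric] using A u(1) that by (simp add: scalar_prod_def atLeast0LessThan)
    finally have "norm (e * u $ i) \<le> (\<Sum>j<k. norm (complex_of_real (A $$ (i, j)) * u $ j))"
      by (simp only: norm_sum)
    then show ?thesis using nonneg that by (simp add: norm_mult)
  qed
  then have "(\<Sum>i<k. y i * (norm e * norm (u $ i))) \<le> (\<Sum>i<k. y i * (\<Sum>j<k. A $$ (i, j) * norm (u $ j)))"
    by (intro sum_mono mult_left_mono) (use y in \<open>auto simp: less_imp_le\<close>)
  also have "\<dots> = (\<Sum>j<k. \<Sum>i<k. y i * A $$ (i, j) * norm (u $ j))"
    unfolding sum_distrib_left mult.assoc by (rule sum.swap)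
  also have "\<dots> = r * ?s"
    unfolding sum_distrib_right[symmetric] by (simp add: y(2) sum_distrib_left mult.assoc)
  finally have "norm e * ?s \<le> r * ?s" by (simp add: sum_distrib_left mult_ac)
  then show "spectral_radius ?A \<le> r" using s e(2) by simp
qed

section \<open>Reachability between indices and orbits of a nonnegative matrix\<close>

locale frobenius_mat =
  fixes X :: "real mat" and d :: nat
  assumes carrier: "X \<in> carrier_mat d d"
    and nonneg: "\<And>i j. i < d \<Longrightarrow> j < d \<Longrightarrow> 0 \<le> X $$ (i, j)"
    and primitive: "primitive_Frobenius X"
begin

abbreviation "E \<equiv> entries X"
abbreviation "traj n w \<equiv> (mapp {..<d} E ^^ n) w"
abbreviation "pw n i j \<equiv> mpow {..<d} E n i j"

lemma dims [simp]: "dim_row X = d" "dim_col X = d"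
  using carrier by auto

lemma pw_nonneg: "i < d \<Longrightarrow> 0 \<le> pw n i j"
  by (rule mpow_nonneg) (auto simp: nonneg)

lemma reaches_iff: "reaches X a b \<longleftrightarrow> a < d \<and> b < d \<and> (\<exists>n. 0 < pw n a b)"
  unfolding reaches_def using pow_mat_entries[OF carrier] by auto

lemma reaches_less: "reaches X a b \<Longrightarrow> a < d" "reaches X a b \<Longrightarrow> b < d"
  by (auto simp: reaches_iff)

lemma reaches_refl: "a < d \<Longrightarrow> reaches X a a"
  unfolding reaches_iff by (auto intro!: exI[of _ 0] simp: mpow_0)

lemma reaches_edge: "a < d \<Longrightarrow> b < d \<Longrightarrow> 0 < X $$ (a, b) \<Longrightarrow> reaches X a b"
  unfolding reaches_iff by (auto intro!: exI[of _ "Suc 0"] simp: mpow_1)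

lemma reaches_trans:
  assumes "reaches X a b" "reaches X b c" shows "reaches X a c"
proof -
  obtain m n where mn: "0 < pw m a b" "0 < pw n b c" using assms by (auto simp: reaches_iff)
  have "0 < (\<Sum>k<d. pw m a k * pw n k c)"
    by (rule sum_pos2[of _ b]) (use mn assms pw_nonneg in \<open>auto simp: reaches_iff\<close>)
  then have "0 < pw (m + n) a c" using assms by (simp add: mpow_add reaches_iff)
  then show ?thesis using assms by (auto simp: reaches_iff)
qed

text \<open>Follow a path of positive weight from a to b until it first leaves C.\<close>

lemma exit_edge:
  assumes "a \<in> C" "C \<subseteq> {..<d}" "reaches X a b" "b \<notin> C"
  shows "\<exists>i\<in>C. \<exists>k<d. k \<notin> C \<and> 0 < X $$ (i, k) \<and> reaches X k b"
proof -
  obtain n where "0 < pw n a b" using assms by (auto simp: reaches_iff)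
  with assms(1) show ?thesis
  proof (induction n arbitrary: a)
    case 0
    then show ?case using assms by (auto simp: mpow_0)
  next
    case (Suc n)
    then have "a < d" using assms by auto
    have "\<exists>k<d. X $$ (a, k) * pw n k b \<noteq> 0"
    proof (rule ccontr)
      assume "\<not> ?thesis"
      then have "pw (Suc n) a b = 0" by (auto simp: mpow_Suc intro!: sum.neutral)
      with Suc.prems show False by simp
    qed
    then obtain k where k: "k < d" "X $$ (a, k) \<noteq> 0" "pw n k b \<noteq> 0" by auto
    then have k': "0 < X $$ (a, k)" "0 < pw n k b"
      using nonneg[OF \<open>a < d\<close> k(1)] pw_nonneg[OF k(1), of n b] by auto
    show ?case
    proof (cases "k \<in> C")
      case True
      then show ?thesis using Suc.IH k'(2) by blast
    next
      case False
      have "reaches X k b" using k k' assms by (auto simp: reaches_iff)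
      then show ?thesis using Suc.prems(1) False k k' by blast
    qed
  qed
qed

lemma mem_block_of: "b \<in> block_of X a \<longleftrightarrow> reaches X a b \<and> reaches X b a"
  by (simp add: block_of_def)

lemma block_of_self: "a < d \<Longrightarrow> a \<in> block_of X a"
  by (simp add: mem_block_of reaches_refl)

lemma block_of_subset: "block_of X a \<subseteq> {..<d}"
  by (auto simp: mem_block_of reaches_less)

lemma finite_block: "finite (block_of X a)"
  using block_of_subset finite_subset by blast

lemma block_of_eqI: "reaches X a b \<Longrightarrow> reaches X b a \<Longrightarrow> block_of X a = block_of X b"
  unfolding block_of_def using reaches_trans by blast

lemma block_of_in_blocks: "a < d \<Longrightarrow> block_of X a \<in> blocks X"
  by (auto simp: blocks_def)

text \<open>The Perron root found on the submatrix is its spectral radius, and the limits of the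
  powers are carried back to the block. The exponent in \<open>primitive_mat\<close> is at least 1,
  so a single index without a loop is not primitive and every block has positive radius.\<close>

lemma block_perron:
  assumes "a < d"
  shows "0 < block_rho X (block_of X a)"
    and "\<And>i j. i \<in> block_of X a \<Longrightarrow> j \<in> block_of X a \<Longrightarrow>
      \<exists>c>0. (\<lambda>n. mpow (block_of X a) E n i j / block_rho X (block_of X a) ^ n) \<longlonglongrightarrow> c"
proof -
  define C where "C = block_of X a"
  define k where "k = card C"
  define A where "A = diagonal_block X C"
  have C: "finite C" "C \<subseteq> {..<d}" "a \<in> C" "C \<in> blocks X"
    using finite_block block_of_subset block_of_self block_of_in_blocks assms by (auto simp: C_def)
  have ix: "{i. i < d \<and> i \<in> C} = C" using C by auto
  have A: "A \<in> carrier_mat k k"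
    by (intro carrier_matI) (simp_all add: A_def diagonal_block_def dim_submatrix ix k_def)
  have A_eq: "A $$ (i, j) = E (pick C i) (pick C j)" if "i < k" "j < k" for i j
    unfolding A_def diagonal_block_def using that
    by (intro submatrix_index) (simp_all add: k_def ix)
  have bij: "bij_betw (pick C) {..<k} C" unfolding k_def by (rule pick_bij_betw[OF C(1)])
  have k0: "0 < k" using C by (auto simp: k_def card_gt_0_iff)
  have "primitive_mat A" using primitive C by (auto simp: primitive_Frobenius_def A_def)
  then obtain p where p: "1 \<le> p" "\<And>i j. i < k \<Longrightarrow> j < k \<Longrightarrow> 0 < (A ^\<^sub>m p) $$ (i, j)"
    and A0: "\<And>i j. i < k \<Longrightarrow> j < k \<Longrightarrow> 0 \<le> A $$ (i, j)"
    using A unfolding primitive_mat_def by auto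
  interpret A: primitive_kernel "{..<k}" "entries A" p
  proof
    fix i j assume "i \<in> {..<k}" "j \<in> {..<k}"
    then show "0 < mpow {..<k} (entries A) p i j" using p(2)[of i j] pow_mat_entries[OF A, of i j p] by simp
  qed (use p(1) A0 k0 in auto)
  obtain r x y where r: "0 < r" and xy: "\<And>j. j < k \<Longrightarrow> 0 < x j" "\<And>j. j < k \<Longrightarrow> 0 < y j"
    "\<And>i. i < k \<Longrightarrow> A.T x i = r * x i" "\<And>j. j < k \<Longrightarrow> (\<Sum>i<k. y i * A $$ (i, j)) = r * y j"
    and lim: "\<And>i j. i < k \<Longrightarrow> j < k \<Longrightarrow> \<exists>c>0. (\<lambda>n. mpow {..<k} (entries A) n i j / r ^ n) \<longlonglongrightarrow> c"
    using A.perron unfolding lessThan_iff by blast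
  have rho: "block_rho X C = r"
    unfolding block_rho_def A_def[symmetric] by (rule spectral_radius_eq_perron_root[OF A k0 A0 r xy(1,3,2,4)])
  then show "0 < block_rho X (block_of X a)" using r by (simp add: C_def)
  fix i j assume "i \<in> block_of X a" "j \<in> block_of X a"
  then have "i \<in> pick C ` {..<k}" "j \<in> pick C ` {..<k}"
    unfolding bij_betw_imp_surj_on[OF bij] by (simp_all add: C_def)
  then obtain i' j' where ij: "i' < k" "j' < k" "i = pick C i'" "j = pick C j'" by auto
  have "mpow {..<k} (entries A) n i' j' = mpow C E n i j" for n
  proof -
    have "mpow {..<k} (entries A) n i' j' = mpow {..<k} (\<lambda>i j. E (pick C i) (pick C j)) n i' j'"
      using ij(1)
      by (induction n arbitrary: i') (auto simp: mpow_0 mpow_Suc A_eq intro!: sum.cong)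
    also have "\<dots> = mpow C E n i j"
      using mpow_reindex[OF bij, of i' j' E n] ij by simp
    finally show ?thesis .
  qed
  then show "\<exists>c>0. (\<lambda>n. mpow (block_of X a) E n i j / block_rho X (block_of X a) ^ n) \<longlonglongrightarrow> c"
    using lim[OF ij(1,2)] rho by (simp add: C_def)
qed

text \<open>The set depends on a only through its block. It stands for the successors in the acyclic
  order of the blocks, so that recursions along this order can run over indices.\<close>

definition exits :: "nat \<Rightarrow> nat set" where
  "exits a = {b \<in> {..<d} - block_of X a. \<exists>i\<in>block_of X a. 0 < X $$ (i, b)}"

lemma finite_exits: "finite (exits a)"
  by (simp add: exits_def)

lemma exits_reaches:
  assumes "b \<in> exits a" shows "b < d" "reaches X a b" "\<not> reaches X b a"
proof -
  obtain i where i: "i \<in> block_of X a" "0 < X $$ (i, b)" "b < d" "b \<notin> block_of X a"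
    using assms by (auto simp: exits_def)
  then show "b < d" by simp
  have "reaches X a i" "i < d" using i by (auto simp: mem_block_of reaches_less)
  then show "reaches X a b" using reaches_edge i reaches_trans by blast
  then show "\<not> reaches X b a" using i by (simp add: mem_block_of)
qed

lemma exitsI:
  assumes "reaches X a b" "\<not> reaches X b a"
  shows "\<exists>k\<in>exits a. reaches X k b"
proof -
  have "b \<notin> block_of X a" using assms by (simp add: mem_block_of)
  then show ?thesis
    using exit_edge[OF block_of_self block_of_subset assms(1)] assms reaches_less
    by (fastforce simp: exits_def)
qed

lemma grows_orbit_step:
  assumes "a < d" "\<And>i. i < d \<Longrightarrow> 0 \<le> w i"
    and "\<And>b. b \<in> exits a \<Longrightarrow> grows (\<lambda>n. traj n w b) (P b)"
  shows "grows (\<lambda>n. traj n w a)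
    (max (if \<exists>j\<in>block_of X a. 0 < w j then (block_rho X (block_of X a), 1) else (0, 0))
       (Max (insert (0, 0) (comb (block_rho X (block_of X a)) ` P ` exits a))))"
  unfolding exits_def
  by (rule grows_block) (use assms block_of_subset block_of_self block_perron nonneg in \<open>auto simp: exits_def\<close>)

text \<open>An exit of a reaches only indices that a reaches, but not a itself; so the number of
  reachable indices drops.\<close>

lemma exits_induct [consumes 1, case_names step]:
  assumes "a < d" and step: "\<And>a. a < d \<Longrightarrow> (\<And>b. b \<in> exits a \<Longrightarrow> Q b) \<Longrightarrow> Q a"
  shows "Q a"
  using assms(1)
proof (induction "card (reachable_indices X a)" arbitrary: a rule: less_induct)
  case less
  show ?case
  proof (rule step[OF less.prems])
    fix b assume b: "b \<in> exits a"
    note rb = exits_reaches[OF b]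
    have "reachable_indices X b \<subset> reachable_indices X a"
      unfolding reachable_indices_def
      using rb reaches_trans reaches_refl[OF less.prems] by blast
    moreover have "finite (reachable_indices X a)"
      by (rule finite_subset[of _ "{..<d}"]) (auto simp: reachable_indices_def reaches_less)
    ultimately show "Q b" by (intro less.hyps psubset_card_mono rb(1))
  qed
qed

text \<open>Only existence is claimed, because an arbitrary weight may vanish on the blocks that
  would dominate. This suffices for the birth counts, whose rate enters only through
  \<open>Lambda_M\<close>.\<close>

theorem grows_orbit:
  assumes "a < d" "\<And>i. i < d \<Longrightarrow> 0 \<le> w i"
  shows "\<exists>P. grows (\<lambda>n. traj n w a) P"
  using assms(1)
proof (induction rule: exits_induct)
  case (step a)
  then obtain P where P: "\<And>b. b \<in> exits a \<Longrightarrow> grows (\<lambda>n. traj n w b) (P b)"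
    by metis
  show ?case using grows_orbit_step[OF step(1) assms(2) P] by blast
qed

end

section \<open>Largest block radius and chains of blocks\<close>

context frobenius_mat
begin

abbreviation "rho a \<equiv> block_rho X (block_of X a)"

lemma finite_blocks: "finite (blocks X)"
  by (simp add: blocks_def)

lemma block_reaches_iff:
  assumes "a < d" "b < d"
  shows "block_reaches X (block_of X a) (block_of X b) \<longleftrightarrow> reaches X a b"
  unfolding block_reaches_def mem_block_of Bex_def
  using reaches_trans reaches_refl assms by blast

lemma blocks_cases:
  assumes "D \<in> blocks X" obtains b where "b < d" "D = block_of X b"
  using assms by (auto simp: blocks_def)

lemma block_of_eq_iff:
  assumes "a < d" "b < d"
  shows "block_of X a = block_of X b \<longleftrightarrow> reaches X a b \<and> reaches X b a"
  using assms block_of_eqI block_of_self[of b] mem_block_of by metis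

lemma reachable_blocks_eq: "a < d \<Longrightarrow> reachable_blocks X a = block_of X ` {b. reaches X a b}"
  unfolding reachable_blocks_def blocks_def by (auto simp: block_reaches_iff reaches_less)

lemma reaches_cases:
  assumes "a < d"
  shows "reaches X a b \<longleftrightarrow> b \<in> block_of X a \<or> (\<exists>k\<in>exits a. reaches X k b)"
  using exitsI exits_reaches reaches_trans mem_block_of by metis

lemma finite_reachable: "finite {b. reaches X a b}"
  by (rule finite_subset[of _ "{..<d}"]) (auto simp: reaches_less)

lemma rho_le_max_rho: "reaches X a b \<Longrightarrow> rho b \<le> max_rho X a"
  unfolding max_rho_def using finite_reachable
  by (intro Max_ge) (auto simp: reachable_blocks_eq reaches_less)

lemma max_rho_attained:
  assumes "a < d" obtains b where "reaches X a b" "rho b = max_rho X a"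
proof -
  have "max_rho X a \<in> block_rho X ` reachable_blocks X a"
    unfolding max_rho_def using assms finite_reachable reaches_refl[OF assms]
    by (intro Max_in) (auto simp: reachable_blocks_eq)
  then show ?thesis using that assms by (auto simp: reachable_blocks_eq)
qed

text \<open>A block reachable from a is either its own or reachable from an exit. The recursion
  mirrors that of the growth rates.\<close>

lemma max_rho_exits:
  assumes "a < d"
  shows "max_rho X a = Max (insert (rho a) (max_rho X ` exits a))"
proof (rule Max_eqI[symmetric])
  show "finite (insert (rho a) (max_rho X ` exits a))" using finite_exits by simp
  obtain b where b: "reaches X a b" "rho b = max_rho X a" using max_rho_attained[OF assms] .
  show "max_rho X a \<in> insert (rho a) (max_rho X ` exits a)"
  proof (cases "b \<in> block_of X a")
    case True
    then have "block_of X b = block_of X a" using block_of_eqI by (auto simp: mem_block_of)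
    then show ?thesis using b by auto
  next
    case False
    then obtain k where k: "k \<in> exits a" "reaches X k b" using b reaches_cases assms by blast
    have "max_rho X k \<le> max_rho X a"
    proof -
      obtain c where "reaches X k c" "rho c = max_rho X k" using max_rho_attained exits_reaches k by metis
      then show ?thesis using rho_le_max_rho[of a c] reaches_trans exits_reaches(2)[OF k(1)] by metis
    qed
    then have "max_rho X a = max_rho X k" using rho_le_max_rho[OF k(2)] b by simp
    then show ?thesis using k by auto
  qed
  fix y assume "y \<in> insert (rho a) (max_rho X ` exits a)"
  then consider "y = rho a" | k where "k \<in> exits a" "y = max_rho X k" by auto
  then show "y \<le> max_rho X a"
  proof cases
    case 1
    then show ?thesis using rho_le_max_rho reaches_refl assms by blast
  next
    case 2
    obtain c where "reaches X k c" "rho c = max_rho X k" using max_rho_attained exits_reaches 2 by metis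
    then show ?thesis using rho_le_max_rho[of a c] reaches_trans exits_reaches(2)[OF 2(1)] 2 by metis
  qed
qed

definition hits :: "real \<Rightarrow> nat set list \<Rightarrow> nat" where
  "hits l cs = card {r. r < length cs \<and> block_rho X (cs ! r) = l}"

lemma hits_eq: "hits l cs = length (filter (\<lambda>C. block_rho X C = l) cs)"
  by (simp add: hits_def length_filter_conv_card)

text \<open>The radius l is a parameter rather than \<open>max_rho X a\<close>: the recursion passes
  to the exits of a, whose own maximal radius may be smaller.\<close>

definition max_hits :: "real \<Rightarrow> nat \<Rightarrow> nat" where
  "max_hits l a = Max {hits l cs | cs. block_chain X a cs}"

lemma varkappa_eq: "varkappa X a = max_hits (max_rho X a) a"
  by (simp add: varkappa_def max_hits_def hits_def)

lemma finite_chains: "finite {hits l cs | cs. block_chain X a cs}"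
proof -
  have "finite {cs. set cs \<subseteq> blocks X \<and> distinct cs}"
    using finite_subset_distinct[OF finite_blocks] by simp
  then have "finite {cs. block_chain X a cs}"
    by (rule finite_subset[rotated]) (auto simp: block_chain_def)
  then have "finite (hits l ` {cs. block_chain X a cs})" by (rule finite_imageI)
  then show ?thesis by (simp add: setcompr_eq_image)
qed

lemma block_chain_singleton: "a < d \<Longrightarrow> block_chain X a [block_of X a]"
  by (simp add: block_chain_def block_of_in_blocks)

lemma hits_le_max_hits: "block_chain X a cs \<Longrightarrow> hits l cs \<le> max_hits l a"
  unfolding max_hits_def by (intro Max_ge finite_chains) auto

lemma max_hits_attained:
  assumes "a < d" obtains cs where "block_chain X a cs" "hits l cs = max_hits l a"
proof -
  have "max_hits l a \<in> {hits l cs | cs. block_chain X a cs}"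
    unfolding max_hits_def using block_chain_singleton[OF assms] by (intro Max_in finite_chains) auto
  then show ?thesis using that by auto
qed

lemma block_chain_reaches:
  assumes "a < d" "block_chain X a cs" "C \<in> set cs" "C = block_of X b" "b < d"
  shows "reaches X a b"
proof -
  have "successively (block_reaches X) cs \<Longrightarrow> set cs \<subseteq> blocks X \<Longrightarrow> cs \<noteq> [] \<Longrightarrow> hd cs = block_of X a
      \<Longrightarrow> a < d \<Longrightarrow> C \<in> set cs \<Longrightarrow> reaches X a b" for cs a
  proof (induction cs arbitrary: a)
    case (Cons D ds)
    show ?case
    proof (cases "C = D")
      case True
      then show ?thesis using Cons.prems assms(4,5) block_of_eq_iff by auto
    next
      case False
      then have ds: "ds \<noteq> []" "C \<in> set ds" using Cons.prems by auto
      then have "hd ds \<in> blocks X" using Cons.prems by auto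
      then obtain c where c: "c < d" "hd ds = block_of X c" by (rule blocks_cases)
      have "reaches X c b" using Cons.IH[of c] Cons.prems ds c by (auto simp: successively_Cons)
      moreover have "reaches X a c"
        using Cons.prems ds c block_reaches_iff[of a c] by (auto simp: successively_Cons)
      ultimately show ?thesis using reaches_trans by blast
    qed
  qed simp
  then show ?thesis using assms by (auto simp: block_chain_def)
qed

text \<open>The new block differs from the others because each of those is reachable from b, and b
  does not reach a.\<close>

lemma block_chain_Cons:
  assumes "a < d" "block_chain X b ds" "b < d" "reaches X a b" "\<not> reaches X b a"
  shows "block_chain X a (block_of X a # ds)"
proof -
  have "block_of X a \<notin> set ds" using block_chain_reaches[OF assms(3,2)] assms by blast
  then show ?thesis
    using assms block_reaches_iff[of a b] block_of_in_blocks[of a]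
    by (auto simp: block_chain_def successively_Cons)
qed

lemma hits_Cons: "hits l (C # cs) = (if block_rho X C = l then 1 else 0) + hits l cs"
  by (simp add: hits_eq)

text \<open>The tail of a chain starts in a block reached through some exit of a; conversely, a
  chain from an exit can be preceded by the block of a, which cannot occur again.\<close>

lemma max_hits_exits:
  assumes "a < d"
  shows "max_hits l a = (if rho a = l then 1 else 0) + Max (insert 0 (max_hits l ` exits a))"
    (is "_ = ?e + ?M")
proof (rule antisym)
  obtain cs where cs: "block_chain X a cs" "hits l cs = max_hits l a" using max_hits_attained[OF assms] .
  then obtain ds where ds: "cs = block_of X a # ds" by (cases cs) (auto simp: block_chain_def)
  have "hits l ds \<le> ?M"
  proof (cases "ds = []")
    case True
    then show ?thesis by (simp add: hits_eq)
  next
    case False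
    have succ: "successively (block_reaches X) ds" "block_reaches X (block_of X a) (hd ds)"
      "set ds \<subseteq> blocks X" "distinct ds" "block_of X a \<notin> set ds"
      using cs False unfolding ds block_chain_def by (auto simp: successively_Cons)
    then have "hd ds \<in> blocks X" using False by auto
    then obtain c where c: "c < d" "hd ds = block_of X c" by (rule blocks_cases)
    have ac: "reaches X a c" using succ c assms block_reaches_iff by auto
    have "block_of X c \<noteq> block_of X a" using succ c False by (metis hd_in_set)
    then have "\<not> reaches X c a" using ac block_of_eqI by metis
    then obtain k where k: "k \<in> exits a" "reaches X k c" using exitsI ac by blast
    have kd: "k < d" using exits_reaches k by auto
    have chain: "block_chain X c ds" using succ False c by (simp add: block_chain_def)
    have "hits l ds \<le> max_hits l k"
    proof (cases "reaches X c k")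
      case True
      then have "block_of X c = block_of X k" using k block_of_eqI by blast
      then have "block_chain X k ds" using chain by (simp add: block_chain_def)
      then show ?thesis by (rule hits_le_max_hits)
    next
      case False
      \<comment> \<open>The tail may skip the block of the exit k; inserting this block in front
        does not decrease the number of hits.\<close>
      then have "block_chain X k (block_of X k # ds)" using block_chain_Cons chain k kd c by blast
      then have "hits l (block_of X k # ds) \<le> max_hits l k" by (rule hits_le_max_hits)
      then show ?thesis by (simp add: hits_Cons)
    qed
    also have "\<dots> \<le> ?M" using k finite_exits by (intro Max_ge) auto
    finally show ?thesis .
  qed
  then show "max_hits l a \<le> ?e + ?M" using cs(2) by (simp add: ds hits_Cons)
  have "?M \<in> insert 0 (max_hits l ` exits a)" using finite_exits by (intro Max_in) auto
  then consider "?M = 0" | k where "k \<in> exits a" "?M = max_hits l k" by auto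
  then show "?e + ?M \<le> max_hits l a"
  proof cases
    case 1
    then show ?thesis using hits_le_max_hits[OF block_chain_singleton[OF assms], of l] by (simp add: hits_eq split: if_splits)
  next
    case 2
    note k = exits_reaches[OF 2(1)]
    obtain ds where ds: "block_chain X k ds" "hits l ds = max_hits l k" using max_hits_attained[OF k(1)] .
    have "block_chain X a (block_of X a # ds)" using block_chain_Cons ds k assms by blast
    then show ?thesis using hits_le_max_hits[of a "block_of X a # ds" l] 2 ds by (simp add: hits_Cons)
  qed
qed

lemma max_hits_pos:
  assumes "a < d" shows "1 \<le> max_hits (max_rho X a) a"
  using assms
proof (induction rule: exits_induct)
  case (step a)
  have "max_rho X a \<in> insert (rho a) (max_rho X ` exits a)"
    unfolding max_rho_exits[OF step(1)] using finite_exits by (intro Max_in) auto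
  then consider "max_rho X a = rho a" | k where "k \<in> exits a" "max_rho X a = max_rho X k" by auto
  then show ?case
  proof cases
    case 1
    then show ?thesis unfolding max_hits_exits[OF step(1)] by simp
  next
    case 2
    have "max_hits (max_rho X k) k \<le> Max (insert 0 (max_hits (max_rho X a) ` exits a))"
      using 2 finite_exits by (intro Max_ge) auto
    then show ?thesis unfolding max_hits_exits[OF step(1)] using step(2)[OF 2(1)] by linarith
  qed
qed

text \<open>Exits whose maximal radius is below l thus drop out of the recursion for l.\<close>

lemma max_hits_zero:
  assumes "a < d" "max_rho X a < l" shows "max_hits l a = 0"
proof -
  obtain cs where cs: "block_chain X a cs" "hits l cs = max_hits l a" using max_hits_attained[OF assms(1)] .
  have "block_rho X C \<noteq> l" if C: "C \<in> set cs" for C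
  proof -
    have "C \<in> blocks X" using cs C by (auto simp: block_chain_def)
    then obtain b where b: "b < d" "C = block_of X b" by (rule blocks_cases)
    then show ?thesis using rho_le_max_rho[OF block_chain_reaches[OF assms(1) cs(1) C b(2,1)]] assms by auto
  qed
  then have "hits l cs = 0" by (simp add: hits_eq filter_empty_conv)
  then show ?thesis using cs by simp
qed

text \<open>Rothblum's theorem for the row sums.\<close>

theorem grows_row_sums:
  assumes "a < d"
  shows "grows (\<lambda>n. traj n (\<lambda>_. 1) a) (max_rho X a, varkappa X a)"
  using assms
proof (induction rule: exits_induct)
  case (step a)
  define P where "P = (\<lambda>b. (max_rho X b, varkappa X b))"
  \<comment> \<open>The candidates for the rate: the block itself, charged by the all-ones vector,
    and each exit after convolution with the block.\<close>
  define R where "R = insert (rho a, 1) (comb (rho a) ` P ` exits a)"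
  define l where "l = max_rho X a"
  define N where "N = max_hits l a"
  have rho0: "0 < rho a" by (rule block_perron(1)[OF step(1)])
  have lam: "l \<in> insert (rho a) (max_rho X ` exits a)" "\<And>y. y \<in> insert (rho a) (max_rho X ` exits a) \<Longrightarrow> y \<le> l"
    unfolding l_def max_rho_exits[OF step(1)]
    by (rule Max_in Max_ge; simp only: finite_insert finite_imageI finite_exits insert_not_empty simp_thms)+
  let ?M = "Max (insert 0 (max_hits l ` exits a))"
  have N: "N = (if rho a = l then 1 else 0) + ?M" unfolding N_def by (rule max_hits_exits[OF step(1)])
  have M: "?M \<in> insert 0 (max_hits l ` exits a)" "\<And>b. b \<in> exits a \<Longrightarrow> max_hits l b \<le> ?M"
    by (rule Max_in Max_ge; simp add: finite_exits)+
  have comb_P: "comb (rho a) (P b) = (if rho a < max_rho X b then (max_rho X b, varkappa X b)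
      else if max_rho X b = rho a then (rho a, Suc (varkappa X b)) else (rho a, 1))" if "b \<in> exits a" for b
  proof -
    have "0 < rho b" by (rule block_perron(1)) (use exits_reaches that in auto)
    also have "rho b \<le> max_rho X b" using rho_le_max_rho reaches_refl exits_reaches that by blast
    finally show ?thesis by (auto simp: comb_def P_def)
  qed
  \<comment> \<open>For an exit of maximal radius l, \<open>comb\<close> adds one to its count
    exactly if the block itself has radius l, just like the recursion for \<open>max_hits\<close>.
    Every other exit yields the candidate of the block itself or a base below l.\<close>
  have "Max R = (l, N)"
  proof (rule Max_eqI)
    show "finite R" using finite_exits by (simp add: R_def)
    fix y assume "y \<in> R"
    then consider "y = (rho a, 1)" | b where "b \<in> exits a" "y = comb (rho a) (P b)" by (auto simp: R_def)
    then show "y \<le> (l, N)"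
    proof cases
      case 1
      then show ?thesis using lam(2)[of "rho a"] N by auto
    next
      case 2
      have "max_rho X b \<le> l" "rho a \<le> l" using lam(2) 2 by auto
      moreover have "max_rho X b = l \<Longrightarrow> varkappa X b \<le> ?M" using M(2)[OF 2(1)] by (simp add: varkappa_eq)
      ultimately show ?thesis
        unfolding 2(2) comb_P[OF 2(1)] using N by (cases "max_rho X b = l"; cases "rho a = l") auto
    qed
  next
    show "(l, N) \<in> R"
    proof (cases "?M = 0")
      case True
      \<comment> \<open>No exit attains l, since one that does would carry at least one hit; so the
        maximum comes from the block itself.\<close>
      have "rho a = l"
      proof (rule ccontr)
        assume "rho a \<noteq> l"
        with lam obtain b where b: "b \<in> exits a" "max_rho X b = l" by auto
        have "1 \<le> max_hits (max_rho X b) b" by (rule max_hits_pos) (use exits_reaches b in auto)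
        then show False using M(2)[OF b(1)] b True by simp
      qed
      then show ?thesis using N True by (simp add: R_def)
    next
      case False
      then obtain b where b: "b \<in> exits a" "?M = max_hits l b" using M(1) by auto
      have bd: "b < d" using exits_reaches b by auto
      have "l \<le> max_rho X b" using max_hits_zero[OF bd, of l] False b by force
      then have eq: "max_rho X b = l" using lam(2)[of "max_rho X b"] b by simp
      then have "?M = varkappa X b" using b by (simp add: varkappa_eq)
      then have "comb (rho a) (P b) = (l, N)"
        unfolding comb_P[OF b(1)] using N eq lam(2)[of "rho a"] by auto
      then show ?thesis unfolding R_def using b(1) by (metis imageI insertI2)
    qed
  qed
  moreover have "grows (\<lambda>n. traj n (\<lambda>_. 1) a)
     (max (rho a, 1) (Max (insert (0, 0) (comb (rho a) ` P ` exits a))))"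
    using grows_orbit_step[OF step(1), of "\<lambda>_. 1" P] step block_of_self[OF step(1)]
    by (auto simp: P_def split: if_splits)
  moreover have "max (rho a, 1) (Max (insert (0, 0) (comb (rho a) ` P ` exits a))) = Max R"
  proof -
    let ?S = "comb (rho a) ` P ` exits a"
    have "max (rho a, 1) (Max (insert (0, 0) ?S)) = Max (insert (rho a, 1) (insert (0, 0) ?S))"
      using finite_exits by (subst (2) Max_insert) auto
    also have "\<dots> = Max (insert (0, 0) R)" by (simp only: R_def insert_commute)
    also have "\<dots> = max (0, 0) (Max R)" using finite_exits by (subst Max_insert) (auto simp: R_def)
    also have "\<dots> = Max R"
    proof -
      have "(0, 0) \<le> (rho a, 1::nat)" using rho0 by simp
      also have "\<dots> \<le> Max R" using finite_exits by (intro Max_ge) (auto simp: R_def)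
      finally show ?thesis by (simp add: max_def)
    qed
    finally show ?thesis .
  qed
  ultimately show ?case by (simp add: l_def N_def varkappa_eq)
qed

end

section \<open>Graphs of an edge iterated graph system\<close>

lemma truncate_simps [simp]:
  "verts (uncoloured G) = verts G" "arcs (uncoloured G) = arcs G"
  "tail (uncoloured G) = tail G" "head (uncoloured G) = head G"
  by (simp_all add: pre_digraph.truncate_def)

text \<open>\<open>incidence G v y\<close> is the product of \<open>\<kappa>\<^sub>G(v)\<close> with the column vector \<open>y\<close>.\<close>

definition incidence :: "('v, 'e) cdigraph \<Rightarrow> 'v \<Rightarrow> (nat \<Rightarrow> real) \<Rightarrow> real" where
  "incidence G v y = (\<Sum>e\<in>arcs G. of_bool (tail G e = v) * y (2 * colour G e)
     + of_bool (head G e = v) * y (2 * colour G e + 1))"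

lemma sum_lessThan_double:
  fixes f :: "nat \<Rightarrow> real"
  shows "(\<Sum>a<2 * K. f a) = (\<Sum>i<K. f (2 * i) + f (2 * i + 1))"
  by (induction K) auto

lemma card_filter_of_bool:
  assumes "finite A"
  shows "real (card {e \<in> A. Q e}) = (\<Sum>e\<in>A. of_bool (Q e))"
  using assms by (simp add: of_bool_def sum.If_cases Int_def)

lemma kappa_incidence:
  assumes "finite (arcs G)" "\<And>e. e \<in> arcs G \<Longrightarrow> colour G e < K"
  shows "(\<Sum>a<2 * K. kappa K G v $ a * y a) = incidence G v y"
proof -
  have card: "real (card {e \<in> arcs G. Q e \<and> colour G e = i}) = (\<Sum>e\<in>arcs G. of_bool (Q e) * of_bool (colour G e = i))" for Q i
    by (simp add: card_filter_of_bool[OF assms(1)] of_bool_conj)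
  have pick: "(\<Sum>i<K. of_bool (colour G e = i) * z i) = z (colour G e)" if "e \<in> arcs G" for e and z :: "nat \<Rightarrow> real"
    using assms(2)[OF that] by (simp add: of_bool_def if_distrib if_distribR cong: if_cong)
  have "(\<Sum>a<2 * K. kappa K G v $ a * y a)
    = (\<Sum>i<K. (\<Sum>e\<in>arcs G. of_bool (tail G e = v) * of_bool (colour G e = i)) * y (2 * i)
         + (\<Sum>e\<in>arcs G. of_bool (head G e = v) * of_bool (colour G e = i)) * y (2 * i + 1))"
    unfolding sum_lessThan_double
    by (rule sum.cong) (auto simp: kappa_def out_arcs_def in_arcs_def card[symmetric] conj_assoc)
  also have "\<dots> = (\<Sum>i<K. \<Sum>e\<in>arcs G. of_bool (colour G e = i) *
      (of_bool (tail G e = v) * y (2 * i) + of_bool (head G e = v) * y (2 * i + 1)))"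
    unfolding sum_distrib_right sum.distrib[symmetric] by (intro sum.cong refl) (simp only: distrib_left mult_ac)
  also have "\<dots> = (\<Sum>e\<in>arcs G. \<Sum>i<K. of_bool (colour G e = i) *
      (of_bool (tail G e = v) * y (2 * i) + of_bool (head G e = v) * y (2 * i + 1)))"
    by (rule sum.swap)
  also have "\<dots> = incidence G v y"
    unfolding incidence_def
    by (rule sum.cong[OF refl], subst pick) auto
  finally show ?thesis .
qed

lemma dim_kappa [simp]: "dim_vec (kappa K G v) = 2 * K"
  by (simp add: kappa_def)

lemma kappa_nonneg: "a < 2 * K \<Longrightarrow> 0 \<le> kappa K G v $ a"
  by (simp add: kappa_def)

text \<open>Pairing with unit vectors recovers the entries. Types are thus compared through
  \<open>incidence\<close>, for which a replacement step has a simple form.\<close>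

lemma kappa_eqI:
  assumes "finite (arcs G)" "\<And>e. e \<in> arcs G \<Longrightarrow> colour G e < K"
    and "finite (arcs H)" "\<And>e. e \<in> arcs H \<Longrightarrow> colour H e < K"
    and "\<And>y. incidence G v y = incidence H w y"
  shows "kappa K G v = kappa K H w"
proof (rule eq_vecI)
  fix a assume "a < dim_vec (kappa K H w)"
  then have a: "a < 2 * K" by simp
  let ?y = "\<lambda>b. of_bool (b = a) :: real"
  have comp: "(\<Sum>b<2 * K. x $ b * ?y b) = x $ a" for x :: "real vec"
    using a by (simp add: of_bool_def if_distrib if_distribR cong: if_cong)
  show "kappa K G v $ a = kappa K H w $ a"
    using kappa_incidence[OF assms(1,2), where v = v and y = ?y] kappa_incidence[OF assms(3,4), where v = w and y = ?y]
      assms(5)[of ?y] unfolding comp by simp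
qed simp

lemma vertex_degree_incidence:
  assumes "finite (arcs G)"
  shows "real (vertex_degree G v) = incidence G v (\<lambda>_. 1)"
proof -
  show ?thesis
    by (simp add: vertex_degree_def out_degree_def in_degree_def out_arcs_def in_arcs_def
        incidence_def sum.distrib card_filter_of_bool[OF assms])
qed

text \<open>The empty walk has cost 0. Together with the lower bound on the distance of the planting
  vertices, this keeps the two apart.\<close>

lemma undirected_dist_self_le:
  assumes "wf_digraph (uncoloured G)" "v \<in> verts G"
  shows "undirected_dist G v v \<le> 0"
proof -
  let ?H = "with_proj (mk_symmetric (uncoloured G))"
  interpret pair_wf_digraph "mk_symmetric (uncoloured G)"
    by (rule wf_digraph.wellformed_mk_symmetric[OF assms(1)])
  have "wf_digraph ?H" by unfold_locales
  moreover have "pre_digraph.awalk ?H v [] v"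
    using assms(2) by (simp add: pre_digraph.awalk_def)
  ultimately show ?thesis
    using wf_digraph.min_cost_le_walk_cost[of ?H v "[]" v "\<lambda>_. 1"]
    by (simp add: undirected_dist_def awalk_cost_def zero_ereal_def)
qed

locale eigs_system =
  fixes S :: "('v, 'e) eigs" and \<iota> :: nat
  assumes eigs: "is_eigs S" and init: "\<iota> < num_colours S"
begin

abbreviation "K \<equiv> num_colours S"
abbreviation "rul \<equiv> rule S"
abbreviation "G n \<equiv> Xi S \<iota> n"
abbreviation "unplanted j \<equiv> verts (rul j) - {plant_pos S j, plant_neg S j}"

lemma rule_graph:
  assumes "j < K"
  shows "finite (verts (rul j))" "finite (arcs (rul j))"
    "\<And>f. f \<in> arcs (rul j) \<Longrightarrow> tail (rul j) f \<in> verts (rul j)"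
    "\<And>f. f \<in> arcs (rul j) \<Longrightarrow> head (rul j) f \<in> verts (rul j)"
    "\<And>f. f \<in> arcs (rul j) \<Longrightarrow> colour (rul j) f < K"
    "plant_pos S j \<in> verts (rul j)" "plant_neg S j \<in> verts (rul j)"
    "fin_digraph (uncoloured (rul j))" "Digraph_Component.connected (uncoloured (rul j))"
proof -
  have *: "fin_digraph (uncoloured (rul j))" "colour (rul j) ` arcs (rul j) \<subseteq> {..<K}"
    "plant_pos S j \<in> verts (rul j)" "plant_neg S j \<in> verts (rul j)" "Digraph_Component.connected (uncoloured (rul j))"
    using eigs assms unfolding is_eigs_def by auto
  then interpret fin_digraph "uncoloured (rul j)" by simp
  show "finite (verts (rul j))" "finite (arcs (rul j))"
    "\<And>f. f \<in> arcs (rul j) \<Longrightarrow> tail (rul j) f \<in> verts (rul j)"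
    "\<And>f. f \<in> arcs (rul j) \<Longrightarrow> head (rul j) f \<in> verts (rul j)"
    "\<And>f. f \<in> arcs (rul j) \<Longrightarrow> colour (rul j) f < K"
    "plant_pos S j \<in> verts (rul j)" "plant_neg S j \<in> verts (rul j)"
    "fin_digraph (uncoloured (rul j))" "Digraph_Component.connected (uncoloured (rul j))"
    using finite_verts finite_arcs tail_in_verts head_in_verts * by auto
qed

lemma plant_distinct:
  assumes "j < K" shows "plant_pos S j \<noteq> plant_neg S j"
proof
  assume eq: "plant_pos S j = plant_neg S j"
  have "wf_digraph (uncoloured (rul j))"
    using rule_graph(8)[OF assms] by (simp add: fin_digraph_def)
  then have "undirected_dist (rul j) (plant_pos S j) (plant_pos S j) \<le> 0"
    using rule_graph(6)[OF assms] by (rule undirected_dist_self_le)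
  moreover have "ereal 2 \<le> undirected_dist (rul j) (plant_pos S j) (plant_neg S j)"
    using eigs assms unfolding is_eigs_def by auto
  ultimately show False using eq by (auto simp: zero_ereal_def dest: order_trans)
qed

text \<open>The graph is connected and has a second vertex, since the two planting vertices differ.
  As no vertex is isolated, birth types do not vanish and degrees do not decrease.\<close>

lemma rule_vertex_has_arc:
  assumes "j < K" "v \<in> verts (rul j)"
  shows "\<exists>f\<in>arcs (rul j). tail (rul j) f = v \<or> head (rul j) f = v"
proof -
  interpret fin_digraph "uncoloured (rul j)" by (rule rule_graph(8)[OF assms(1)])
  obtain w where w: "w \<in> verts (rul j)" "w \<noteq> v"
    using rule_graph(6,7)[OF assms(1)] plant_distinct[OF assms(1)] by metis
  have "v \<rightarrow>\<^sup>*\<^bsub>with_proj (mk_symmetric (uncoloured (rul j)))\<^esub> w"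
    using rule_graph(9)[OF assms(1)] w assms(2) unfolding Digraph_Component.connected_def strongly_connected_def by auto
  then have "\<exists>x. (v, x) \<in> parcs (mk_symmetric (uncoloured (rul j)))"
    using w(2) unfolding reachable_def
    by (cases rule: converse_rtrancl_on_cases) (auto simp: arcs_ends_def arc_to_ends_def)
  then show ?thesis by (auto simp: parcs_mk_symmetric)
qed

end

section \<open>One replacement step: vertices, arcs, types and births\<close>

context eigs_system
begin

lemma Xi_Suc_simps:
  "verts (G (Suc n)) = verts (G n) \<union> (\<Union>e\<in>arcs (G n). planted S (G n) e ` verts (rul (colour (G n) e)))"
  "arcs (G (Suc n)) = (\<lambda>(e, f). f # e) ` (SIGMA e:arcs (G n). arcs (rul (colour (G n) e)))"
  "tail (G (Suc n)) (f # e) = planted S (G n) e (tail (rul (colour (G n) e)) f)"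
  "head (G (Suc n)) (f # e) = planted S (G n) e (head (rul (colour (G n) e)) f)"
  "colour (G (Suc n)) (f # e) = colour (rul (colour (G n) e)) f"
  by (auto simp: substitute_def)

declare Xi.simps(2) [simp del]

text \<open>The length of an address records the generation, which is what separates new vertices
  from all earlier ones.\<close>

lemma Xi_invariant:
  shows "finite (verts (G n))" "finite (arcs (G n))"
    and "e \<in> arcs (G n) \<Longrightarrow> length e = n" "e \<in> arcs (G n) \<Longrightarrow> colour (G n) e < K"
    and "e \<in> arcs (G n) \<Longrightarrow> tail (G n) e \<in> verts (G n)" "e \<in> arcs (G n) \<Longrightarrow> head (G n) e \<in> verts (G n)"
proof -
  have "finite (verts (G n)) \<and> finite (arcs (G n)) \<and> (\<forall>e\<in>arcs (G n). length e = n \<and> colour (G n) e < K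
    \<and> tail (G n) e \<in> verts (G n) \<and> head (G n) e \<in> verts (G n))"
  proof (induction n)
    case 0
    then show ?case using init by simp
  next
    case (Suc n)
    have "finite (verts (G (Suc n)))" "finite (arcs (G (Suc n)))"
      unfolding Xi_Suc_simps using Suc rule_graph(1,2) by (auto intro!: finite_imageI finite_SigmaI)
    moreover have "length x = Suc n \<and> colour (G (Suc n)) x < K
      \<and> tail (G (Suc n)) x \<in> verts (G (Suc n)) \<and> head (G (Suc n)) x \<in> verts (G (Suc n))"
      if x: "x \<in> arcs (G (Suc n))" for x
    proof -
      obtain e f where ef: "x = f # e" "e \<in> arcs (G n)" "f \<in> arcs (rul (colour (G n) e))"
        using x by (auto simp: Xi_Suc_simps(2))
      then have c: "colour (G n) e < K" "length e = n" using Suc by auto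
      note f = rule_graph(3,4,5)[OF c(1) ef(3)]
      have "planted S (G n) e w \<in> verts (G (Suc n))" if "w \<in> verts (rul (colour (G n) e))" for w
        unfolding Xi_Suc_simps(1) using ef(2) that by blast
      then show ?thesis using f c(2) unfolding ef(1) Xi_Suc_simps by simp
    qed
    ultimately show ?case by blast
  qed
  then show "finite (verts (G n))" "finite (arcs (G n))"
    and "e \<in> arcs (G n) \<Longrightarrow> length e = n" "e \<in> arcs (G n) \<Longrightarrow> colour (G n) e < K"
    and "e \<in> arcs (G n) \<Longrightarrow> tail (G n) e \<in> verts (G n)" "e \<in> arcs (G n) \<Longrightarrow> head (G n) e \<in> verts (G n)"
    by blast+
qed

text \<open>Indexed by the generation of the replaced arcs, so these vertices belong to generation n
  + 1.\<close>

definition newborn :: "nat \<Rightarrow> ('v, 'e) xvertex set" where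
  "newborn n = (\<lambda>(e, w). Born e w) ` (SIGMA e:arcs (G n). unplanted (colour (G n) e))"

lemma mem_newborn: "v \<in> newborn n \<longleftrightarrow> (\<exists>e w. v = Born e w \<and> e \<in> arcs (G n) \<and> w \<in> unplanted (colour (G n) e))"
  by (auto simp: newborn_def)

lemma verts_Suc: "verts (G (Suc n)) = verts (G n) \<union> newborn n"
proof (rule Set.set_eqI)
  fix v
  have "v \<in> newborn n \<longleftrightarrow> (\<exists>e\<in>arcs (G n). \<exists>w\<in>unplanted (colour (G n) e). v = planted S (G n) e w)"
    unfolding mem_newborn by (auto simp: planted_def)
  moreover have "planted S (G n) e w \<in> verts (G n)"
    if "e \<in> arcs (G n)" "w \<in> {plant_pos S (colour (G n) e), plant_neg S (colour (G n) e)}" for e w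
    using that Xi_invariant(5,6)[of e n] by (auto simp: planted_def)
  ultimately show "v \<in> verts (G (Suc n)) \<longleftrightarrow> v \<in> verts (G n) \<union> newborn n"
    unfolding Xi_Suc_simps(1) by blast
qed

lemma verts_cases:
  assumes "v \<in> verts (G n)"
  shows "v \<in> {Root_tail, Root_head} \<or> (\<exists>m<n. v \<in> newborn m)"
  using assms by (induction n) (auto simp: verts_Suc less_Suc_eq)

lemma newborn_length: "Born e w \<in> newborn n \<Longrightarrow> length e = n"
  using Xi_invariant(3) by (auto simp: mem_newborn)

lemma newborn_not_in_verts:
  assumes "v \<in> newborn n" "m \<le> n" shows "v \<notin> verts (G m)"
proof
  assume "v \<in> verts (G m)"
  moreover obtain e w where v: "v = Born e w" using assms by (auto simp: mem_newborn)
  ultimately obtain k where "k < m" "v \<in> newborn k" using verts_cases by blast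
  then show False using newborn_length[of e w n] newborn_length[of e w k] v assms by auto
qed

lemma verts_mono: "m \<le> n \<Longrightarrow> verts (G m) \<subseteq> verts (G n)"
  by (induction n rule: dec_induct) (auto simp: verts_Suc)

lemma born_Suc: "born S \<iota> (Suc n) = newborn n"
proof
  show "born S \<iota> (Suc n) \<subseteq> newborn n" by (auto simp: born_def verts_Suc)
  show "newborn n \<subseteq> born S \<iota> (Suc n)"
    using newborn_not_in_verts by (auto simp: born_def verts_Suc)
qed

lemma born_0: "born S \<iota> 0 = {Root_tail, Root_head}"
  by (auto simp: born_def)

lemma finite_born: "finite (born S \<iota> m)"
  unfolding born_def using Xi_invariant(1) by simp

lemma born_unique: "v \<in> born S \<iota> m \<Longrightarrow> v \<in> born S \<iota> m' \<Longrightarrow> m = m'"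
  unfolding born_def by (metis (mono_tags, lifting) linorder_neqE_nat mem_Collect_eq)

lemma ex_born: "v \<in> verts (G n) \<Longrightarrow> \<exists>m\<le>n. v \<in> born S \<iota> m"
proof -
  assume v: "v \<in> verts (G n)"
  define m where "m = (LEAST m. v \<in> verts (G m))"
  have "v \<in> verts (G m)" unfolding m_def using v by (rule LeastI)
  moreover have "m \<le> n" unfolding m_def using v by (rule Least_le)
  moreover have "\<forall>k<m. v \<notin> verts (G k)" unfolding m_def using not_less_Least by blast
  ultimately show ?thesis by (auto simp: born_def)
qed

lemma Xi_verts_eq: "Xi_verts S \<iota> = (\<Union>m. born S \<iota> m)"
  unfolding Xi_verts_def using ex_born by (fastforce simp: born_def)

lemma sum_arcs_Suc:
  "(\<Sum>x\<in>arcs (G (Suc n)). h x) = (\<Sum>e\<in>arcs (G n). \<Sum>f\<in>arcs (rul (colour (G n) e)). h (f # e))"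
proof -
  have "inj_on (\<lambda>(e, f). f # e) (SIGMA e:arcs (G n). arcs (rul (colour (G n) e)))"
    by (auto simp: inj_on_def)
  then show ?thesis
    unfolding Xi_Suc_simps(2) using Xi_invariant(2,4) rule_graph(2)
    by (simp add: sum.reindex sum.Sigma case_prod_unfold)
qed

abbreviation "massE \<equiv> entries (mass_mat S)"
abbreviation "degE \<equiv> entries (degree_mat S)"

text \<open>One replacement turns the sum of y into the sum of the mass matrix applied to y; the
  induction therefore varies y. Indicators give the numbers of arcs of one colour,
  \<open>inner_count\<close> gives the births.\<close>

lemma sum_arcs_colour:
  "(\<Sum>e\<in>arcs (G n). y (colour (G n) e)) = (mapp {..<K} massE ^^ n) y \<iota>"
proof (induction n arbitrary: y)
  case (Suc n)
  have "(\<Sum>f\<in>arcs (rul j). y (colour (rul j) f)) = mapp {..<K} massE y j" if j: "j < K" for j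
  proof -
    have "mapp {..<K} massE y j = (\<Sum>k<K. (\<Sum>f\<in>arcs (rul j). of_bool (colour (rul j) f = k)) * y k)"
      using j by (simp add: mapp_def mass_mat_def card_filter_of_bool rule_graph(2))
    also have "\<dots> = (\<Sum>f\<in>arcs (rul j). \<Sum>k<K. of_bool (colour (rul j) f = k) * y k)"
      unfolding sum_distrib_right by (rule sum.swap)
    also have "\<dots> = (\<Sum>f\<in>arcs (rul j). y (colour (rul j) f))"
      using rule_graph(5)[OF j]
      by (intro sum.cong refl) (simp add: of_bool_def if_distrib if_distribR cong: if_cong)
    finally show ?thesis by simp
  qed
  then have "(\<Sum>x\<in>arcs (G (Suc n)). y (colour (G (Suc n)) x)) = (\<Sum>e\<in>arcs (G n). mapp {..<K} massE y (colour (G n) e))"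
    unfolding sum_arcs_Suc Xi_Suc_simps(5) by (intro sum.cong refl) (use Xi_invariant(4) in auto)
  also have "\<dots> = (mapp {..<K} massE ^^ n) (mapp {..<K} massE y) \<iota>" by (rule Suc.IH)
  finally show ?case by (simp add: funpow_swap1)
qed simp

lemma mapp_degE:
  assumes "i < K"
  shows "mapp {..<2 * K} degE y (2 * i) = incidence (rul i) (plant_pos S i) y"
    and "mapp {..<2 * K} degE y (2 * i + 1) = incidence (rul i) (plant_neg S i) y"
proof -
  have "mapp {..<2 * K} degE y (2 * i) = (\<Sum>b<2 * K. kappa K (rul i) (plant_pos S i) $ b * y b)"
    using assms by (simp add: mapp_def degree_mat_def)
  then show "mapp {..<2 * K} degE y (2 * i) = incidence (rul i) (plant_pos S i) y"
    using kappa_incidence[OF rule_graph(2,5)[OF assms]] by simp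
  have "mapp {..<2 * K} degE y (2 * i + 1) = (\<Sum>b<2 * K. kappa K (rul i) (plant_neg S i) $ b * y b)"
    using assms by (simp add: mapp_def degree_mat_def)
  then show "mapp {..<2 * K} degE y (2 * i + 1) = incidence (rul i) (plant_neg S i) y"
    using kappa_incidence[OF rule_graph(2,5)[OF assms]] by simp
qed

lemma incidence_Suc:
  "incidence (G (Suc n)) v y = (\<Sum>e\<in>arcs (G n). \<Sum>f\<in>arcs (rul (colour (G n) e)).
     of_bool (planted S (G n) e (tail (rul (colour (G n) e)) f) = v) * y (2 * colour (rul (colour (G n) e)) f)
     + of_bool (planted S (G n) e (head (rul (colour (G n) e)) f) = v) * y (2 * colour (rul (colour (G n) e)) f + 1))"
  unfolding incidence_def sum_arcs_Suc Xi_Suc_simps(3-5) ..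

text \<open>An old vertex meets the copy of a rule graph only as one of the planting vertices, so
  its new type is the old one times the degree matrix. In the dual form used here the matrix acts on
  the test vector.\<close>

lemma incidence_Suc_old:
  assumes v: "v \<in> verts (G n)"
  shows "incidence (G (Suc n)) v y = incidence (G n) v (mapp {..<2 * K} degE y)"
proof -
  have "(\<Sum>f\<in>arcs (rul (colour (G n) e)).
     of_bool (planted S (G n) e (tail (rul (colour (G n) e)) f) = v) * y (2 * colour (rul (colour (G n) e)) f)
     + of_bool (planted S (G n) e (head (rul (colour (G n) e)) f) = v) * y (2 * colour (rul (colour (G n) e)) f + 1))
    = of_bool (tail (G n) e = v) * mapp {..<2 * K} degE y (2 * colour (G n) e)
      + of_bool (head (G n) e = v) * mapp {..<2 * K} degE y (2 * colour (G n) e + 1)"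
    if e: "e \<in> arcs (G n)" for e
  proof -
    define j where "j = colour (G n) e"
    have j: "j < K" using Xi_invariant(4)[OF e] by (simp add: j_def)
    \<comment> \<open>The two indicators may be added even if e is a loop: the planting vertices are
      distinct, so at most one summand is nonzero.\<close>
    have planted: "of_bool (planted S (G n) e w = v) = (of_bool (tail (G n) e = v) * of_bool (w = plant_pos S j)
        + of_bool (head (G n) e = v) * of_bool (w = plant_neg S j) :: real)" if "w \<in> verts (rul j)" for w
    proof -
      have "Born e w \<noteq> v" if "w \<in> unplanted j"
        using newborn_not_in_verts[of "Born e w" n n] v e that by (auto simp: mem_newborn j_def)
      then show ?thesis using plant_distinct[OF j] that by (auto simp: planted_def j_def)
    qed
    show ?thesis
      unfolding j_def[symmetric] mapp_degE[OF j] incidence_def sum_distrib_left sum.distrib[symmetric]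
      by (rule sum.cong[OF refl]) (simp add: planted rule_graph(3,4)[OF j] algebra_simps)
  qed
  then show ?thesis unfolding incidence_Suc incidence_def[of "G n"] by simp
qed

text \<open>All arcs at a newborn vertex lie in the copy that created it, so its birth type can be
  read off from the rule graph.\<close>

lemma incidence_newborn:
  assumes e: "e \<in> arcs (G n)" and w: "w \<in> unplanted (colour (G n) e)"
  shows "incidence (G (Suc n)) (Born e w) y = incidence (rul (colour (G n) e)) w y"
proof -
  have nb: "Born e w \<in> newborn n" using e w by (auto simp: mem_newborn)
  have planted: "planted S (G n) e' x = Born e w \<longleftrightarrow> e' = e \<and> x = w" if "e' \<in> arcs (G n)" for e' x
  proof -
    have "tail (G n) e' \<noteq> Born e w" "head (G n) e' \<noteq> Born e w"
      using newborn_not_in_verts[OF nb order_refl] Xi_invariant(5,6)[OF that] by auto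
    then show ?thesis using w by (auto simp: planted_def)
  qed
  have "incidence (G (Suc n)) (Born e w) y = (\<Sum>e'\<in>arcs (G n). if e' = e then incidence (rul (colour (G n) e)) w y else 0)"
    unfolding incidence_Suc by (rule sum.cong[OF refl]) (auto simp: planted incidence_def)
  then show ?thesis using e Xi_invariant(2) by simp
qed

lemma kappa_newborn:
  assumes "e \<in> arcs (G n)" "w \<in> unplanted (colour (G n) e)"
  shows "kappa K (G (Suc n)) (Born e w) = kappa K (rul (colour (G n) e)) w"
  using Xi_invariant(2,4) rule_graph(2,5) incidence_newborn[OF assms] assms
  by (intro kappa_eqI) auto

definition inner_count :: "real vec \<Rightarrow> nat \<Rightarrow> real" where
  "inner_count u j = real (card {w \<in> unplanted j. kappa K (rul j) w = u})"

lemma birth_count_Suc: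
  "real (birth_count S \<iota> u (Suc n)) = (mapp {..<K} massE ^^ n) (inner_count u) \<iota>"
proof -
  let ?A = "SIGMA e:arcs (G n). {w \<in> unplanted (colour (G n) e). kappa K (rul (colour (G n) e)) w = u}"
  have "{v \<in> born S \<iota> (Suc n). kappa K (G (Suc n)) v = u} = (\<lambda>(e, w). Born e w) ` ?A"
    unfolding born_Suc newborn_def using kappa_newborn by auto
  moreover have "inj_on (\<lambda>(e, w). Born e w) ?A" by (auto simp: inj_on_def)
  ultimately have "birth_count S \<iota> u (Suc n) = card ?A"
    unfolding birth_count_def by (simp add: card_image)
  also have "\<dots> = (\<Sum>e\<in>arcs (G n). card {w \<in> unplanted (colour (G n) e). kappa K (rul (colour (G n) e)) w = u})"
    using Xi_invariant(2,4) rule_graph(1) by (intro card_SigmaI) auto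
  finally have "real (birth_count S \<iota> u (Suc n)) = (\<Sum>e\<in>arcs (G n). inner_count u (colour (G n) e))"
    by (simp add: inner_count_def)
  then show ?thesis by (simp add: sum_arcs_colour)
qed

end

section \<open>The degree scaling limit\<close>

text \<open>\<open>type_lambda\<close> and \<open>type_tau\<close> maximise in two stages; this
  identifies the result with a single maximum in the order of growth rates.\<close>

lemma Max_lexicographic:
  fixes f :: "'a \<Rightarrow> real" and g :: "'a \<Rightarrow> nat"
  assumes "finite A" "A \<noteq> {}"
  shows "Max ((\<lambda>a. (f a, g a)) ` A) = (Max (f ` A), Max (g ` {a \<in> A. f a = Max (f ` A)}))"
proof (rule Max_eqI)
  let ?B = "{a \<in> A. f a = Max (f ` A)}"
  have "Max (f ` A) \<in> f ` A" using assms by (intro Max_in) auto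
  then have "?B \<noteq> {}" by force
  then have "Max (g ` ?B) \<in> g ` ?B" using assms by (intro Max_in) auto
  then show "(Max (f ` A), Max (g ` ?B)) \<in> (\<lambda>a. (f a, g a)) ` A" by force
  fix y assume "y \<in> (\<lambda>a. (f a, g a)) ` A"
  then obtain a where a: "a \<in> A" "y = (f a, g a)" by auto
  have "f a \<le> Max (f ` A)" using a assms by simp
  moreover have "g a \<le> Max (g ` ?B)" if "f a = Max (f ` A)" using a assms that by (intro Max_ge) auto
  ultimately show "y \<le> (Max (f ` A), Max (g ` ?B))" unfolding a(2) by (cases "f a = Max (f ` A)") auto
qed (use assms in simp)

lemma tendsto_Max_image:
  fixes f :: "'a \<Rightarrow> 'b \<Rightarrow> real"
  assumes "finite A" "A \<noteq> {}" "\<And>i. i \<in> A \<Longrightarrow> (f i \<longlongrightarrow> l i) F"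
  shows "((\<lambda>n. Max ((\<lambda>i. f i n) ` A)) \<longlongrightarrow> Max (l ` A)) F"
  using assms
proof (induction A rule: finite_ne_induct)
  case (insert a A)
  have "((\<lambda>n. max (f a n) (Max ((\<lambda>i. f i n) ` A))) \<longlongrightarrow> max (l a) (Max (l ` A))) F"
    by (intro tendsto_max insert) auto
  then show ?case using insert(1,2) by simp
qed simp

section \<open>Degree of a vertex as a function of its birth type and its age\<close>

locale eigs_frobenius = eigs_system +
  assumes degree_primitive: "primitive_Frobenius (degree_mat S)"
    and mass_primitive: "primitive_Frobenius (mass_mat S)"
    and Lambda_gt_1: "1 < Lambda_U S \<iota>"
begin

sublocale N: frobenius_mat "degree_mat S" "2 * K"
proof
  show "degree_mat S \<in> carrier_mat (2 * K) (2 * K)" by (simp add: degree_mat_def)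
  show "0 \<le> degree_mat S $$ (i, j)" if "i < 2 * K" "j < 2 * K" for i j
    using that by (simp add: degree_mat_def kappa_nonneg)
qed (rule degree_primitive)

sublocale M: frobenius_mat "mass_mat S" K
proof
  show "mass_mat S \<in> carrier_mat K K" by (simp add: mass_mat_def)
  show "0 \<le> mass_mat S $$ (i, j)" if "i < K" "j < K" for i j
    using that by (simp add: mass_mat_def)
qed (rule mass_primitive)

abbreviation "row_sums k \<equiv> N.traj k (\<lambda>_. 1)"
abbreviation "type_at m v \<equiv> kappa K (G m) v"

text \<open>The product of u, the k-th power of the degree matrix and the all-ones vector. It is the
  degree at age k of a vertex of birth type u, and by nonnegativity also the l1 norm in
  \<open>c_deg\<close>.\<close>

definition type_deg :: "real vec \<Rightarrow> nat \<Rightarrow> real" where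
  "type_deg u k = (\<Sum>a<2 * K. u $ a * row_sums k a)"

lemma incidence_add:
  assumes "v \<in> verts (G n)"
  shows "incidence (G (n + k)) v y = incidence (G n) v ((mapp {..<2 * K} degE ^^ k) y)"
proof (induction k arbitrary: y)
  case (Suc k)
  have "incidence (G (n + Suc k)) v y = incidence (G (n + k)) v (mapp {..<2 * K} degE y)"
    using incidence_Suc_old[of v "n + k" y] assms verts_mono[of n "n + k"] by auto
  also have "\<dots> = incidence (G n) v ((mapp {..<2 * K} degE ^^ Suc k) y)"
    unfolding Suc.IH by (simp add: funpow_swap1)
  finally show ?case .
qed simp

lemma vertex_degree_eq:
  assumes "v \<in> verts (G m)" "m \<le> n"
  shows "real (vertex_degree (G n) v) = type_deg (type_at m v) (n - m)"
proof -
  have "real (vertex_degree (G n) v) = incidence (G m) v (row_sums (n - m))"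
    using vertex_degree_incidence[OF Xi_invariant(2), of n v] incidence_add[OF assms(1), of "n - m" "\<lambda>_. 1"] assms(2)
    by simp
  then show ?thesis
    using kappa_incidence[OF Xi_invariant(2,4), where y = "row_sums (n - m)"] by (simp add: type_deg_def)
qed

abbreviation "U \<equiv> birth_types S \<iota>"

lemma birth_typesE:
  assumes "u \<in> U"
  obtains v where "v \<in> {Root_tail, Root_head}" "u = type_at 0 v"
  | j w where "reaches (mass_mat S) \<iota> j" "j < K" "w \<in> unplanted j" "u = kappa K (rul j) w"
proof -
  have "u \<in> kappa K (G 0) ` {Root_tail, Root_head} \<or>
    (\<exists>j. reaches (mass_mat S) \<iota> j \<and> u \<in> kappa K (rul j) ` unplanted j)"
    using assms by (auto simp: birth_types_def reachable_indices_def)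
  then show ?thesis using that M.reaches_less(2) by blast
qed

lemma finite_birth_types: "finite U"
proof -
  have "finite (reachable_indices (mass_mat S) \<iota>)"
    using M.finite_reachable by (simp add: reachable_indices_def)
  then show ?thesis
    unfolding birth_types_def using rule_graph(1) M.reaches_less
    by (auto simp: reachable_indices_def intro!: finite_imageI)
qed

lemma birth_type_at:
  assumes "v \<in> born S \<iota> m" shows "type_at m v \<in> U"
proof (cases m)
  case 0
  then show ?thesis using assms by (auto simp: birth_types_def born_def)
next
  case (Suc n)
  then obtain e w where e: "v = Born e w" "e \<in> arcs (G n)" "w \<in> unplanted (colour (G n) e)"
    using assms born_Suc mem_newborn by auto
  let ?j = "colour (G n) e"
  have j: "?j < K" using Xi_invariant(4) e by auto
  have "0 < (\<Sum>e'\<in>arcs (G n). of_bool (colour (G n) e' = ?j) :: real)"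
    by (rule sum_pos2[OF Xi_invariant(2) e(2)]) auto
  also have "\<dots> = mpow {..<K} massE n \<iota> ?j"
    unfolding sum_arcs_colour[of "\<lambda>i. of_bool (i = ?j)" n] mpow_def ..
  finally have "reaches (mass_mat S) \<iota> ?j" using j init by (auto simp: M.reaches_iff)
  then show ?thesis
    using e Suc kappa_newborn[OF e(2,3)] by (auto simp: birth_types_def reachable_indices_def)
qed

text \<open>A colour reachable in the mass matrix appears on some arc, whose replacement creates the
  required vertex. Hence the least generation in \<open>first_birth\<close> exists.\<close>

lemma birth_type_occurs:
  assumes "u \<in> U" shows "\<exists>m. \<exists>v\<in>born S \<iota> m. type_at m v = u"
  using assms
proof (cases rule: birth_typesE)
  case (1 v)
  then show ?thesis using born_0 by metis
next
  case (2 j w)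
  obtain n where "0 < mpow {..<K} massE n \<iota> j" using 2 by (auto simp: M.reaches_iff)
  then have "0 < (\<Sum>e\<in>arcs (G n). of_bool (colour (G n) e = j) :: real)"
    unfolding sum_arcs_colour[of "\<lambda>i. of_bool (i = j)" n] mpow_def .
  moreover have "(\<Sum>e\<in>arcs (G n). of_bool (colour (G n) e = j) :: real) = 0"
    if "\<forall>e\<in>arcs (G n). colour (G n) e \<noteq> j"
    using that by (intro sum.neutral) auto
  ultimately obtain e where e: "e \<in> arcs (G n)" "colour (G n) e = j" by (metis less_irrefl)
  then have "Born e w \<in> born S \<iota> (Suc n)" using 2 by (auto simp: born_Suc mem_newborn)
  moreover have "type_at (Suc n) (Born e w) = u" using kappa_newborn e 2 by auto
  ultimately show ?thesis by blast
qed

lemma birth_type_dim: "u \<in> U \<Longrightarrow> dim_vec u = 2 * K"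
  by (erule birth_typesE) auto

lemma birth_type_nonneg: "u \<in> U \<Longrightarrow> a < 2 * K \<Longrightarrow> 0 \<le> u $ a"
  by (erule birth_typesE) (auto intro: kappa_nonneg)

lemma incidence_ge_1:
  assumes "finite (arcs H)" "f \<in> arcs H" "tail H f = v \<or> head H f = v"
  shows "1 \<le> incidence H v (\<lambda>_. 1)"
proof -
  have "1 \<le> (of_bool (tail H f = v) * 1 + of_bool (head H f = v) * 1 :: real)" using assms by auto
  also have "\<dots> \<le> incidence H v (\<lambda>_. 1)"
    unfolding incidence_def by (rule member_le_sum[OF assms(2)]) (use assms in auto)
  finally show ?thesis .
qed

text \<open>No vertex is isolated; hence the maxima over the support of a birth type range over
  nonempty sets.\<close>

lemma birth_type_pos:
  assumes "u \<in> U" shows "\<exists>a<2 * K. 0 < u $ a"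
proof -
  have "1 \<le> (\<Sum>a<2 * K. u $ a)"
    using assms
  proof (cases rule: birth_typesE)
    case (1 v)
    have "1 \<le> incidence (G 0) v (\<lambda>_. 1)"
      by (rule incidence_ge_1[of _ "[]"]) (use 1 in auto)
    then show ?thesis
      using kappa_incidence[OF Xi_invariant(2,4), where y = "\<lambda>_. 1" and n2 = 0] 1 by simp
  next
    case (2 j w)
    then obtain f where "f \<in> arcs (rul j)" "tail (rul j) f = w \<or> head (rul j) f = w"
      using rule_vertex_has_arc by blast
    then have "1 \<le> incidence (rul j) w (\<lambda>_. 1)" using rule_graph(2)[OF 2(2)] by (intro incidence_ge_1) auto
    then show ?thesis
      using kappa_incidence[OF rule_graph(2,5)[OF 2(2)], where y = "\<lambda>_. 1"] 2 by simp
  qed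
  then show ?thesis by (smt (verit) lessThan_iff sum_nonpos)
qed

text \<open>A row of the degree matrix is the type of a planting vertex, which meets at least one
  arc.\<close>

lemma row_sums_1_ge: "a < 2 * K \<Longrightarrow> 1 \<le> row_sums 1 a"
proof -
  assume a: "a < 2 * K"
  have deg: "1 \<le> incidence (rul i) w (\<lambda>_. 1)" if "i < K" "w \<in> verts (rul i)" for i w
    using rule_vertex_has_arc[OF that] incidence_ge_1 rule_graph(2)[OF that(1)] by metis
  show ?thesis
  proof (cases "even a")
    case True
    then obtain i where "a = 2 * i" by blast
    then show ?thesis using a mapp_degE(1)[of i "\<lambda>_. 1"] deg rule_graph(6) by simp
  next
    case False
    then obtain i where "a = 2 * i + 1" by (rule oddE)
    then show ?thesis using a mapp_degE(2)[of i "\<lambda>_. 1"] deg rule_graph(7) by simp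
  qed
qed

text \<open>One more step replaces the all-ones vector by the first row sums, which are entrywise at
  least 1, and the powers are nonnegative.\<close>

lemma row_sums_mono: "a < 2 * K \<Longrightarrow> row_sums k a \<le> row_sums (Suc k) a"
proof -
  assume a: "a < 2 * K"
  have "row_sums (Suc k) a = (\<Sum>b<2 * K. N.pw k a b * row_sums 1 b)"
    using mapp_funpow[of "{..<2 * K}" a k degE "row_sums 1"] a by (simp add: funpow_swap1)
  moreover have "row_sums k a = (\<Sum>b<2 * K. N.pw k a b * 1)"
    using mapp_funpow[of "{..<2 * K}" a k degE "\<lambda>_. 1"] a by simp
  moreover have "(\<Sum>b<2 * K. N.pw k a b * 1) \<le> (\<Sum>b<2 * K. N.pw k a b * row_sums 1 b)"
    by (intro sum_mono mult_left_mono row_sums_1_ge N.pw_nonneg) (use a in auto)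
  ultimately show ?thesis by linarith
qed

lemma type_deg_mono:
  assumes "u \<in> U" "k \<le> k'" shows "type_deg u k \<le> type_deg u k'"
proof (rule lift_Suc_mono_le[OF _ assms(2)])
  show "type_deg u k \<le> type_deg u (Suc k)" for k
    unfolding type_deg_def
    by (intro sum_mono mult_left_mono row_sums_mono) (use birth_type_nonneg assms in auto)
qed

text \<open>The degree at age k is a positive combination of row sums over the support of u, so the
  largest of their rates wins.\<close>

lemma grows_type_deg:
  assumes u: "u \<in> U"
  shows "grows (type_deg u) (type_lambda S u, type_tau S u)"
proof -
  let ?D = "degree_mat S"
  define A where "A = {a. a < 2 * K \<and> 0 < u $ a}"
  have A: "finite A" "A \<noteq> {}" using birth_type_pos[OF u] by (auto simp: A_def)
  have "grows (\<lambda>n. \<Sum>a\<in>A. u $ a * row_sums n a) (Max (insert (0, 0) ((\<lambda>a. (max_rho ?D a, varkappa ?D a)) ` A)))"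
    using A(1) by (intro grows_sum grows_scale N.grows_row_sums) (auto simp: A_def)
  moreover have "(\<Sum>a\<in>A. u $ a * row_sums n a) = type_deg u n" for n
    unfolding type_deg_def A_def
    by (rule sum.mono_neutral_left) (use birth_type_nonneg[OF u] in \<open>auto simp: order.strict_iff_order\<close>)
  moreover have "Max (insert (0, 0) ((\<lambda>a. (max_rho ?D a, varkappa ?D a)) ` A)) = Max ((\<lambda>a. (max_rho ?D a, varkappa ?D a)) ` A)"
  proof -
    obtain a where a: "a \<in> A" using A by auto
    then have "(0, 0) \<le> (max_rho ?D a, varkappa ?D a)"
      by (intro grows_bot[OF N.grows_row_sums]) (auto simp: A_def)
    also have "\<dots> \<le> Max ((\<lambda>a. (max_rho ?D a, varkappa ?D a)) ` A)"
      using A a by (intro Max_ge) auto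
    finally show ?thesis using A by (subst Max_insert) (auto simp: max_def)
  qed
  moreover have "Max ((\<lambda>a. (max_rho ?D a, varkappa ?D a)) ` A) = (type_lambda S u, type_tau S u)"
  proof -
    have "{max_rho ?D a | a. a < dim_vec u \<and> 0 < u $ a} = max_rho ?D ` A"
      using birth_type_dim[OF u] by (auto simp: A_def)
    then have l: "type_lambda S u = Max (max_rho ?D ` A)" by (simp add: type_lambda_def)
    have "{varkappa ?D a | a. a < dim_vec u \<and> 0 < u $ a \<and> max_rho ?D a = type_lambda S u}
      = varkappa ?D ` {a \<in> A. max_rho ?D a = Max (max_rho ?D ` A)}"
      using birth_type_dim[OF u] l by (auto simp: A_def)
    then have "type_tau S u = Max (varkappa ?D ` {a \<in> A. max_rho ?D a = Max (max_rho ?D ` A)})"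
      by (simp add: type_tau_def)
    then show ?thesis using Max_lexicographic[OF A] l by simp
  qed
  ultimately show ?thesis by simp
qed

lemma l1_norm_eq_type_deg:
  assumes u: "u \<in> U"
  shows "l1_norm (transpose_mat (degree_mat S ^\<^sub>m n) *\<^sub>v u) = type_deg u n"
proof -
  let ?P = "degree_mat S ^\<^sub>m n"
  have P: "?P \<in> carrier_mat (2 * K) (2 * K)" by (rule pow_carrier_mat[OF N.carrier])
  have dim: "u \<in> carrier_vec (2 * K)" by (rule carrier_vecI[OF birth_type_dim[OF u]])
  have entry: "(transpose_mat ?P *\<^sub>v u) $ b = (\<Sum>a<2 * K. u $ a * N.pw n a b)" if b: "b < 2 * K" for b
  proof -
    have "(transpose_mat ?P *\<^sub>v u) $ b = (\<Sum>a<2 * K. ?P $$ (a, b) * u $ a)"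
      using P dim b by (simp add: scalar_prod_def atLeast0LessThan)
    then show ?thesis using pow_mat_entries[OF N.carrier] b by (simp add: mult.commute)
  qed
  have dimP: "dim_vec (transpose_mat ?P *\<^sub>v u) = 2 * K" using P by simp
  have "l1_norm (transpose_mat ?P *\<^sub>v u) = (\<Sum>b<2 * K. \<bar>\<Sum>a<2 * K. u $ a * N.pw n a b\<bar>)"
    unfolding l1_norm_def dimP by (rule sum.cong) (simp_all only: lessThan_iff entry)
  also have "\<dots> = (\<Sum>b<2 * K. \<Sum>a<2 * K. u $ a * N.pw n a b)"
    by (intro sum.cong refl abs_of_nonneg sum_nonneg mult_nonneg_nonneg)
       (use birth_type_nonneg[OF u] N.pw_nonneg in auto)
  also have "\<dots> = (\<Sum>a<2 * K. \<Sum>b<2 * K. u $ a * N.pw n a b)" by (rule sum.swap)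
  also have "\<dots> = type_deg u n"
    unfolding type_deg_def by (rule sum.cong[OF refl]) (simp add: mapp_funpow sum_distrib_left)
  finally show ?thesis .
qed

text \<open>The positive value at age 0 excludes the bottom rate; hence the limit that defines
  \<open>c_deg\<close> exists and is positive.\<close>

lemma c_deg_limit:
  assumes u: "u \<in> U"
  shows "0 < c_deg S u" "(\<lambda>n. type_deg u n / rate (type_lambda S u) (type_tau S u) n) \<longlonglongrightarrow> c_deg S u"
    and "0 < type_lambda S u" "1 \<le> type_tau S u"
proof -
  have "(type_lambda S u, type_tau S u) \<noteq> (0, 0)"
  proof
    assume z: "(type_lambda S u, type_tau S u) = (0, 0)"
    have "type_deg u 0 = 0" using grows_type_deg[OF u] unfolding z by (simp add: grows_def)
    moreover have "0 < type_deg u 0"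
    proof -
      obtain a where "a < 2 * K" "0 < u $ a" using birth_type_pos[OF u] by auto
      then show ?thesis unfolding type_deg_def
        by (intro sum_pos2[of _ a]) (use birth_type_nonneg[OF u] in auto)
    qed
    ultimately show False by simp
  qed
  then obtain c where c: "0 < c" "(\<lambda>n. type_deg u n / rate (type_lambda S u) (type_tau S u) n) \<longlonglongrightarrow> c"
    "0 < type_lambda S u" "1 \<le> type_tau S u"
    using grows_type_deg[OF u] by (auto simp: grows_def)
  moreover have "c_deg S u = c"
    unfolding c_deg_def l1_norm_eq_type_deg[OF u] using c(2) by (intro limI) (simp add: rate_def)
  ultimately show "0 < c_deg S u" "(\<lambda>n. type_deg u n / rate (type_lambda S u) (type_tau S u) n) \<longlonglongrightarrow> c_deg S u"
    "0 < type_lambda S u" "1 \<le> type_tau S u" by auto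
qed

section \<open>Types of maximal growth and the rescaled degree\<close>

abbreviation "\<Lambda> \<equiv> Lambda_U S \<iota>"
abbreviation "\<tau> \<equiv> tau_deg S \<iota>"

text \<open>Survival is not asked for: a type that is born only finitely often can still determine
  the maximum degree.\<close>

definition top_types :: "real vec set" where
  "top_types = {u \<in> U. type_lambda S u = \<Lambda> \<and> type_tau S u = \<tau>}"

lemma root_type_in: "type_at 0 Root_tail \<in> U"
  using birth_type_at[of Root_tail 0] by (simp add: born_0)

lemma top_types_nonempty: "top_types \<noteq> {}" and tau_ge_1: "1 \<le> \<tau>"
  and type_rate_le: "u \<in> U \<Longrightarrow> (type_lambda S u, type_tau S u) \<le> (\<Lambda>, \<tau>)"
proof -
  have "\<Lambda> \<in> type_lambda S ` U" unfolding Lambda_U_def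
    using finite_birth_types root_type_in by (intro Max_in) auto
  then obtain u0 where u0: "u0 \<in> U" "type_lambda S u0 = \<Lambda>" by auto
  let ?T = "{type_tau S u | u. u \<in> U \<and> type_lambda S u = \<Lambda>}"
  have fin: "finite ?T" using finite_birth_types by simp
  then have "\<tau> \<in> ?T" unfolding tau_deg_def using u0 by (intro Max_in) auto
  then obtain u1 where u1: "u1 \<in> U" "type_lambda S u1 = \<Lambda>" "type_tau S u1 = \<tau>" by auto
  then show "top_types \<noteq> {}" by (auto simp: top_types_def)
  show "1 \<le> \<tau>" using c_deg_limit(4)[OF u1(1)] u1 by simp
  assume u: "u \<in> U"
  have "type_lambda S u \<le> \<Lambda>" unfolding Lambda_U_def using finite_birth_types u by simp
  moreover have "type_tau S u \<le> \<tau>" if "type_lambda S u = \<Lambda>"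
    unfolding tau_deg_def using fin u that by (intro Max_ge) auto
  ultimately show "(type_lambda S u, type_tau S u) \<le> (\<Lambda>, \<tau>)"
    by (cases "type_lambda S u = \<Lambda>") auto
qed

text \<open>Extended by 0, so that one limit against the common maximal rate serves all
  types.\<close>

definition c_top :: "real vec \<Rightarrow> real" where
  "c_top u = (if u \<in> top_types then c_deg S u else 0)"

lemma type_deg_limit:
  assumes u: "u \<in> U"
  shows "(\<lambda>n. type_deg u n / rate \<Lambda> \<tau> n) \<longlonglongrightarrow> c_top u"
proof (cases "u \<in> top_types")
  case True
  then show ?thesis using c_deg_limit(2)[OF u] by (simp add: c_top_def top_types_def)
next
  case False
  then have "(type_lambda S u, type_tau S u) \<noteq> (\<Lambda>, \<tau>)" using u by (auto simp: top_types_def)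
  then have "(type_lambda S u, type_tau S u) < (\<Lambda>, \<tau>)" using type_rate_le[OF u] le_neq_trans by blast
  then have "(\<lambda>n. type_deg u n / rate \<Lambda> \<tau> n) \<longlonglongrightarrow> 0"
    by (intro grows_less[OF grows_type_deg[OF u]]) (use Lambda_gt_1 tau_ge_1 in auto)
  then show ?thesis using False by (simp add: c_top_def)
qed

definition first_birth :: "real vec \<Rightarrow> nat" where
  "first_birth u = (LEAST m. \<exists>v\<in>born S \<iota> m. type_at m v = u)"

text \<open>The limit constant of the maximum degree: every type competes with its own constant,
  discounted by the delay of its first birth.\<close>

definition deg_norm :: real where
  "deg_norm = Max ((\<lambda>u. c_top u / \<Lambda> ^ first_birth u) ` U)"

lemma deg_norm_pos: "0 < deg_norm"
proof -
  obtain u where u: "u \<in> top_types" using top_types_nonempty by auto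
  then have uU: "u \<in> U" by (simp add: top_types_def)
  have "0 < c_top u / \<Lambda> ^ first_birth u" using c_deg_limit(1)[OF uU] u Lambda_gt_1 by (simp add: c_top_def)
  also have "\<dots> \<le> deg_norm" unfolding deg_norm_def using finite_birth_types uU by (intro Max_ge) auto
  finally show ?thesis .
qed

text \<open>Degrees increase in time, so among the vertices of a given type the first born ones have the
  largest degree.\<close>

lemma max_degree_eq:
  assumes n: "\<And>u. u \<in> U \<Longrightarrow> first_birth u \<le> n"
  shows "real (max_degree (G n)) = Max ((\<lambda>u. type_deg u (n - first_birth u)) ` U)"
proof (rule antisym)
  have "max_degree (G n) \<in> vertex_degree (G n) ` verts (G n)"
    unfolding max_degree_def using Xi_invariant(1) verts_mono[of 0 n] by (intro Max_in) auto
  then obtain v where v: "v \<in> verts (G n)" "max_degree (G n) = vertex_degree (G n) v" by auto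
  obtain m where m: "m \<le> n" "v \<in> born S \<iota> m" using ex_born[OF v(1)] by auto
  then have vm: "v \<in> verts (G m)" by (simp add: born_def)
  let ?u = "type_at m v"
  have u: "?u \<in> U" by (rule birth_type_at[OF m(2)])
  have "first_birth ?u \<le> m" unfolding first_birth_def using m by (intro Least_le) auto
  then have "type_deg ?u (n - m) \<le> type_deg ?u (n - first_birth ?u)" by (intro type_deg_mono u) auto
  also have "\<dots> \<le> Max ((\<lambda>u. type_deg u (n - first_birth u)) ` U)"
    using finite_birth_types u by (intro Max_ge) auto
  finally show "real (max_degree (G n)) \<le> Max ((\<lambda>u. type_deg u (n - first_birth u)) ` U)"
    using vertex_degree_eq[OF vm m(1)] v by simp
next
  have "Max ((\<lambda>u. type_deg u (n - first_birth u)) ` U) \<in> (\<lambda>u. type_deg u (n - first_birth u)) ` U"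
    using finite_birth_types root_type_in by (intro Max_in) auto
  then obtain u where u: "u \<in> U" "Max ((\<lambda>u. type_deg u (n - first_birth u)) ` U) = type_deg u (n - first_birth u)" by auto
  obtain v where v: "v \<in> born S \<iota> (first_birth u)" "type_at (first_birth u) v = u"
    using LeastI_ex[OF birth_type_occurs[OF u(1)]] unfolding first_birth_def by auto
  then have vm: "v \<in> verts (G (first_birth u))" by (simp add: born_def)
  have "v \<in> verts (G n)" using vm verts_mono[OF n[OF u(1)]] by auto
  then have "vertex_degree (G n) v \<le> max_degree (G n)"
    unfolding max_degree_def using Xi_invariant(1) by (intro Max_ge) auto
  then show "Max ((\<lambda>u. type_deg u (n - first_birth u)) ` U) \<le> real (max_degree (G n))"
    using vertex_degree_eq[OF vm n[OF u(1)]] u v by simp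
qed

text \<open>The maximum runs over finitely many types with fixed delays, so it commutes with the
  limit.\<close>

lemma max_degree_limit: "(\<lambda>n. real (max_degree (G n)) / rate \<Lambda> \<tau> n) \<longlonglongrightarrow> deg_norm"
proof -
  have "(\<lambda>n. Max ((\<lambda>u. type_deg u (n - first_birth u) / rate \<Lambda> \<tau> n) ` U)) \<longlonglongrightarrow> deg_norm"
    unfolding deg_norm_def
    by (intro tendsto_Max_image rate_tendsto_shift type_deg_limit)
       (use finite_birth_types root_type_in Lambda_gt_1 in auto)
  moreover have "\<forall>\<^sub>F n in sequentially. Max ((\<lambda>u. type_deg u (n - first_birth u) / rate \<Lambda> \<tau> n) ` U)
      = real (max_degree (G n)) / rate \<Lambda> \<tau> n"
    using eventually_ge_at_top[of "Max (insert 1 (first_birth ` U))"]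
  proof eventually_elim
    case (elim n)
    have fb: "first_birth u \<le> n" if "u \<in> U" for u
      using elim finite_birth_types that by (meson Max_ge finite_imageI finite_insert imageI insertI2 order_trans)
    have "1 \<le> n" using elim finite_birth_types by (meson Max_ge finite_imageI finite_insert insertI1 order_trans)
    then have r: "0 < rate \<Lambda> \<tau> n" using Lambda_gt_1 by (intro rate_pos) auto
    have "mono (\<lambda>x. x / rate \<Lambda> \<tau> n)" using r by (intro monoI divide_right_mono) auto
    then have "Max ((\<lambda>u. type_deg u (n - first_birth u)) ` U) / rate \<Lambda> \<tau> n
        = Max ((\<lambda>x. x / rate \<Lambda> \<tau> n) ` ((\<lambda>u. type_deg u (n - first_birth u)) ` U))"
      using finite_birth_types root_type_in by (intro mono_Max_commute) auto
    then show ?case by (simp add: max_degree_eq[OF fb] image_image)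
  qed
  ultimately show ?thesis by (rule Lim_transform_eventually)
qed

text \<open>Degree and maximum degree are measured against the same rate, so the polynomial factor
  cancels and only the delay until birth leaves a power of \<Lambda>.\<close>

lemma deg_hat_eq:
  assumes v: "v \<in> born S \<iota> m"
  shows "deg_hat S \<iota> v = c_top (type_at m v) / \<Lambda> ^ m / deg_norm"
proof -
  have vm: "v \<in> verts (G m)" using v by (simp add: born_def)
  have u: "type_at m v \<in> U" by (rule birth_type_at[OF v])
  have "(\<lambda>n. (type_deg (type_at m v) (n - m) / rate \<Lambda> \<tau> n) / (real (max_degree (G n)) / rate \<Lambda> \<tau> n))
      \<longlonglongrightarrow> c_top (type_at m v) / \<Lambda> ^ m / deg_norm"
    by (intro tendsto_divide rate_tendsto_shift type_deg_limit max_degree_limit u)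
       (use Lambda_gt_1 deg_norm_pos in auto)
  moreover have "\<forall>\<^sub>F n in sequentially. (type_deg (type_at m v) (n - m) / rate \<Lambda> \<tau> n) / (real (max_degree (G n)) / rate \<Lambda> \<tau> n)
      = real (vertex_degree (G n) v) / real (max_degree (G n))"
    using eventually_ge_at_top[of "max m 1"]
  proof eventually_elim
    case (elim n)
    then have "0 < rate \<Lambda> \<tau> n" using Lambda_gt_1 by (intro rate_pos) auto
    then show ?case using vertex_degree_eq[OF vm, of n] elim by simp
  qed
  ultimately have "(\<lambda>n. real (vertex_degree (G n) v) / real (max_degree (G n))) \<longlonglongrightarrow> c_top (type_at m v) / \<Lambda> ^ m / deg_norm"
    by (rule Lim_transform_eventually)
  then show ?thesis unfolding deg_hat_def by (rule limI)
qed

end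

section \<open>The degree spectrum\<close>

lemma ln_real_over_real_tendsto_0: "(\<lambda>n. ln (real n) / real n) \<longlonglongrightarrow> 0"
  using filterlim_compose[OF ln_x_over_x_tendsto_0 filterlim_real_sequentially] .

text \<open>The logarithm of the polynomial factor is of order ln n and that of the quotient by the
  rate is bounded; both vanish after division by n.\<close>

lemma ln_grows:
  assumes "grows f (L, q)" "0 < L"
  shows "(\<lambda>n. ln (f n) / real n) \<longlonglongrightarrow> ln L"
proof -
  obtain c where c: "0 < c" "(\<lambda>n. f n / rate L q n) \<longlonglongrightarrow> c"
    using assms by (auto simp: grows_def)
  have "(\<lambda>n. ln (f n / rate L q n) * inverse (real n) + real (q - 1) * (ln (real n) / real n) + ln L)
      \<longlonglongrightarrow> ln c * 0 + real (q - 1) * 0 + ln L"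
    using c by (intro tendsto_add tendsto_mult tendsto_const tendsto_ln lim_inverse_n ln_real_over_real_tendsto_0) auto
  moreover have "\<forall>\<^sub>F n in sequentially. ln (f n / rate L q n) * inverse (real n) + real (q - 1) * (ln (real n) / real n) + ln L
      = ln (f n) / real n"
    using order_tendstoD(1)[OF c(2,1)] eventually_gt_at_top[of 0]
  proof eventually_elim
    case (elim n)
    have r: "0 < rate L q n" using rate_pos[OF assms(2) elim(2)] .
    then have f: "0 < f n" using elim(1) by (simp add: zero_less_divide_iff)
    have "ln (f n / rate L q n) = ln (f n) - ln (rate L q n)" using f r by (simp add: ln_div)
    also have "ln (rate L q n) = real (q - 1) * ln (real n) + real n * ln L"
      unfolding rate_def using elim assms by (simp add: ln_mult ln_realpow)
    finally show ?case using elim by (simp add: field_simps)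
  qed
  ultimately show ?thesis using Lim_transform_eventually by fastforce
qed

text \<open>The shift k is an integer of either sign, since the types of a class may be ahead of or
  behind the reference type.\<close>

lemma ln_shifted:
  assumes "(\<lambda>n. ln (f n) / real n) \<longlonglongrightarrow> l"
  shows "(\<lambda>n. ln (f (nat (int n - k))) / real n) \<longlonglongrightarrow> l"
proof -
  have lim: "filterlim (\<lambda>n. nat (int n - k)) at_top sequentially"
    unfolding filterlim_at_top
  proof
    fix Z
    show "\<forall>\<^sub>F n in sequentially. Z \<le> nat (int n - k)"
      using eventually_ge_at_top[of "nat (int Z + \<bar>k\<bar>)"] by eventually_elim auto
  qed
  have "(\<lambda>n. ln (f (nat (int n - k))) / real (nat (int n - k)) * (1 - real_of_int k * inverse (real n)))
      \<longlonglongrightarrow> l * (1 - real_of_int k * 0)"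
    by (intro tendsto_mult tendsto_diff tendsto_const lim_inverse_n filterlim_compose[OF assms lim])
  moreover have "\<forall>\<^sub>F n in sequentially. ln (f (nat (int n - k))) / real (nat (int n - k)) * (1 - real_of_int k * inverse (real n))
      = ln (f (nat (int n - k))) / real n"
    using eventually_gt_at_top[of "nat \<bar>k\<bar>"]
  proof eventually_elim
    case (elim n)
    then have n: "0 < n" "0 < int n - k" by auto
    then have "real (nat (int n - k)) = real n - real_of_int k" by simp
    moreover have "0 < real n - real_of_int k" using n by linarith
    moreover have "1 - real_of_int k * inverse (real n) = (real n - real_of_int k) / real n"
      using n by (simp add: field_simps)
    ultimately show ?case by simp
  qed
  ultimately show ?thesis using Lim_transform_eventually by fastforce
qed

text \<open>The sum lies between its largest term and \<open>card A\<close> times that term, which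
  changes the logarithm by a bounded amount only.\<close>

lemma ln_sum_limit:
  fixes f :: "'a \<Rightarrow> nat \<Rightarrow> real"
  assumes "finite A" "A \<noteq> {}" and pos: "\<And>i. i \<in> A \<Longrightarrow> \<forall>\<^sub>F n in sequentially. 0 < f i n"
    and lim: "\<And>i. i \<in> A \<Longrightarrow> (\<lambda>n. ln (f i n) / real n) \<longlonglongrightarrow> l i"
  shows "(\<lambda>n. ln (\<Sum>i\<in>A. f i n) / real n) \<longlonglongrightarrow> Max (l ` A)"
proof (rule tendsto_sandwich)
  let ?M = "\<lambda>n. Max ((\<lambda>i. ln (f i n) / real n) ` A)"
  show M: "?M \<longlonglongrightarrow> Max (l ` A)" by (intro tendsto_Max_image assms)
  have "(\<lambda>n. ?M n + ln (real (card A)) * inverse (real n)) \<longlonglongrightarrow> Max (l ` A) + ln (real (card A)) * 0"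
    by (intro tendsto_add tendsto_mult tendsto_const lim_inverse_n M)
  then show "(\<lambda>n. ?M n + ln (real (card A)) * inverse (real n)) \<longlonglongrightarrow> Max (l ` A)" by simp
  have ev: "\<forall>\<^sub>F n in sequentially. (\<forall>i\<in>A. 0 < f i n) \<and> 0 < n"
    using pos assms(1) by (intro eventually_conj eventually_ball_finite eventually_gt_at_top) auto
  from ev show "\<forall>\<^sub>F n in sequentially. ?M n \<le> ln (\<Sum>i\<in>A. f i n) / real n"
  proof eventually_elim
    case (elim n)
    have "ln (f i n) \<le> ln (\<Sum>i\<in>A. f i n)" if "i \<in> A" for i
    proof -
      have "f i n \<le> (\<Sum>i\<in>A. f i n)"
        by (rule member_le_sum[OF that]) (use elim assms in \<open>auto intro: less_imp_le\<close>)
      then show ?thesis using elim that by (intro ln_mono) (auto intro: less_le_trans)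
    qed
    then show ?case using assms(1,2) by (auto intro!: divide_right_mono)
  qed
  from ev show "\<forall>\<^sub>F n in sequentially. ln (\<Sum>i\<in>A. f i n) / real n \<le> ?M n + ln (real (card A)) * inverse (real n)"
  proof eventually_elim
    case (elim n)
    have "Max ((\<lambda>i. f i n) ` A) \<in> (\<lambda>i. f i n) ` A" using assms by (intro Max_in) auto
    then obtain j where j: "j \<in> A" "Max ((\<lambda>i. f i n) ` A) = f j n" by auto
    have "f i n \<le> f j n" if "i \<in> A" for i unfolding j(2)[symmetric] using assms that by (intro Max_ge) auto
    then have "(\<Sum>i\<in>A. f i n) \<le> real (card A) * f j n" by (rule sum_bounded_above)
    moreover have "0 < (\<Sum>i\<in>A. f i n)" using elim assms by (intro sum_pos) auto
    ultimately have "ln (\<Sum>i\<in>A. f i n) \<le> ln (real (card A) * f j n)" by (intro ln_mono) auto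
    also have "\<dots> = ln (f j n) + ln (real (card A))"
      using elim j assms by (subst ln_mult) (auto simp: card_gt_0_iff)
    finally have "ln (\<Sum>i\<in>A. f i n) / real n \<le> (ln (f j n) + ln (real (card A))) / real n"
      by (intro divide_right_mono) auto
    also have "\<dots> = ln (f j n) / real n + ln (real (card A)) * inverse (real n)"
      by (simp only: divide_inverse distrib_right)
    also have "ln (f j n) / real n \<le> ?M n" using assms j by (intro Max_ge) auto
    finally show ?case by simp
  qed
qed

section \<open>Levels of the rescaled degree and their multiplicities\<close>

context eigs_frobenius
begin

abbreviation "B u m \<equiv> real (birth_count S \<iota> u m)"
abbreviation "I \<equiv> I_deg_surv S \<iota>"

lemma I_eq: "I = {u \<in> top_types. \<forall>m0. \<exists>m\<ge>m0. birth_count S \<iota> u m > 0}"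
proof -
  have "u \<noteq> 0\<^sub>v (2 * K)" if "u \<in> U" for u
    using birth_type_pos[OF that] by force
  then show ?thesis by (auto simp: I_deg_surv_def top_types_def)
qed

lemma finite_top_types: "finite top_types"
  using finite_birth_types by (simp add: top_types_def)

lemma finite_I: "finite I"
  using finite_top_types by (simp add: I_eq)

text \<open>The definite description is evaluated by the uniqueness of growth rates; survival
  excludes the bottom rate.\<close>

lemma Lambda_M_grows:
  assumes u: "u \<in> I"
  shows "0 < Lambda_M S \<iota> u" and "\<exists>q. grows (B u) (Lambda_M S \<iota> u, q)"
proof -
  obtain P where "grows (\<lambda>n. M.traj n (inner_count u) \<iota>) P"
    using M.grows_orbit[OF init, of "inner_count u"] by (auto simp: inner_count_def)
  then have P: "grows (\<lambda>n. B u (Suc n)) P" by (simp only: birth_count_Suc)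
  have "P \<noteq> (0, 0)"
  proof
    assume "P = (0, 0)"
    then have "B u (Suc n) = 0" for n using P by (auto simp: grows_def dest: fun_cong)
    \<comment> \<open>Survival provides a birth in a generation m \<ge> 1; the mass matrix describes
      births only from generation 1 on.\<close>
    moreover obtain m where m: "1 \<le> m" "birth_count S \<iota> u m > 0" using u unfolding I_eq by blast
    moreover have "Suc (m - 1) = m" using m by simp
    ultimately show False by (metis of_nat_0_eq_iff less_irrefl)
  qed
  then have gP: "grows (B u) P" using grows_unshift[OF P] by blast
  obtain L q where LQ: "P = (L, q)" by (cases P)
  have Lq: "grows (B u) (L, q)" "0 < L" "1 \<le> q" using gP \<open>P \<noteq> (0, 0)\<close> unfolding LQ by (auto simp: grows_def)
  have iff: "(\<exists>q\<ge>1. asymp_const (\<lambda>m. B u m) (\<lambda>m. real m ^ (q - 1) * L' ^ m)) \<longleftrightarrow> L' = L" if "0 < L'" for L'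
  proof
    assume "\<exists>q\<ge>1. asymp_const (\<lambda>m. B u m) (\<lambda>m. real m ^ (q - 1) * L' ^ m)"
    then obtain q' c where "1 \<le> q'" "0 < c" "(\<lambda>m. B u m / rate L' q' m) \<longlonglongrightarrow> c"
      by (auto simp: asymp_const_def rate_def)
    then have "grows (B u) (L', q')" using that by (intro growsI)
    then have "(L, q) = (L', q')" by (rule grows_unique[OF Lq(1)])
    then show "L' = L" by simp
  next
    assume "L' = L"
    moreover obtain c where "0 < c" "(\<lambda>m. B u m / rate L q m) \<longlonglongrightarrow> c"
      using Lq by (auto simp: grows_def)
    ultimately show "\<exists>q\<ge>1. asymp_const (\<lambda>m. B u m) (\<lambda>m. real m ^ (q - 1) * L' ^ m)"
      using Lq(3) unfolding asymp_const_def rate_def by blast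
  qed
  have "Lambda_M S \<iota> u = L"
    unfolding Lambda_M_def by (rule the_equality) (use iff Lq(2) in auto)
  then show "0 < Lambda_M S \<iota> u" "\<exists>q. grows (B u) (Lambda_M S \<iota> u, q)" using Lq by auto
qed

text \<open>Survival by itself only gives births infinitely often; the positive limit against a rate
  excludes further gaps.\<close>

lemma births_eventually_positive:
  assumes u: "u \<in> I" shows "\<forall>\<^sub>F m in sequentially. 0 < B u m"
proof -
  obtain q c where c: "0 < c" "(\<lambda>m. B u m / rate (Lambda_M S \<iota> u) q m) \<longlonglongrightarrow> c"
    using Lambda_M_grows[OF u] by (auto simp: grows_def)
  show ?thesis
    using order_tendstoD(1)[OF c(2,1)] by eventually_elim (auto simp: zero_less_divide_iff)
qed

text \<open>For a top type u this is the rescaled degree of its vertices born in generation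
  m.\<close>

definition level :: "real vec \<Rightarrow> nat \<Rightarrow> real" where
  "level u m = c_deg S u / \<Lambda> ^ m / deg_norm"

lemma c_deg_pos: "u \<in> top_types \<Longrightarrow> 0 < c_deg S u"
  using c_deg_limit(1) by (simp add: top_types_def)

lemma level_pos: "u \<in> top_types \<Longrightarrow> 0 < level u m"
  using c_deg_pos deg_norm_pos Lambda_gt_1 by (simp add: level_def)

lemma level_less_iff: "u \<in> top_types \<Longrightarrow> level u m < level u n \<longleftrightarrow> n < m"
proof -
  assume "u \<in> top_types"
  then have a: "0 < c_deg S u / deg_norm" using c_deg_pos deg_norm_pos by simp
  have "level u k = (c_deg S u / deg_norm) * inverse (\<Lambda> ^ k)" for k
    by (simp add: level_def divide_inverse)
  then show ?thesis
    using Lambda_gt_1 by (simp only: mult_less_cancel_left_pos[OF a]) simp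
qed

lemma level_tendsto_0: "level u \<longlonglongrightarrow> 0"
proof -
  have "(\<lambda>m. c_deg S u * (1 / \<Lambda>) ^ m / deg_norm) \<longlonglongrightarrow> c_deg S u * 0 / deg_norm"
    using Lambda_gt_1 deg_norm_pos by (intro tendsto_intros LIMSEQ_power_zero) auto
  then show ?thesis by (simp add: level_def[abs_def] power_divide)
qed

text \<open>Cancelling the common constant leaves a power of \<Lambda> whose exponent is the
  difference of the generations. Coincidence of levels is thus the relation behind
  \<open>deg_equiv\<close>, here also for types that do not survive.\<close>

lemma level_eq_iff:
  assumes "u \<in> top_types" "v \<in> top_types"
  shows "level v n = level u m \<longleftrightarrow> c_deg S u / c_deg S v = \<Lambda> powi (int m - int n)"
proof -
  have pos: "0 < c_deg S u" "0 < c_deg S v" "0 < \<Lambda> ^ m" "0 < \<Lambda> ^ n" "0 < deg_norm"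
    using c_deg_pos assms Lambda_gt_1 deg_norm_pos by auto
  have "\<Lambda> powi (int m - int n) = \<Lambda> ^ m / \<Lambda> ^ n"
    using Lambda_gt_1 by (simp add: power_int_diff)
  moreover have "level v n = level u m \<longleftrightarrow> c_deg S v * \<Lambda> ^ m = c_deg S u * \<Lambda> ^ n"
  proof -
    have "level v n = level u m \<longleftrightarrow> c_deg S v / \<Lambda> ^ n = c_deg S u / \<Lambda> ^ m"
      unfolding level_def divide_cancel_right using pos by auto
    also have "\<dots> \<longleftrightarrow> c_deg S v * \<Lambda> ^ m = c_deg S u * \<Lambda> ^ n"
      by (rule frac_eq_eq) (use pos Lambda_gt_1 in auto)
    finally show ?thesis .
  qed
  moreover have "c_deg S u / c_deg S v = \<Lambda> ^ m / \<Lambda> ^ n \<longleftrightarrow> c_deg S u * \<Lambda> ^ n = \<Lambda> ^ m * c_deg S v"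
    by (rule frac_eq_eq) (use pos Lambda_gt_1 in auto)
  ultimately show ?thesis by (auto simp: mult.commute)
qed

definition sources :: "real \<Rightarrow> (real vec \<times> nat) set" where
  "sources l = {(u, m). u \<in> top_types \<and> level u m = l}"

text \<open>Along one type the levels decrease strictly, so a level determines the generation. This
  also yields the finiteness of \<open>sources\<close>.\<close>

lemma sources_unique: "(u, m) \<in> sources l \<Longrightarrow> (u, n) \<in> sources l \<Longrightarrow> m = n"
  using level_less_iff[of u m n] level_less_iff[of u n m] by (auto simp: sources_def)

lemma finite_sources: "finite (sources l)"
proof -
  have "inj_on fst (sources l)" by (rule inj_onI) (metis prod.collapse sources_unique)
  moreover have "finite (fst ` sources l)"
    by (rule finite_subset[OF _ finite_top_types]) (auto simp: sources_def)
  ultimately show ?thesis using finite_image_iff by blast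
qed

text \<open>A positive level excludes all vertices whose type is not a top type, as their rescaled
  degree is 0. Different pairs give disjoint sets because a vertex has one generation of birth and
  one birth type.\<close>

lemma level_count_eq:
  assumes "0 < l"
  shows "level_count S \<iota> l = (\<Sum>(u, m)\<in>sources l. birth_count S \<iota> u m)"
proof -
  let ?S = "\<lambda>(u, m). {v \<in> born S \<iota> m. type_at m v = u}"
  have "{v \<in> Xi_verts S \<iota>. deg_hat S \<iota> v = l} = (\<Union>p\<in>sources l. ?S p)"
  proof (rule Set.set_eqI)
    fix v
    have "v \<in> (\<Union>p\<in>sources l. ?S p)" if "v \<in> born S \<iota> m" "deg_hat S \<iota> v = l" for m
    proof -
      have l: "c_top (type_at m v) / \<Lambda> ^ m / deg_norm = l" using deg_hat_eq[OF that(1)] that by simp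
      then have "type_at m v \<in> top_types" using \<open>0 < l\<close> by (auto simp: c_top_def split: if_splits)
      then have "(type_at m v, m) \<in> sources l" using l by (simp add: sources_def level_def c_top_def)
      then show ?thesis using that by auto
    qed
    moreover have "deg_hat S \<iota> v = l \<and> v \<in> Xi_verts S \<iota>" if p: "p \<in> sources l" and "v \<in> ?S p" for p
    proof -
      obtain u m where um: "p = (u, m)" by (cases p)
      then have "v \<in> born S \<iota> m" "type_at m v = u" using that by auto
      then show ?thesis using deg_hat_eq[of v m] p um by (auto simp: sources_def level_def c_top_def Xi_verts_eq)
    qed
    ultimately show "v \<in> {v \<in> Xi_verts S \<iota>. deg_hat S \<iota> v = l} \<longleftrightarrow> v \<in> (\<Union>p\<in>sources l. ?S p)"
      by (auto simp: Xi_verts_eq)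
  qed
  then have "level_count S \<iota> l = card (\<Union>p\<in>sources l. ?S p)" by (simp add: level_count_def)
  also have "\<dots> = (\<Sum>p\<in>sources l. card (?S p))"
  proof (rule card_UN_disjoint[OF finite_sources])
    show "\<forall>p\<in>sources l. finite (?S p)" using finite_born by (auto split: prod.splits)
    show "\<forall>p\<in>sources l. \<forall>q\<in>sources l. p \<noteq> q \<longrightarrow> ?S p \<inter> ?S q = {}"
    proof (intro ballI impI equals0I)
      fix p q v assume "p \<noteq> q" "v \<in> ?S p \<inter> ?S q"
      then show False using born_unique[of v "snd p" "snd q"] by (auto split: prod.splits)
    qed
  qed
  also have "\<dots> = (\<Sum>(u, m)\<in>sources l. birth_count S \<iota> u m)"
    by (rule sum.cong) (auto simp: birth_count_def)
  finally show ?thesis .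
qed

lemma nonsurviving_bound:
  obtains N where "\<And>u m. u \<in> top_types \<Longrightarrow> u \<notin> I \<Longrightarrow> N \<le> m \<Longrightarrow> birth_count S \<iota> u m = 0"
proof -
  have "\<forall>u\<in>top_types - I. \<exists>n. \<forall>m\<ge>n. birth_count S \<iota> u m = 0"
    by (auto simp: I_eq)
  then obtain n where n: "\<And>u m. u \<in> top_types - I \<Longrightarrow> n u \<le> m \<Longrightarrow> birth_count S \<iota> u m = 0"
    by metis
  have fin: "finite (n ` (top_types - I))" using finite_top_types by auto
  show ?thesis
  proof (rule that[of "Max (insert 0 (n ` (top_types - I)))"])
    fix u m assume u: "u \<in> top_types" "u \<notin> I" and m: "Max (insert 0 (n ` (top_types - I))) \<le> m"
    have "n u \<le> Max (insert 0 (n ` (top_types - I)))" using fin u by (intro Max_ge) auto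
    then show "birth_count S \<iota> u m = 0" using n[of u m] u m by auto
  qed
qed

abbreviation "cls u \<equiv> deg_equiv S \<iota> `` {u}"

lemma mem_cls: "v \<in> cls u \<longleftrightarrow> u \<in> I \<and> v \<in> I \<and> (\<exists>k. c_deg S u / c_deg S v = \<Lambda> powi k)"
  by (auto simp: deg_equiv_def)

lemma self_in_cls: "u \<in> I \<Longrightarrow> u \<in> cls u"
  unfolding mem_cls using c_deg_pos[of u] by (auto simp: I_eq intro!: exI[of _ 0])

lemma finite_cls: "finite (cls u)"
  by (rule finite_subset[OF _ finite_I]) (use mem_cls in blast)

text \<open>Eventually only the types of the class of \<open>u\<close> contribute to the levels of \<open>u\<close>, each with one
  generation that is shifted by a constant.\<close>

lemma level_count_class:
  assumes u: "u \<in> I"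
  obtains k where "\<forall>\<^sub>F m in sequentially. real (level_count S \<iota> (level u m)) = (\<Sum>v\<in>cls u. B v (nat (int m - k v)))"
proof -
  have ut: "u \<in> top_types" using u by (simp add: I_eq)
  \<comment> \<open>All top types that can share a level with u, surviving or not; the class of u is
    the surviving part.\<close>
  define E where "E = {v \<in> top_types. \<exists>k. c_deg S u / c_deg S v = \<Lambda> powi k}"
  have E: "finite E" "cls u = E \<inter> I"
  proof -
    show "finite E" using finite_top_types by (simp add: E_def)
    show "cls u = E \<inter> I"
    proof (rule Set.set_eqI)
      show "v \<in> cls u \<longleftrightarrow> v \<in> E \<inter> I" for v
        unfolding mem_cls E_def using u by (auto simp: I_eq)
    qed
  qed
  obtain k where k: "\<And>v. v \<in> E \<Longrightarrow> c_deg S u / c_deg S v = \<Lambda> powi k v"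
    using bchoice[of E "\<lambda>v j. c_deg S u / c_deg S v = \<Lambda> powi j"] unfolding E_def by blast
  obtain N where N: "\<And>u m. u \<in> top_types \<Longrightarrow> u \<notin> I \<Longrightarrow> N \<le> m \<Longrightarrow> birth_count S \<iota> u m = 0"
    using nonsurviving_bound by blast
  \<comment> \<open>From here on m - k v is nonnegative, so \<open>nat\<close> does not truncate it,
    and it is at least N, so the members of E that die out contribute nothing.\<close>
  have "\<forall>\<^sub>F m in sequentially. \<forall>v\<in>E. int N + \<bar>k v\<bar> \<le> int m"
  proof (intro eventually_ball_finite E ballI)
    fix v
    show "\<forall>\<^sub>F m in sequentially. int N + \<bar>k v\<bar> \<le> int m"
      using eventually_ge_at_top[of "nat (int N + \<bar>k v\<bar>)"] by eventually_elim simp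
  qed
  then have "\<forall>\<^sub>F m in sequentially. real (level_count S \<iota> (level u m)) = (\<Sum>v\<in>cls u. B v (nat (int m - k v)))"
  proof eventually_elim
    case (elim m)
    let ?\<mu> = "\<lambda>v. nat (int m - k v)"
    have src: "sources (level u m) = (\<lambda>v. (v, ?\<mu> v)) ` E"
    proof (intro equalityI subsetI)
      fix p assume "p \<in> sources (level u m)"
      then obtain v n where p: "p = (v, n)" "v \<in> top_types" "level v n = level u m" by (auto simp: sources_def)
      then have eq: "c_deg S u / c_deg S v = \<Lambda> powi (int m - int n)" using level_eq_iff[OF ut] by simp
      then have vE: "v \<in> E" using p by (auto simp: E_def)
      have "\<Lambda> powi (int m - int n) = \<Lambda> powi k v" using eq k[OF vE] by simp
      \<comment> \<open>A power of \<Lambda> > 1 determines its exponent, so the shift does not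
        depend on m.\<close>
      then have "int m - int n = k v"
        using Lambda_gt_1 power_int_strict_increasing[of _ _ \<Lambda>] by (metis less_irrefl linorder_neqE_linordered_idom)
      then show "p \<in> (\<lambda>v. (v, ?\<mu> v)) ` E" using vE p by auto
    next
      fix p assume "p \<in> (\<lambda>v. (v, ?\<mu> v)) ` E"
      then obtain v where v: "v \<in> E" "p = (v, ?\<mu> v)" by auto
      then have vt: "v \<in> top_types" by (simp add: E_def)
      have "int m - int (?\<mu> v) = k v" using elim v by fastforce
      then have "level v (?\<mu> v) = level u m" using level_eq_iff[OF ut vt] k[OF v(1)] by simp
      then show "p \<in> sources (level u m)" using v vt by (simp add: sources_def)
    qed
    have "level_count S \<iota> (level u m) = (\<Sum>v\<in>E. birth_count S \<iota> v (?\<mu> v))"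
      unfolding level_count_eq[OF level_pos[OF ut]] src by (subst sum.reindex) (auto simp: inj_on_def)
    also have "\<dots> = (\<Sum>v\<in>cls u. birth_count S \<iota> v (?\<mu> v))"
    proof (rule sum.mono_neutral_right[OF E(1)])
      show "\<forall>v\<in>E - cls u. birth_count S \<iota> v (?\<mu> v) = 0"
      proof
        fix v assume v: "v \<in> E - cls u"
        then have "int N + \<bar>k v\<bar> \<le> int m" using elim by auto
        then have "N \<le> ?\<mu> v" by linarith
        then show "birth_count S \<iota> v (?\<mu> v) = 0" using v E(2) by (intro N) (auto simp: E_def)
      qed
    qed (use E in auto)
    finally show ?case by simp
  qed
  then show ?thesis by (rule that)
qed

lemma births_shift_positive:
  assumes "v \<in> I" shows "\<forall>\<^sub>F m in sequentially. 0 < B v (nat (int m - k))"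
proof -
  obtain N where N: "\<And>m. N \<le> m \<Longrightarrow> 0 < B v m"
    using births_eventually_positive[OF assms] by (auto simp: eventually_sequentially)
  show ?thesis using eventually_ge_at_top[of "nat (int N + \<bar>k\<bar>)"] by eventually_elim (rule N, linarith)
qed

lemma level_count_positive:
  assumes u: "u \<in> I" shows "\<forall>\<^sub>F m in sequentially. 0 < level_count S \<iota> (level u m)"
proof -
  obtain k where k: "\<forall>\<^sub>F m in sequentially. real (level_count S \<iota> (level u m)) = (\<Sum>v\<in>cls u. B v (nat (int m - k v)))"
    using level_count_class[OF u] by blast
  from k births_shift_positive[OF u, of "k u"] show ?thesis
  proof eventually_elim
    case (elim m)
    have "0 < (\<Sum>v\<in>cls u. B v (nat (int m - k v)))"
      by (rule sum_pos2[OF finite_cls self_in_cls[OF u]]) (use elim in auto)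
    then show ?case using elim(1) by simp
  qed
qed

lemma ln_Lambda_eff:
  assumes u: "u \<in> I"
  shows "Max ((\<lambda>v. ln (Lambda_M S \<iota> v)) ` cls u) = ln (Lambda_eff S \<iota> (cls u))" and "0 < Lambda_eff S \<iota> (cls u)"
proof -
  have "Lambda_eff S \<iota> (cls u) \<in> Lambda_M S \<iota> ` cls u"
    unfolding Lambda_eff_def using finite_cls self_in_cls[OF u] by (intro Max_in) auto
  then obtain v where v: "v \<in> cls u" "Lambda_eff S \<iota> (cls u) = Lambda_M S \<iota> v" by auto
  have pos: "0 < Lambda_M S \<iota> w" if "w \<in> cls u" for w using that Lambda_M_grows(1) mem_cls by blast
  then show "0 < Lambda_eff S \<iota> (cls u)" using v by simp
  show "Max ((\<lambda>v. ln (Lambda_M S \<iota> v)) ` cls u) = ln (Lambda_eff S \<iota> (cls u))"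
  proof (rule Max_eqI)
    fix y assume "y \<in> (\<lambda>v. ln (Lambda_M S \<iota> v)) ` cls u"
    then obtain w where w: "w \<in> cls u" "y = ln (Lambda_M S \<iota> w)" by auto
    have "Lambda_M S \<iota> w \<le> Lambda_eff S \<iota> (cls u)" unfolding Lambda_eff_def using finite_cls w by (intro Max_ge) auto
    then show "y \<le> ln (Lambda_eff S \<iota> (cls u))" unfolding w(2) by (intro ln_mono pos w)
  qed (use finite_cls v in auto)
qed

text \<open>Divide numerator and denominator by m: the former tends to the logarithm of the largest
  birth rate in the class, the latter is linear in m up to a constant and tends to ln
  \<Lambda>.\<close>

lemma class_exponent:
  assumes u: "u \<in> I"
  shows "(\<lambda>m. ln (real (level_count S \<iota> (level u m))) / (- ln (level u m)))
    \<longlonglongrightarrow> ln (Lambda_eff S \<iota> (cls u)) / ln \<Lambda>"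
proof -
  have ut: "u \<in> top_types" using u by (simp add: I_eq)
  obtain k where k: "\<forall>\<^sub>F m in sequentially. real (level_count S \<iota> (level u m)) = (\<Sum>v\<in>cls u. B v (nat (int m - k v)))"
    using level_count_class[OF u] by blast
  have "(\<lambda>m. ln (\<Sum>v\<in>cls u. B v (nat (int m - k v))) / real m) \<longlonglongrightarrow> Max ((\<lambda>v. ln (Lambda_M S \<iota> v)) ` cls u)"
  proof (rule ln_sum_limit[OF finite_cls])
    show "cls u \<noteq> {}" using self_in_cls[OF u] by auto
    fix v assume "v \<in> cls u"
    then have v: "v \<in> I" using mem_cls by blast
    then show "\<forall>\<^sub>F m in sequentially. 0 < B v (nat (int m - k v))" by (rule births_shift_positive)
    obtain q where "grows (B v) (Lambda_M S \<iota> v, q)" using Lambda_M_grows(2)[OF v] by blast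
    then show "(\<lambda>m. ln (B v (nat (int m - k v))) / real m) \<longlonglongrightarrow> ln (Lambda_M S \<iota> v)"
      by (intro ln_shifted ln_grows Lambda_M_grows(1)[OF v])
  qed
  then have num: "(\<lambda>m. ln (\<Sum>v\<in>cls u. B v (nat (int m - k v))) / real m) \<longlonglongrightarrow> ln (Lambda_eff S \<iota> (cls u))"
    unfolding ln_Lambda_eff(1)[OF u] .
  have den: "(\<lambda>m. ln \<Lambda> - ln (c_deg S u / deg_norm) * inverse (real m)) \<longlonglongrightarrow> ln \<Lambda> - ln (c_deg S u / deg_norm) * 0"
    by (intro tendsto_diff tendsto_mult tendsto_const lim_inverse_n)
  have "(\<lambda>m. (ln (\<Sum>v\<in>cls u. B v (nat (int m - k v))) / real m) / (ln \<Lambda> - ln (c_deg S u / deg_norm) * inverse (real m)))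
    \<longlonglongrightarrow> ln (Lambda_eff S \<iota> (cls u)) / (ln \<Lambda> - ln (c_deg S u / deg_norm) * 0)"
    using Lambda_gt_1 by (intro tendsto_divide num den) auto
  moreover have "\<forall>\<^sub>F m in sequentially. (ln (\<Sum>v\<in>cls u. B v (nat (int m - k v))) / real m) / (ln \<Lambda> - ln (c_deg S u / deg_norm) * inverse (real m))
    = ln (real (level_count S \<iota> (level u m))) / (- ln (level u m))"
    using k eventually_gt_at_top[of 0]
  proof eventually_elim
    case (elim m)
    have "level u m = (c_deg S u / deg_norm) / \<Lambda> ^ m" by (simp add: level_def)
    also have "ln \<dots> = ln (c_deg S u / deg_norm) - real m * ln \<Lambda>"
      using c_deg_pos[OF ut] deg_norm_pos Lambda_gt_1 by (subst ln_div) (auto simp: ln_realpow)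
    finally have "- ln (level u m) = real m * (ln \<Lambda> - ln (c_deg S u / deg_norm) * inverse (real m))"
      using elim(2) by (simp add: right_diff_distrib)
    then show ?case using elim by simp
  qed
  ultimately show ?thesis using Lim_transform_eventually by fastforce
qed

section \<open>The degree spectrum and the BEDM condition\<close>

lemma deg_classes_eq: "deg_classes S \<iota> = cls ` I"
  by (auto simp: deg_classes_def quotient_def)

text \<open>The levels of u themselves form an admissible sequence once the initial generations,
  where a level might be unpopulated, are dropped.\<close>

lemma exponent_in_spectrum:
  assumes u: "u \<in> I"
  shows "ln (Lambda_eff S \<iota> (cls u)) / ln \<Lambda> \<in> degree_spectrum S \<iota>"
proof -
  have ut: "u \<in> top_types" using u by (simp add: I_eq)
  obtain N where N: "\<And>m. N \<le> m \<Longrightarrow> 0 < level_count S \<iota> (level u m)"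
    using level_count_positive[OF u] by (auto simp: eventually_sequentially)
  let ?l = "\<lambda>m. level u (m + N)"
  have "decseq ?l" by (rule decseq_SucI) (simp add: level_less_iff[OF ut] less_imp_le)
  moreover have "?l \<longlonglongrightarrow> 0" by (rule LIMSEQ_ignore_initial_segment[OF level_tendsto_0])
  moreover have "(\<lambda>m. ln (real (level_count S \<iota> (?l (id m)))) / (- ln (?l (id m)))) \<longlonglongrightarrow> ln (Lambda_eff S \<iota> (cls u)) / ln \<Lambda>"
    using LIMSEQ_ignore_initial_segment[OF class_exponent[OF u], of N] by simp
  ultimately show ?thesis
    unfolding degree_spectrum_def mem_Collect_eq
    by (intro exI[of _ ?l] conjI allI level_pos ut N exI[of _ id]) (auto simp: strict_mono_def)
qed

text \<open>Small populated levels are levels of surviving types. As these are finitely many, one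
  type u accounts for infinitely many members of the given sequence, and along them the quotients
  converge to the exponent of the class of u.\<close>

lemma spectrum_subset:
  assumes "x \<in> degree_spectrum S \<iota>"
  obtains u where "u \<in> I" "x = ln (Lambda_eff S \<iota> (cls u)) / ln \<Lambda>"
proof -
  obtain l r where l: "l \<longlonglongrightarrow> 0" "\<And>m. 0 < l m" "\<And>m. 0 < level_count S \<iota> (l m)" "strict_mono r"
    "(\<lambda>m. ln (real (level_count S \<iota> (l (r m)))) / (- ln (l (r m)))) \<longlonglongrightarrow> x"
    using assms unfolding degree_spectrum_def by blast
  have lr: "(\<lambda>m. l (r m)) \<longlonglongrightarrow> 0" using LIMSEQ_subseq_LIMSEQ[OF l(1,4)] by (simp add: o_def)
  obtain N where N: "\<And>u m. u \<in> top_types \<Longrightarrow> u \<notin> I \<Longrightarrow> N \<le> m \<Longrightarrow> birth_count S \<iota> u m = 0"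
    using nonsurviving_bound by blast
  \<comment> \<open>A level of u below \<open>level u N\<close> belongs to a generation after N,
    where types that do not survive have no births.\<close>
  have "\<forall>\<^sub>F m in sequentially. \<forall>u\<in>top_types. l (r m) < level u N"
    using finite_top_types order_tendstoD(2)[OF lr] level_pos by (intro eventually_ball_finite) auto
  then have "\<forall>\<^sub>F m in sequentially. \<exists>u\<in>I. \<exists>n. l (r m) = level u n"
  proof eventually_elim
    case (elim m)
    have "(\<Sum>(u, n)\<in>sources (l (r m)). birth_count S \<iota> u n) \<noteq> 0"
      using l(3)[of "r m"] level_count_eq[OF l(2)] by simp
    then obtain p where p: "p \<in> sources (l (r m))" "(case p of (u, n) \<Rightarrow> birth_count S \<iota> u n) \<noteq> 0"
      by (rule sum.not_neutral_contains_not_neutral)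
    then obtain u n where un: "u \<in> top_types" "level u n = l (r m)" "birth_count S \<iota> u n \<noteq> 0"
      by (cases p) (auto simp: sources_def)
    have "level u n < level u N" using elim un by auto
    then have "N < n" by (simp only: level_less_iff[OF un(1)])
    then have "u \<in> I" using N[of u n] un by auto
    then show ?case using un(2) by metis
  qed
  then have "\<exists>\<^sub>F m in sequentially. \<exists>u\<in>I. \<exists>n. l (r m) = level u n"
    by (rule eventually_frequently[rotated]) simp
  then have "\<exists>u\<in>I. \<exists>\<^sub>F m in sequentially. \<exists>n. l (r m) = level u n"
    by (rule frequently_bex_finite[OF finite_I])
  then obtain u where u: "u \<in> I" "\<exists>\<^sub>F m in sequentially. \<exists>n. l (r m) = level u n" by blast
  have ut: "u \<in> top_types" using u by (simp add: I_eq)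
  have "infinite {m. \<exists>n. l (r m) = level u n}"
    using u(2) by (simp add: cofinite_eq_sequentially[symmetric] frequently_cofinite)
  then obtain s :: "nat \<Rightarrow> nat" where s: "strict_mono s" "\<And>j. s j \<in> {m. \<exists>n. l (r m) = level u n}"
    using infinite_enumerate by blast
  then have "\<forall>j. \<exists>n. l (r (s j)) = level u n" by simp
  from choice[OF this] obtain \<mu> where \<mu>: "\<And>j. l (r (s j)) = level u (\<mu> j)" by blast
  \<comment> \<open>The generations tend to infinity because the levels tend to 0 while each single
    level of u is positive.\<close>
  have "filterlim \<mu> at_top sequentially"
    unfolding filterlim_at_top
  proof
    fix Z
    have "(\<lambda>j. l (r (s j))) \<longlonglongrightarrow> 0" using LIMSEQ_subseq_LIMSEQ[OF lr s(1)] by (simp add: o_def)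
    then have "\<forall>\<^sub>F j in sequentially. l (r (s j)) < level u Z" using level_pos[OF ut] by (rule order_tendstoD(2))
    then show "\<forall>\<^sub>F j in sequentially. Z \<le> \<mu> j" by eventually_elim (simp add: \<mu> level_less_iff[OF ut])
  qed
  then have "(\<lambda>j. ln (real (level_count S \<iota> (level u (\<mu> j)))) / (- ln (level u (\<mu> j)))) \<longlonglongrightarrow> ln (Lambda_eff S \<iota> (cls u)) / ln \<Lambda>"
    by (rule filterlim_compose[OF class_exponent[OF u(1)]])
  moreover have "(\<lambda>j. ln (real (level_count S \<iota> (level u (\<mu> j)))) / (- ln (level u (\<mu> j)))) \<longlonglongrightarrow> x"
    using LIMSEQ_subseq_LIMSEQ[OF l(5) s(1)] by (simp add: o_def \<mu>)
  ultimately show ?thesis using LIMSEQ_unique that u(1) by blast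
qed

theorem spectrum_eq:
  "degree_spectrum S \<iota> = {ln (Lambda_eff S \<iota> Q) / ln \<Lambda> | Q. Q \<in> deg_classes S \<iota>}"
proof (intro equalityI subsetI)
  fix x assume "x \<in> degree_spectrum S \<iota>"
  then obtain u where "u \<in> I" "x = ln (Lambda_eff S \<iota> (cls u)) / ln \<Lambda>" by (rule spectrum_subset)
  then show "x \<in> {ln (Lambda_eff S \<iota> Q) / ln \<Lambda> | Q. Q \<in> deg_classes S \<iota>}" by (auto simp: deg_classes_eq)
next
  fix x assume "x \<in> {ln (Lambda_eff S \<iota> Q) / ln \<Lambda> | Q. Q \<in> deg_classes S \<iota>}"
  then obtain u where "u \<in> I" "x = ln (Lambda_eff S \<iota> (cls u)) / ln \<Lambda>" by (auto simp: deg_classes_eq)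
  then show "x \<in> degree_spectrum S \<iota>" using exponent_in_spectrum by simp
qed

text \<open>On positive bases the logarithm is injective and ln \<Lambda> is nonzero, so distinct
  effective bases give distinct points of the spectrum; it is finite because there are finitely many
  classes.\<close>

theorem BEDM_iff: "BEDM S \<iota> \<longleftrightarrow> finite_discrete_multiscale_free S \<iota>"
proof -
  let ?h = "\<lambda>Q. ln (Lambda_eff S \<iota> Q) / ln \<Lambda>"
  have D: "degree_spectrum S \<iota> = ?h ` deg_classes S \<iota>" unfolding spectrum_eq by auto
  have fin: "finite (degree_spectrum S \<iota>)" unfolding D deg_classes_eq using finite_I by simp
  have inj: "?h Q1 = ?h Q2 \<longleftrightarrow> Lambda_eff S \<iota> Q1 = Lambda_eff S \<iota> Q2"
    if "Q1 \<in> deg_classes S \<iota>" "Q2 \<in> deg_classes S \<iota>" for Q1 Q2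
    using that ln_Lambda_eff(2) Lambda_gt_1 by (auto simp: deg_classes_eq)
  have "1 < card (degree_spectrum S \<iota>) \<longleftrightarrow> \<not> (\<forall>x\<in>degree_spectrum S \<iota>. \<forall>y\<in>degree_spectrum S \<iota>. x = y)"
    using card_le_Suc0_iff_eq[OF fin] by auto
  also have "\<dots> \<longleftrightarrow> BEDM S \<iota>" unfolding D BEDM_def using inj by auto
  finally show ?thesis using fin by (simp add: finite_discrete_multiscale_free_def)
qed

end

theorem theorem4p13:
  fixes S :: "('v, 'e) eigs" and \<iota> :: nat
  assumes "is_eigs S"
    and "\<iota> < num_colours S"
    and "primitive_Frobenius (degree_mat S)"
    and "primitive_Frobenius (mass_mat S)"
    and "Lambda_U S \<iota> > 1"
  shows "degree_spectrum S \<iota> =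
           {ln (Lambda_eff S \<iota> Q) / ln (Lambda_U S \<iota>) | Q. Q \<in> deg_classes S \<iota>}
         \<and> (BEDM S \<iota> \<longleftrightarrow> finite_discrete_multiscale_free S \<iota>)"
proof -
  interpret eigs_frobenius S \<iota> by unfold_locales (fact assms)+
  show ?thesis using spectrum_eq BEDM_iff by blast
qed

end
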